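(* Let $\Omega$ be a bounded Lipschitz domain in $\mathbb{R}^n$, $n\ge2$, and let $Q>0$ be a constant such that $$Q\,P_\Omega(E)\ \ge\ \min\big(|E|,|\Omega\setminus E|\big)^{1-1/n}\qquad\text{for every measurable } E\subseteq\Omega .$$ Let $A$ be an N-function satisfying a $\Delta_2$-condition near infinity. If $u\in H^1\mathcal{L}_A(\Omega)$, then $\tilde u\in H^1_{\mathrm{loc}}\mathcal{L}_A(\tilde\Omega)$ and, for every $\epsilon\in(0,\tfrac{|\Omega|}{2})$, $$\|D\tilde u\|_{\mathcal{L}_A(\tilde\Omega_\epsilon)}\ \le\ \big(Q\,n\,c_n^{1/n}\big)\left(\frac{|\Omega|-\epsilon}{\epsilon}\right)^{1-1/n}\|Du\|_{\mathcal{L}_A(\Omega)},$$ where $\tilde\Omega_\epsilon$ is the ball centred at the origin with measure $|\Omega|-\epsilon$. Moreover, $u^*\in AC_{\mathrm{loc}}(\epsilon,|\Omega|-\epsilon)$ (i.e. $u^*$ is locally absolutely continuous on $(\epsilon,|\Omega|-\epsilon)$) for every $\epsilon>0$ (with $\epsilon<|\Omega|/2$).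
   Context: $|\cdot|$ denotes Lebesgue measure of sets, $c_n$ is the measure of the unit ball of $\mathbb{R}^n$, and $D$ denotes the gradient. $P_\Omega(E)$ is the De Giorgi perimeter of $E$ relative to $\Omega$; a constant $Q$ as in the claim exists for every bounded Lipschitz domain. For a real measurable function $u$ on $\Omega$ (possibly of changing sign): the distribution function is $\mu(t)=|\{x\in\Omega:u(x)>t\}|$, $t\in\mathbb{R}$; the decreasing rearrangement is $u^*(s)=\inf\{t\in\mathbb{R}:\mu(t)\le s\}$, $s\in[0,|\Omega|]$; the Schwarz symmetrization is $\tilde u(x)=u^*(c_n|x|^n)$, $x\in\tilde\Omega$, where $\tilde\Omega$ is the (open) ball centred at the origin with the same measure as $\Omega$. An N-function is an increasing continuous convex function $A:[0,+\infty)\to[0,+\infty)$ with $\lim_{t\to0}A(t)/t=0$ and $\lim_{t\to+\infty}A(t)/t=+\infty$. $A$ satisfies a $\Delta_2$-condition near infinity if there are $\delta>0$, $t_0>0$ with $A(2t)\le\delta A(t)$ for all $t\ge t_0$. The Orlicz space $\mathcal{L}_A(\Omega)$ consists of the measurable $u$ on $\Omega$ with $\int_\Omega A(|u|/\lambda)\,dx<+\infty$ for some $\lambda>0$, with norm $\|u\|_{\mathcal{L}_A(\Omega)}=\inf\{\lambda>0:\int_\Omega A(|u|/\lambda)\,dx\le1\}$; $\|Du\|_{\mathcal{L}_A}$ means the norm of $|Du|$. $H^1\mathcal{L}_A(\Omega)$ is the Orlicz-Sobolev space of functions in $\mathcal{L}_A(\Omega)$ whose weak first derivatives are in $\mathcal{L}_A(\Omega)$;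 $H^1_{\mathrm{loc}}\mathcal{L}_A(\tilde\Omega)$ is the set of functions belonging to $H^1\mathcal{L}_A(\omega)$ for every open $\omega$ compactly contained in $\tilde\Omega$. *)

theory Defs
  imports "HOL-Analysis.Analysis"
begin

subsection \<open>Bounded Lipschitz domains\<close>

text \<open>Near each boundary point \<open>\<Omega>\<close> is the region above a Lipschitz graph. The unit vector \<open>e\<close> plays
  the role of the last coordinate axis after a rotation, \<open>x - (x \<bullet> e) *\<^sub>R e\<close> that of the remaining
  coordinates.\<close>

definition bounded_lipschitz_domain :: "'a::euclidean_space set \<Rightarrow> bool" where
  "bounded_lipschitz_domain \<Omega> \<longleftrightarrow>
     open \<Omega> \<and> connected \<Omega> \<and> \<Omega> \<noteq> {} \<and> bounded \<Omega> \<and>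
     (\<forall>p \<in> frontier \<Omega>. \<exists>r>0. \<exists>e \<gamma> L. norm e = 1 \<and> L-lipschitz_on {y. y \<bullet> e = 0} \<gamma> \<and>
        \<Omega> \<inter> ball p r = {x \<in> ball p r. \<gamma> (x - (x \<bullet> e) *\<^sub>R e) < x \<bullet> e})"


subsection \<open>Test functions, perimeter, weak gradients\<close>

text \<open>Compactly supported \<open>C\<^sup>1\<close> maps; used with \<open>'b = real\<close> for weak derivatives and with \<open>'b = 'a\<close>
  for the perimeter. By mollification, \<open>C\<^sup>\<infinity>\<close> test functions give the same notions.\<close>

definition C1_compact_support ::
    "'a::euclidean_space set \<Rightarrow> ('a \<Rightarrow> 'b::real_normed_vector) set" where
  "C1_compact_support \<Omega> =
     {\<phi>. (\<forall>x. \<phi> differentiable (at x)) \<and>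
         (\<forall>v. continuous_on UNIV (\<lambda>x. frechet_derivative \<phi> (at x) v)) \<and>
         compact (closure {x. \<phi> x \<noteq> 0}) \<and> closure {x. \<phi> x \<noteq> 0} \<subseteq> \<Omega>}"

definition divergence :: "('a::euclidean_space \<Rightarrow> 'a) \<Rightarrow> 'a \<Rightarrow> real" where
  "divergence \<phi> x = (\<Sum>b\<in>Basis. frechet_derivative \<phi> (at x) b \<bullet> b)"

definition perimeter :: "'a::euclidean_space set \<Rightarrow> 'a set \<Rightarrow> ereal" where
  "perimeter \<Omega> E =
     (SUP \<phi> \<in> {\<phi> \<in> C1_compact_support \<Omega>. \<forall>x. norm (\<phi> x) \<le> 1}.
        ereal (LINT x|lebesgue_on E. divergence \<phi> x))"

definition locally_integrable ::
    "'a::euclidean_space set \<Rightarrow> ('a \<Rightarrow> 'b::euclidean_space) \<Rightarrow> bool" where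
  "locally_integrable \<Omega> f \<longleftrightarrow> (\<forall>K. compact K \<and> K \<subseteq> \<Omega> \<longrightarrow> integrable (lebesgue_on K) f)"

definition has_weak_gradient ::
    "'a::euclidean_space set \<Rightarrow> ('a \<Rightarrow> real) \<Rightarrow> ('a \<Rightarrow> 'a) \<Rightarrow> bool" where
  "has_weak_gradient \<Omega> u g \<longleftrightarrow>
     locally_integrable \<Omega> u \<and> locally_integrable \<Omega> g \<and>
     (\<forall>\<phi> \<in> C1_compact_support \<Omega>. \<forall>b \<in> Basis.
        (LINT x|lebesgue_on \<Omega>. u x * frechet_derivative \<phi> (at x) b) =
        - (LINT x|lebesgue_on \<Omega>. (g x \<bullet> b) * \<phi> x))"

text \<open>A representative of the weak gradient, which is unique up to null sets in \<open>\<Omega>\<close>. It is only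
  meaningful if a weak gradient exists.\<close>

definition weak_gradient :: "'a::euclidean_space set \<Rightarrow> ('a \<Rightarrow> real) \<Rightarrow> 'a \<Rightarrow> 'a" where
  "weak_gradient \<Omega> u = (SOME g. has_weak_gradient \<Omega> u g)"


subsection \<open>Rearrangements\<close>

definition distribution_function :: "'a::euclidean_space set \<Rightarrow> ('a \<Rightarrow> real) \<Rightarrow> real \<Rightarrow> real" where
  "distribution_function \<Omega> u t = measure lebesgue {x \<in> \<Omega>. u x > t}"

text \<open>The infimum over real \<open>t\<close> is taken in the extended reals: it is \<open>-\<infinity>\<close> at \<open>s = |\<Omega>|\<close> and may
  be \<open>\<infinity>\<close> at \<open>s = 0\<close>; for \<open>0 < s < |\<Omega>|\<close> and \<open>\<Omega>\<close> of finite measure it is finite.\<close>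

definition decreasing_rearrangement ::
    "'a::euclidean_space set \<Rightarrow> ('a \<Rightarrow> real) \<Rightarrow> real \<Rightarrow> ereal" where
  "decreasing_rearrangement \<Omega> u s = Inf {ereal t | t. distribution_function \<Omega> u t \<le> s}"

definition ball_const :: "'a::euclidean_space itself \<Rightarrow> real" where
  "ball_const _ = measure lebesgue (ball (0::'a) 1)"

definition ball_of_measure :: "real \<Rightarrow> 'a::euclidean_space set" where
  "ball_of_measure m = ball 0 ((m / ball_const TYPE('a)) powr (1 / DIM('a)))"

lemma measure_ball_of_measure:
  assumes "m \<ge> 0"
  shows "measure lebesgue (ball_of_measure m :: 'a::euclidean_space set) = m"
proof -
  have c: "ball_const TYPE('a) = unit_ball_vol DIM('a)"
    by (simp add: ball_const_def content_ball)
  have p: "unit_ball_vol DIM('a) > 0"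
    by simp
  define q where "q = m / unit_ball_vol DIM('a)"
  have q: "q \<ge> 0"
    using assms p by (simp add: q_def)
  have "(q powr (1 / DIM('a))) ^ DIM('a) = q"
  proof (cases "q = 0")
    case False
    then show ?thesis
      using q by (simp add: powr_powr flip: powr_realpow)
  qed simp
  then show ?thesis
    using p[THEN less_imp_neq, symmetric]
    by (simp add: ball_of_measure_def c content_ball q_def del: unit_ball_vol_pos)
qed

text \<open>\<open>real_of_ereal\<close> matters at most at the origin, the only point of the ball of measure \<open>|\<Omega>|\<close>
  where the rearrangement can be infinite.\<close>

definition schwarz_symmetrization ::
    "'a::euclidean_space set \<Rightarrow> ('a \<Rightarrow> real) \<Rightarrow> 'a \<Rightarrow> real" where
  "schwarz_symmetrization \<Omega> u x =
     real_of_ereal (decreasing_rearrangement \<Omega> u (ball_const TYPE('a) * norm x ^ DIM('a)))"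


subsection \<open>Orlicz and Orlicz--Sobolev spaces\<close>

text \<open>Only the values on \<open>[0, \<infinity>)\<close> matter. ``Increasing'' is understood in the weak sense, so that
  the strictly increasing functions are included.\<close>

definition N_function :: "(real \<Rightarrow> real) \<Rightarrow> bool" where
  "N_function A \<longleftrightarrow>
     (\<forall>t\<ge>0. A t \<ge> 0) \<and> mono_on {0..} A \<and> continuous_on {0..} A \<and> convex_on {0..} A \<and>
     ((\<lambda>t. A t / t) \<longlongrightarrow> 0) (at_right 0) \<and> filterlim (\<lambda>t. A t / t) at_top at_top"

definition Delta2_near_infinity :: "(real \<Rightarrow> real) \<Rightarrow> bool" where
  "Delta2_near_infinity A \<longleftrightarrow> (\<exists>\<delta>>0. \<exists>t0>0. \<forall>t\<ge>t0. A (2 * t) \<le> \<delta> * A t)"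

definition orlicz_modular ::
    "(real \<Rightarrow> real) \<Rightarrow> 'a::euclidean_space set \<Rightarrow> ('a \<Rightarrow> real) \<Rightarrow> ennreal" where
  "orlicz_modular A \<Omega> u = (\<integral>\<^sup>+ x. ennreal (A \<bar>u x\<bar>) \<partial>lebesgue_on \<Omega>)"

definition orlicz_space ::
    "(real \<Rightarrow> real) \<Rightarrow> 'a::euclidean_space set \<Rightarrow> ('a \<Rightarrow> real) set" where
  "orlicz_space A \<Omega> =
     {u \<in> borel_measurable (lebesgue_on \<Omega>).
        \<exists>k>0. orlicz_modular A \<Omega> (\<lambda>x. u x / k) < \<infinity>}"

text \<open>The norm takes values in \<open>[0, \<infinity>]\<close>, so that the infimum of the empty set is \<open>\<infinity>\<close>.\<close>

definition orlicz_norm ::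
    "(real \<Rightarrow> real) \<Rightarrow> 'a::euclidean_space set \<Rightarrow> ('a \<Rightarrow> real) \<Rightarrow> ennreal" where
  "orlicz_norm A \<Omega> u =
     Inf {ennreal k | k. k > 0 \<and> orlicz_modular A \<Omega> (\<lambda>x. u x / k) \<le> 1}"

definition orlicz_sobolev ::
    "(real \<Rightarrow> real) \<Rightarrow> 'a::euclidean_space set \<Rightarrow> ('a \<Rightarrow> real) set" where
  "orlicz_sobolev A \<Omega> =
     {u \<in> orlicz_space A \<Omega>.
        \<exists>g. has_weak_gradient \<Omega> u g \<and> (\<forall>b\<in>Basis. (\<lambda>x. g x \<bullet> b) \<in> orlicz_space A \<Omega>)}"

definition orlicz_sobolev_loc ::
    "(real \<Rightarrow> real) \<Rightarrow> 'a::euclidean_space set \<Rightarrow> ('a \<Rightarrow> real) set" where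
  "orlicz_sobolev_loc A \<Omega> =
     {u. \<forall>\<omega>. open \<omega> \<and> compact (closure \<omega>) \<and> closure \<omega> \<subseteq> \<Omega> \<longrightarrow> u \<in> orlicz_sobolev A \<omega>}"


subsection \<open>Absolute continuity\<close>

definition abs_continuous_on_interval :: "(real \<Rightarrow> real) \<Rightarrow> real \<Rightarrow> real \<Rightarrow> bool" where
  "abs_continuous_on_interval f a b \<longleftrightarrow>
     (\<forall>e>0. \<exists>d>0. \<forall>(n::nat) x y.
        (\<forall>i<n. a \<le> x i \<and> x i \<le> y i \<and> y i \<le> b) \<and>
        disjoint_family_on (\<lambda>i. {x i<..<y i}) {..<n} \<and>
        (\<Sum>i<n. y i - x i) < d \<longrightarrow> (\<Sum>i<n. \<bar>f (y i) - f (x i)\<bar>) < e)"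

definition AC_loc :: "(real \<Rightarrow> real) \<Rightarrow> real \<Rightarrow> real \<Rightarrow> bool" where
  "AC_loc f a b \<longleftrightarrow> (\<forall>c d. a < c \<and> c \<le> d \<and> d < b \<longrightarrow> abs_continuous_on_interval f c d)"

end

theory Submission
  imports Defs
begin

text \<open>Write \<open>V\<close> for the measure of \<open>\<Omega>\<close>, \<open>\<mu>\<close> for the distribution function of \<open>u\<close>, \<open>r\<close> for its decreasing
  rearrangement and \<open>p = 1 - 1/n\<close>. The proof has three steps.

  \<^emph>\<open>A growth inequality for \<open>r\<close>.\<close> The truncations \<open>((u - t)\<^sup>+ - (u - t - h)\<^sup>+) / h\<close> converge to the
  indicator of \<open>{u > t}\<close> as \<open>h\<close> tends to \<open>0\<close>. Testing them with a vector field of length at most \<open>1\<close>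
  and integrating by parts bounds the perimeter of \<open>{u > t}\<close> by the lower limit of
  \<open>1/h \<integral>|Du|\<close> over \<open>{t < u \<le> t + h}\<close> (\<open>perimeter_less_imp_growth\<close>); this holds for \<^emph>\<open>every\<close> height \<open>t\<close>.
  For \<open>r s' \<le> t < r s\<close> the measure \<open>\<mu> t\<close> lies between \<open>s\<close> and \<open>s'\<close>, so the isoperimetric inequality
  bounds the perimeter from below there by \<open>min s (V - s')\<^sup>p / Q\<close>, and a supremum argument
  (\<open>measure_ge_of_local_growth\<close>) integrates this over the heights:
  \<open>min s (V - s')\<^sup>p (r s - r s') \<le> Q \<integral>|Du|\<close> over \<open>{r s' < u < r s}\<close> (\<open>rearrangement_increment_le\<close>).
  The set on the right has measure at most \<open>s' - s\<close>, so the absolute continuity of the integral of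
  \<open>|Du|\<close> passes to \<open>r\<close> (\<open>rearrangement_abs_continuous\<close>).

  \<^emph>\<open>A modular inequality.\<close> Hence \<open>- r\<close> has a density \<open>f\<close> (\<open>slope_density\<close>). The difference quotients of
  \<open>- r\<close> are averages of \<open>f\<close>, so they converge to \<open>f\<close> almost everywhere along a sequence of steps \<open>h\<close>. By
  the growth inequality the quotient at \<open>s\<close> is at most a weight times \<open>1/h \<integral>|Du|\<close> over a set of measure at
  most \<open>h\<close>, to which Jensen's inequality applies. When \<open>s\<close> varies, a point \<open>x\<close> belongs to these sets
  only for \<open>s\<close> in an interval of length \<open>h\<close>; Fubini and Fatou therefore give
  \<open>\<integral>A(f / weight) \<le> \<integral>A(|Du|)\<close> (\<open>weighted_slope_modular_le\<close>, with the weight replaced by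
  a multiple of \<open>s\<^bsup>-p\<^esup>\<close> that dominates it).

  \<^emph>\<open>Back to the ball.\<close> The map \<open>x \<mapsto> c\<^sub>n|x|\<^sup>n\<close> (\<open>radial_volume\<close>) transports Lebesgue measure on the
  symmetrized ball to Lebesgue measure on \<open>(0, V)\<close>. Integration by parts for radial functions, proved
  for \<open>C\<^sup>1\<close> profiles and extended to absolutely continuous ones by \<open>L\<^sup>1\<close> approximation
  (\<open>radial_parts_L1\<close>, \<open>Dv_parts\<close>), shows that the symmetrization has a weak gradient of length
  \<open>n c\<^sub>n\<^bsup>1/n\<^esup> s\<^sup>p f s\<close> at \<open>s = c\<^sub>n|x|\<^sup>n\<close>. For \<open>s \<le> V - \<epsilon>\<close> the ratio \<open>s / min s (V - s)\<close> is at most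
  \<open>(V - \<epsilon>) / \<epsilon>\<close>, and this is where the constant of the theorem comes from.

  The chain rule for truncations, on which the first step depends, is obtained from difference
  quotients: these are averages of the weak gradient along segments (\<open>difference_eq_steklov\<close>), and such
  averages converge in \<open>L\<^sup>1\<close> (\<open>steklov_tendsto_L1\<close>). The same convergence identifies the limit of the
  difference quotients of \<open>r\<close> and smooths the radial profiles.\<close>

section \<open>Translations and averages along segments\<close>

lemma lborel_integral_translate:
  fixes f :: "'a::euclidean_space \<Rightarrow> 'b::{banach, second_countable_topology}"
  assumes [measurable]: "f \<in> borel_measurable borel"
  shows "(\<integral>x. f (x + z) \<partial>lborel) = (\<integral>x. f x \<partial>lborel)"
proof -
  have "(\<integral>x. f x \<partial>lborel) = (\<integral>x. f x \<partial>distr lborel borel ((+) z))"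
    by (simp add: lborel_distr_plus)
  also have "\<dots> = (\<integral>x. f (z + x) \<partial>lborel)"
    by (rule integral_distr) simp_all
  finally show ?thesis
    by (simp add: add.commute)
qed

lemma lborel_integrable_translate:
  fixes f :: "'a::euclidean_space \<Rightarrow> 'b::{banach, second_countable_topology}"
  assumes "integrable lborel f"
  shows "integrable lborel (\<lambda>x. f (x + z))"
proof -
  have [measurable]: "f \<in> borel_measurable borel"
    using assms by auto
  have "integrable (distr lborel borel ((+) z)) f"
    using assms by (simp add: lborel_distr_plus)
  then have "integrable lborel (\<lambda>x. f (z + x))"
    by (subst (asm) integrable_distr_eq) simp_all
  then show ?thesis
    by (simp add: add.commute)
qed

text \<open>The \<open>L\<^sup>1\<close> modulus of continuity. The convergence of Steklov averages rests on its tending to \<open>0\<close> with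
  the translation vector.\<close>

definition translation_modulus :: "('a::euclidean_space \<Rightarrow> real) \<Rightarrow> 'a \<Rightarrow> real" where
  "translation_modulus f z = (\<integral>x. \<bar>f (x + z) - f x\<bar> \<partial>lborel)"

lemma translation_modulus_nonneg: "0 \<le> translation_modulus f z"
  by (simp add: translation_modulus_def)

lemma translation_modulus_le:
  assumes "integrable lborel f"
  shows "translation_modulus f z \<le> 2 * (\<integral>x. \<bar>f x\<bar> \<partial>lborel)"
proof -
  note i = lborel_integrable_translate[OF assms, of z]
  have [measurable]: "f \<in> borel_measurable borel"
    using assms by auto
  have "translation_modulus f z \<le> (\<integral>x. \<bar>f (x + z)\<bar> + \<bar>f x\<bar> \<partial>lborel)"
    unfolding translation_modulus_def using i assms by (intro integral_mono) auto
  also have "\<dots> = (\<integral>x. \<bar>f (x + z)\<bar> \<partial>lborel) + (\<integral>x. \<bar>f x\<bar> \<partial>lborel)"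
    using i assms by (intro Bochner_Integration.integral_add) auto
  also have "(\<integral>x. \<bar>f (x + z)\<bar> \<partial>lborel) = (\<integral>x. \<bar>f x\<bar> \<partial>lborel)"
    by (rule lborel_integral_translate[of "\<lambda>x. \<bar>f x\<bar>"]) simp
  finally show ?thesis by simp
qed

lemma translation_modulus_add_le:
  assumes f: "integrable lborel f" and g: "integrable lborel g"
  shows "translation_modulus (\<lambda>x. f x + g x) z \<le> translation_modulus f z + translation_modulus g z"
proof -
  note i = lborel_integrable_translate[OF f, of z] lborel_integrable_translate[OF g, of z]
  have "translation_modulus (\<lambda>x. f x + g x) z
      \<le> (\<integral>x. \<bar>f (x + z) - f x\<bar> + \<bar>g (x + z) - g x\<bar> \<partial>lborel)"
    unfolding translation_modulus_def using i f g by (intro integral_mono) auto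
  also have "\<dots> = translation_modulus f z + translation_modulus g z"
    unfolding translation_modulus_def
    using i f g by (intro Bochner_Integration.integral_add) auto
  finally show ?thesis .
qed

lemma translation_modulus_approx:
  assumes f: "integrable lborel f" and z: "z \<longlonglongrightarrow> 0"
    and approx: "\<And>e. e > 0 \<Longrightarrow> \<exists>g. integrable lborel g \<and> (\<integral>x. \<bar>f x - g x\<bar> \<partial>lborel) < e \<and>
      (\<lambda>n. translation_modulus g (z n)) \<longlonglongrightarrow> 0"
  shows "(\<lambda>n. translation_modulus f (z n)) \<longlonglongrightarrow> 0"
proof (rule LIMSEQ_I)
  fix e :: real assume "e > 0"
  then obtain g where g: "integrable lborel g" "(\<integral>x. \<bar>f x - g x\<bar> \<partial>lborel) < e / 4"
      "(\<lambda>n. translation_modulus g (z n)) \<longlonglongrightarrow> 0"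
    using approx[of "e / 4"] by auto
  obtain N where N: "\<And>n. n \<ge> N \<Longrightarrow> translation_modulus g (z n) < e / 2"
    using LIMSEQ_D[OF g(3), of "e / 2"] \<open>e > 0\<close> by (auto simp: translation_modulus_nonneg)
  show "\<exists>N. \<forall>n\<ge>N. norm (translation_modulus f (z n) - 0) < e"
  proof (intro exI allI impI)
    fix n assume "n \<ge> N"
    have "translation_modulus f (z n)
        \<le> translation_modulus g (z n) + translation_modulus (\<lambda>x. f x - g x) (z n)"
      using translation_modulus_add_le[of g "\<lambda>x. f x - g x" "z n"] f g(1) by simp
    also have "translation_modulus (\<lambda>x. f x - g x) (z n) \<le> 2 * (\<integral>x. \<bar>f x - g x\<bar> \<partial>lborel)"
      using f g(1) by (intro translation_modulus_le) simp
    finally show "norm (translation_modulus f (z n) - 0) < e"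
      using N[OF \<open>n \<ge> N\<close>] g(2) by (simp add: translation_modulus_nonneg)
  qed
qed

text \<open>For an open set \<open>U\<close> the loss \<open>(1\<^sub>U(x) - 1\<^sub>U(x + z))\<^sup>+\<close> tends to \<open>0\<close> pointwise, because a point of \<open>U\<close>
  stays in \<open>U\<close> under small translations. Translations preserve the measure of \<open>U\<close>, so loss and gain have
  the same integral and the loss controls everything.\<close>

lemma translation_modulus_indicator_open:
  fixes U :: "'a::euclidean_space set"
  assumes "open U" "emeasure lborel U < \<infinity>" and z: "z \<longlonglongrightarrow> 0"
  shows "(\<lambda>n. translation_modulus (indicator U) (z n)) \<longlonglongrightarrow> 0"
proof -
  let ?i = "indicator U :: 'a \<Rightarrow> real"
  have [measurable]: "U \<in> sets borel"
    using assms by simp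
  have i: "integrable lborel ?i"
    using assms by (simp add: integrable_indicator_iff)
  note it = lborel_integrable_translate[OF i]
  have int_max: "integrable lborel (\<lambda>x. max 0 (?i x - ?i (x + v)))" for v
    by (rule Bochner_Integration.integrable_bound[OF i]) (auto simp: indicator_def)
  have eq: "translation_modulus ?i v = 2 * (\<integral>x. max 0 (?i x - ?i (x + v)) \<partial>lborel)" for v
  proof -
    have "translation_modulus ?i v
        = (\<integral>x. 2 * max 0 (?i x - ?i (x + v)) + (?i (x + v) - ?i x) \<partial>lborel)"
      unfolding translation_modulus_def
      by (intro Bochner_Integration.integral_cong) (auto simp: indicator_def)
    also have "\<dots> = 2 * (\<integral>x. max 0 (?i x - ?i (x + v)) \<partial>lborel)
        + ((\<integral>x. ?i (x + v) \<partial>lborel) - (\<integral>x. ?i x \<partial>lborel))"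
      using int_max it i by (subst Bochner_Integration.integral_add) auto
    also have "(\<integral>x. ?i (x + v) \<partial>lborel) = (\<integral>x. ?i x \<partial>lborel)"
      by (rule lborel_integral_translate) simp
    finally show ?thesis by simp
  qed
  have "(\<lambda>n. \<integral>x. max 0 (?i x - ?i (x + z n)) \<partial>lborel) \<longlonglongrightarrow> (\<integral>x. (0::real) \<partial>(lborel::'a measure))"
  proof (rule integral_dominated_convergence[OF _ _ i])
    show "AE x in lborel. (\<lambda>n. max 0 (?i x - ?i (x + z n))) \<longlonglongrightarrow> 0"
    proof (rule AE_I2)
      fix x :: 'a
      show "(\<lambda>n. max 0 (?i x - ?i (x + z n))) \<longlonglongrightarrow> 0"
      proof (cases "x \<in> U")
        case True
        have "(\<lambda>n. x + z n) \<longlonglongrightarrow> x"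
          using tendsto_add[OF tendsto_const z, of x] by simp
        then have "\<forall>\<^sub>F n in sequentially. x + z n \<in> U"
          using True \<open>open U\<close> topological_tendstoD by blast
        then have "\<forall>\<^sub>F n in sequentially. max 0 (?i x - ?i (x + z n)) = 0"
          by eventually_elim (auto simp: indicator_def)
        then show ?thesis
          by (rule tendsto_eventually)
      qed (auto simp: indicator_def)
    qed
  qed (auto simp: indicator_def)
  from tendsto_mult_left[OF this, of 2] show ?thesis
    by (simp add: eq)
qed

text \<open>Outer regularity passes from open sets to Borel sets, linearity and \<open>L\<^sup>1\<close> limits to integrable
  functions.\<close>

lemma translation_modulus_tendsto:
  fixes f :: "'a::euclidean_space \<Rightarrow> real"
  assumes "integrable lborel f" and z: "z \<longlonglongrightarrow> 0"
  shows "(\<lambda>n. translation_modulus f (z n)) \<longlonglongrightarrow> 0"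
  using assms(1)
proof (induction f rule: integrable_induct)
  case (base A c)
  have A[measurable]: "A \<in> sets borel"
    using base by simp
  have iA: "integrable lborel (indicator A :: 'a \<Rightarrow> real)"
    using base by (simp add: integrable_indicator_iff)
  have "(\<lambda>n. translation_modulus (indicator A) (z n)) \<longlonglongrightarrow> 0"
  proof (rule translation_modulus_approx[OF iA z])
    fix e :: real assume "e > 0"
    obtain U where U: "open U" "A \<subseteq> U" "emeasure lborel (U - A) < ennreal e"
      using outer_regular_lborel[OF A \<open>e > 0\<close>] by blast
    have "emeasure lborel U = emeasure lborel (A \<union> (U - A))"
      using U by (intro arg_cong2[where f = emeasure]) auto
    also have "\<dots> \<le> emeasure lborel A + emeasure lborel (U - A)"
      using U by (intro emeasure_subadditive) auto
    also have "\<dots> < \<infinity>"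
      using base U(3) by (auto simp: ennreal_add_eq_top less_top[symmetric])
    finally have fU: "emeasure lborel U < \<infinity>" .
    have iU: "integrable lborel (indicator U :: 'a \<Rightarrow> real)"
      using U fU by (simp add: integrable_indicator_iff)
    have "(\<integral>x. \<bar>indicator A x - indicator U x\<bar> \<partial>lborel) = (\<integral>x. indicator (U - A) x \<partial>lborel :: real)"
      using U(2) by (intro Bochner_Integration.integral_cong) (auto simp: indicator_def)
    also have "\<dots> = measure lborel (U - A)"
      using U by simp
    also have "\<dots> < e"
      using U(3) \<open>e > 0\<close> unfolding measure_def
      by (metis enn2real_less_iff ennreal_less_top less_trans enn2real_ennreal less_imp_le)
    finally show "\<exists>g. integrable lborel g \<and> (\<integral>x. \<bar>indicator A x - g x\<bar> \<partial>lborel) < e \<and>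
      (\<lambda>n. translation_modulus g (z n)) \<longlonglongrightarrow> 0"
      using iU translation_modulus_indicator_open[OF U(1) fU z] by blast
  qed
  from tendsto_mult_left[OF this, of "\<bar>c\<bar>"]
  show ?case
    by (simp add: translation_modulus_def abs_mult mult.commute flip: right_diff_distrib left_diff_distrib)
next
  case (add f g)
  show ?case
  proof (rule tendsto_sandwich[OF always_eventually always_eventually tendsto_const])
    show "(\<lambda>n. translation_modulus f (z n) + translation_modulus g (z n)) \<longlonglongrightarrow> 0"
      using tendsto_add[OF add(3,4)] by simp
  qed (use add translation_modulus_add_le translation_modulus_nonneg in auto)
next
  case (lim f s)
  show ?case
  proof (rule translation_modulus_approx[OF lim(4) z])
    fix e :: real assume "e > 0"
    have [measurable]: "f \<in> borel_measurable borel" "\<And>i. s i \<in> borel_measurable borel"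
      using lim(1,4) by auto
    have "(\<lambda>i. \<integral>x. \<bar>f x - s i x\<bar> \<partial>lborel) \<longlonglongrightarrow> (\<integral>x. (0::real) \<partial>(lborel::'a measure))"
    proof (rule integral_dominated_convergence)
      show "integrable lborel (\<lambda>x. 3 * \<bar>f x\<bar>)"
        using lim(4) by simp
      show "AE x in lborel. (\<lambda>i. \<bar>f x - s i x\<bar>) \<longlonglongrightarrow> 0"
      proof (rule AE_I2)
        fix x
        have "(\<lambda>i. \<bar>f x - s i x\<bar>) \<longlonglongrightarrow> \<bar>f x - f x\<bar>"
          using lim(2)[of x] by (intro tendsto_intros) auto
        then show "(\<lambda>i. \<bar>f x - s i x\<bar>) \<longlonglongrightarrow> 0"
          by simp
      qed
      show "AE x in lborel. norm \<bar>f x - s i x\<bar> \<le> 3 * \<bar>f x\<bar>" for i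
      proof (rule AE_I2)
        fix x
        have "\<bar>s i x\<bar> \<le> 2 * \<bar>f x\<bar>"
          using lim(3)[of x i] by auto
        then show "norm \<bar>f x - s i x\<bar> \<le> 3 * \<bar>f x\<bar>"
          by auto
      qed
    qed auto
    then have "\<forall>\<^sub>F i in sequentially. (\<integral>x. \<bar>f x - s i x\<bar> \<partial>lborel) < e"
      using \<open>e > 0\<close> by (intro order_tendstoD) auto
    then obtain i where "(\<integral>x. \<bar>f x - s i x\<bar> \<partial>lborel) < e"
      by (meson eventually_happens trivial_limit_sequentially)
    then show "\<exists>g. integrable lborel g \<and> (\<integral>x. \<bar>f x - g x\<bar> \<partial>lborel) < e \<and>
      (\<lambda>n. translation_modulus g (z n)) \<longlonglongrightarrow> 0"
      using lim(1,5) by blast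
  qed
qed

text \<open>The Steklov average of \<open>f\<close> over the segment from \<open>x\<close> to \<open>x + v\<close>. The segment is parametrized by
  \<open>[0, 1]\<close> to avoid a division by the length of \<open>v\<close>.\<close>

definition steklov :: "'a::euclidean_space \<Rightarrow> ('a \<Rightarrow> real) \<Rightarrow> 'a \<Rightarrow> real" where
  "steklov v f x = (\<integral>s. indicator {0..1} s * f (x + s *\<^sub>R v) \<partial>lborel)"

lemma steklov_pair_integrable:
  fixes f :: "'a::euclidean_space \<Rightarrow> real"
  assumes f: "integrable lborel f"
  shows "integrable (lborel \<Otimes>\<^sub>M lborel) (\<lambda>(s, x). indicator {0..1::real} s * f (x + s *\<^sub>R v))"
proof -
  have [measurable]: "f \<in> borel_measurable borel"
    using f by auto
  show ?thesis
  proof (rule lborel_pair.Fubini_integrable)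
    have "(\<integral>x. norm (case (s, x) of (s, x) \<Rightarrow> indicator {0..1::real} s * f (x + s *\<^sub>R v)) \<partial>lborel)
       = indicator {0..1} s * (\<integral>x. \<bar>f x\<bar> \<partial>lborel)" for s
      using lborel_integral_translate[of "\<lambda>x. \<bar>f x\<bar>" "s *\<^sub>R v"] by (simp add: abs_mult)
    then show "integrable lborel (\<lambda>s. \<integral>x. norm (case (s, x) of (s, x) \<Rightarrow>
        indicator {0..1::real} s * f (x + s *\<^sub>R v)) \<partial>lborel)"
      by simp
    show "AE s in lborel. integrable lborel (\<lambda>x. case (s, x) of (s, x) \<Rightarrow>
        indicator {0..1::real} s * f (x + s *\<^sub>R v))"
      using lborel_integrable_translate[OF f] by simp
  qed simp
qed

lemma integrable_steklov:
  assumes f: "integrable lborel f"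
  shows "integrable lborel (steklov v f)"
proof -
  have "integrable (lborel \<Otimes>\<^sub>M lborel) (\<lambda>(x, s). indicator {0..1::real} s * f (x + s *\<^sub>R v))"
    using steklov_pair_integrable[OF f, of v] by (subst lborel_pair.integrable_product_swap_iff[symmetric]) simp
  from lborel_pair.integrable_fst'[OF this] show ?thesis
    by (simp add: steklov_def[abs_def])
qed

text \<open>Averaging commutes with the \<open>L\<^sup>1\<close> norm up to an inequality, so the distance between \<open>f\<close> and its average
  is at most the average of the distances between \<open>f\<close> and its translates.\<close>

lemma steklov_L1_le:
  fixes f :: "'a::euclidean_space \<Rightarrow> real"
  assumes f: "integrable lborel f"
  shows "(\<integral>x. \<bar>steklov v f x - f x\<bar> \<partial>lborel)
    \<le> (\<integral>s. indicator {0..1} s * translation_modulus f (s *\<^sub>R v) \<partial>lborel)"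
    and "(\<lambda>s. translation_modulus f (s *\<^sub>R v)) \<in> borel_measurable borel"
proof -
  have [measurable]: "f \<in> borel_measurable borel"
    using f by auto
  let ?F = "\<lambda>s x. indicator {0..1::real} s * (f (x + s *\<^sub>R v) - f x)"
  have 1: "integrable (lborel \<Otimes>\<^sub>M lborel) (\<lambda>(s, x). indicator {0..1::real} s * f (x + s *\<^sub>R v))"
    by (rule steklov_pair_integrable[OF f])
  have 2: "integrable (lborel \<Otimes>\<^sub>M lborel) (\<lambda>(s, x). indicator {0..1::real} s * f x)"
    using steklov_pair_integrable[OF f, of 0] by simp
  have i1: "integrable (lborel \<Otimes>\<^sub>M lborel) (\<lambda>(s, x). ?F s x)"
    using Bochner_Integration.integrable_diff[OF 1 2]
    by (simp add: case_prod_unfold algebra_simps)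
  have i2: "integrable (lborel \<Otimes>\<^sub>M lborel) (\<lambda>(x, s). ?F s x)"
    using i1 by (subst lborel_pair.integrable_product_swap_iff[symmetric]) simp
  have i2': "integrable (lborel \<Otimes>\<^sub>M lborel) (\<lambda>(x, s). \<bar>?F s x\<bar>)"
    using integrable_abs[OF i2] by (simp add: case_prod_unfold)
  have ae: "AE x in lborel. integrable lborel (\<lambda>s. ?F s x)"
    using lborel_pair.AE_integrable_fst'[OF i2] by simp
  have ae1: "AE x in lborel. integrable lborel (\<lambda>s. indicator {0..1::real} s * f (x + s *\<^sub>R v))"
  proof -
    have "integrable (lborel \<Otimes>\<^sub>M lborel) (\<lambda>(x, s). indicator {0..1::real} s * f (x + s *\<^sub>R v))"
      using 1 by (subst lborel_pair.integrable_product_swap_iff[symmetric]) simp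
    from lborel_pair.AE_integrable_fst'[OF this] show ?thesis by simp
  qed
  have "(\<integral>x. \<bar>steklov v f x - f x\<bar> \<partial>lborel) \<le> (\<integral>x. (\<integral>s. \<bar>?F s x\<bar> \<partial>lborel) \<partial>lborel)"
  proof (rule integral_mono_AE)
    show "integrable lborel (\<lambda>x. \<bar>steklov v f x - f x\<bar>)"
      using integrable_steklov[OF f] f by simp
    show "integrable lborel (\<lambda>x. \<integral>s. \<bar>?F s x\<bar> \<partial>lborel)"
      using lborel_pair.integrable_fst'[OF i2'] by simp
    show "AE x in lborel. \<bar>steklov v f x - f x\<bar> \<le> (\<integral>s. \<bar>?F s x\<bar> \<partial>lborel)"
      using ae1
    proof eventually_elim
      case (elim x)
      have "steklov v f x - f x = (\<integral>s. indicator {0..1::real} s * f (x + s *\<^sub>R v) \<partial>lborel)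
          - (\<integral>s. indicator {0..1::real} s * f x \<partial>lborel)"
        by (simp add: steklov_def)
      also have "\<dots> = (\<integral>s. ?F s x \<partial>lborel)"
        using elim by (subst Bochner_Integration.integral_diff[symmetric]) (auto simp: algebra_simps)
      finally show ?case
        by (metis integral_abs_bound)
    qed
  qed
  also have "\<dots> = (\<integral>s. (\<integral>x. \<bar>?F s x\<bar> \<partial>lborel) \<partial>lborel)"
    using lborel_pair.Fubini_integral[OF i2'] by simp
  also have "\<dots> = (\<integral>s. indicator {0..1} s * translation_modulus f (s *\<^sub>R v) \<partial>lborel)"
    by (simp add: translation_modulus_def abs_mult)
  finally show "(\<integral>x. \<bar>steklov v f x - f x\<bar> \<partial>lborel)
    \<le> (\<integral>s. indicator {0..1} s * translation_modulus f (s *\<^sub>R v) \<partial>lborel)" .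
  show "(\<lambda>s. translation_modulus f (s *\<^sub>R v)) \<in> borel_measurable borel"
    unfolding translation_modulus_def by measurable
qed

lemma steklov_tendsto_L1:
  fixes f :: "'a::euclidean_space \<Rightarrow> real"
  assumes f: "integrable lborel f" and v: "v \<longlonglongrightarrow> 0"
  shows "(\<lambda>n. \<integral>x. \<bar>steklov (v n) f x - f x\<bar> \<partial>lborel) \<longlonglongrightarrow> 0"
proof (rule tendsto_sandwich[OF always_eventually always_eventually tendsto_const])
  note [measurable] = steklov_L1_le(2)[OF f]
  have "(\<lambda>n. \<integral>s. indicator {0..1} s * translation_modulus f (s *\<^sub>R v n) \<partial>lborel)
      \<longlonglongrightarrow> (\<integral>s. (0::real) \<partial>(lborel::real measure))"
  proof (rule integral_dominated_convergence)
    show "integrable lborel (\<lambda>s. indicator {0..1::real} s * (2 * (\<integral>x. \<bar>f x\<bar> \<partial>lborel)))"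
      by simp
    show "AE s in lborel. (\<lambda>n. indicator {0..1} s * translation_modulus f (s *\<^sub>R v n)) \<longlonglongrightarrow> 0"
    proof (rule AE_I2)
      fix s :: real
      have "(\<lambda>n. s *\<^sub>R v n) \<longlonglongrightarrow> 0"
        using tendsto_scaleR[OF tendsto_const v, of s] by simp
      from tendsto_mult_left[OF translation_modulus_tendsto[OF f this], of "indicator {0..1} s"]
      show "(\<lambda>n. indicator {0..1} s * translation_modulus f (s *\<^sub>R v n)) \<longlonglongrightarrow> 0"
        by simp
    qed
  qed (auto simp: indicator_def translation_modulus_le[OF f] translation_modulus_nonneg)
  then show "(\<lambda>n. \<integral>s. indicator {0..1} s * translation_modulus f (s *\<^sub>R v n) \<partial>lborel) \<longlonglongrightarrow> 0"
    by simp
qed (auto simp: steklov_L1_le[OF f])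

text \<open>The difference quotients have integral \<open>0\<close> by translation invariance, and they converge boundedly on a
  common bounded set.\<close>

lemma integral_directional_derivative_eq_0:
  fixes \<psi> \<psi>' :: "'a::euclidean_space \<Rightarrow> real" and v :: 'a
  assumes der: "\<And>x. ((\<lambda>h. \<psi> (x + h *\<^sub>R v)) has_real_derivative \<psi>' x) (at 0)"
    and cont': "continuous_on UNIV \<psi>'" and cont: "continuous_on UNIV \<psi>"
    and supp: "\<And>x. norm x > R \<Longrightarrow> \<psi> x = 0"
  shows "(\<integral>x. \<psi>' x \<partial>lborel) = 0"
proof -
  have [measurable]: "\<psi> \<in> borel_measurable borel" "\<psi>' \<in> borel_measurable borel"
    using cont cont' by (auto intro: borel_measurable_continuous_onI)
  \<comment> \<open>Steps of size at most \<open>1\<close> move points by at most \<open>norm v\<close>: the quotients vanish off \<open>K\<close>, and the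
    intermediate points of the mean value theorem stay in a ball that is larger by another \<open>norm v\<close>.\<close>
  define K where "K = cball (0::'a) (\<bar>R\<bar> + norm v)"
  have cK: "compact K"
    by (simp add: K_def)
  obtain B where B: "\<And>x. x \<in> cball (0::'a) (\<bar>R\<bar> + 2 * norm v) \<Longrightarrow> \<bar>\<psi>' x\<bar> \<le> B"
    using compact_imp_bounded[OF compact_continuous_image[OF continuous_on_subset[OF cont' subset_UNIV]
      compact_cball]] unfolding bounded_iff by (metis imageI real_norm_def)
  have iK: "integrable lborel (indicator K :: 'a \<Rightarrow> real)"
    using emeasure_compact_finite[OF cK] cK by (simp add: integrable_indicator_iff compact_imp_closed borel_closed)
  have der': "((\<lambda>h. \<psi> (x + h *\<^sub>R v)) has_real_derivative \<psi>' (x + s *\<^sub>R v)) (at s)" for x s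
    using der[of "x + s *\<^sub>R v"] DERIV_shift[of "\<lambda>h. \<psi> (x + h *\<^sub>R v)" "\<psi>' (x + s *\<^sub>R v)" 0 s]
    by (simp add: algebra_simps)
  define h where "h n = inverse (real (Suc n))" for n
  have h: "0 < h n" "h n \<le> 1" for n
    by (auto simp: h_def field_simps)
  have hlim: "h \<longlonglongrightarrow> 0"
    unfolding h_def by (rule LIMSEQ_inverse_real_of_nat)
  define q where "q n x = (\<psi> (x + h n *\<^sub>R v) - \<psi> x) / h n" for n x
  have lim: "(\<lambda>n. q n x) \<longlonglongrightarrow> \<psi>' x" for x
  proof -
    have "((\<lambda>k. (\<psi> (x + k *\<^sub>R v) - \<psi> x) / k) \<longlongrightarrow> \<psi>' x) (at 0)"
      using der[of x] by (simp add: DERIV_def)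
    moreover have "filterlim h (at 0) sequentially"
      using hlim h(1) by (auto simp: filterlim_at intro!: eventuallyI) (metis less_irrefl)
    ultimately show ?thesis
      unfolding q_def by (rule filterlim_compose)
  qed
  have bnd: "\<bar>q n x\<bar> \<le> B * indicator K x" for n x
  proof (cases "x \<in> K")
    case True
    obtain s where s: "0 < s" "s < h n" "\<psi> (x + h n *\<^sub>R v) - \<psi> x = h n * \<psi>' (x + s *\<^sub>R v)"
      using MVT2[OF h(1)[of n], of "\<lambda>k. \<psi> (x + k *\<^sub>R v)" "\<lambda>k. \<psi>' (x + k *\<^sub>R v)"] der' by auto
    have "norm (x + s *\<^sub>R v) \<le> norm x + s * norm v"
      using s norm_triangle_ineq[of x "s *\<^sub>R v"] by simp
    also have "\<dots> \<le> (\<bar>R\<bar> + norm v) + 1 * norm v"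
      using True s h(2)[of n] by (intro add_mono mult_right_mono) (auto simp: K_def)
    finally have "\<bar>\<psi>' (x + s *\<^sub>R v)\<bar> \<le> B"
      by (intro B) simp
    then show ?thesis
      using True s h(1)[of n] by (simp add: q_def)
  next
    case False
    then have x: "norm x > \<bar>R\<bar> + norm v"
      by (simp add: K_def)
    have "norm x \<le> norm (x + h n *\<^sub>R v) + h n * norm v"
      using norm_triangle_ineq4[of "x + h n *\<^sub>R v" "h n *\<^sub>R v"] h(1)[of n] by simp
    also have "h n * norm v \<le> 1 * norm v"
      using h(2)[of n] by (intro mult_right_mono) auto
    finally have "norm (x + h n *\<^sub>R v) > R"
      using x by simp
    moreover have "norm x > R"
      using x norm_ge_zero[of v] by linarith
    ultimately show ?thesis
      using supp False by (simp add: q_def)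
  qed
  have i\<psi>: "integrable lborel \<psi>"
  proof -
    obtain C where C: "\<And>x. x \<in> K \<Longrightarrow> \<bar>\<psi> x\<bar> \<le> C"
      using compact_imp_bounded[OF compact_continuous_image[OF continuous_on_subset[OF cont subset_UNIV] cK]]
      unfolding bounded_iff by (metis imageI real_norm_def)
    have *: "\<bar>\<psi> x\<bar> \<le> \<bar>C * indicator K x\<bar>" for x
    proof (cases "x \<in> K")
      case False
      then have "norm x > R"
        using norm_ge_zero[of v] abs_ge_self[of R] unfolding K_def mem_cball_0 by linarith
      then show ?thesis by (simp add: supp)
    qed (use C[of x] in auto)
    show ?thesis
      by (rule Bochner_Integration.integrable_bound[where f = "\<lambda>x. C * indicator K x"])
         (use iK * in auto)
  qed
  have "(\<lambda>n. \<integral>x. q n x \<partial>lborel) \<longlonglongrightarrow> (\<integral>x. \<psi>' x \<partial>lborel)"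
  proof (rule integral_dominated_convergence)
    show "integrable lborel (\<lambda>x. B * indicator K x)"
      using iK by simp
  qed (use lim bnd in \<open>auto simp: q_def\<close>)
  moreover have "(\<integral>x. q n x \<partial>lborel) = 0" for n
  proof -
    have "(\<integral>x. q n x \<partial>lborel)
        = ((\<integral>x. \<psi> (x + h n *\<^sub>R v) \<partial>lborel) - (\<integral>x. \<psi> x \<partial>lborel)) / h n"
      unfolding q_def
      using lborel_integrable_translate[OF i\<psi>, of "h n *\<^sub>R v"] i\<psi>
      by (simp add: Bochner_Integration.integral_diff[symmetric] del: Bochner_Integration.integral_diff)
    then show ?thesis
      by (simp add: lborel_integral_translate)
  qed
  ultimately show ?thesis
    by (simp add: LIMSEQ_const_iff)
qed

section \<open>Test functions and the fundamental lemma\<close>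

lemma has_derivative_frechet_eq:
  "(\<phi> has_derivative D) (at x) \<Longrightarrow> frechet_derivative \<phi> (at x) = D"
  by (metis frechet_derivative_at)

lemma C1_compact_supportI:
  assumes D: "\<And>x. (\<phi> has_derivative D x) (at x)" and "\<And>v. continuous_on UNIV (\<lambda>x. D x v)"
    and K: "compact K" "\<And>x. x \<notin> K \<Longrightarrow> \<phi> x = 0" "K \<subseteq> \<Omega>"
  shows "\<phi> \<in> C1_compact_support \<Omega>"
proof -
  have sub: "closure {x. \<phi> x \<noteq> 0} \<subseteq> K"
    using K by (intro closure_minimal compact_imp_closed) auto
  then have "compact (closure {x. \<phi> x \<noteq> 0})"
    unfolding compact_eq_bounded_closed
    by (intro conjI closed_closure bounded_subset[OF compact_imp_bounded[OF K(1)] sub])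
  then show ?thesis
    using assms sub has_derivative_frechet_eq[OF D]
    by (auto simp: C1_compact_support_def differentiable_def)
qed

lemma C1_compact_support_derivative:
  assumes "\<phi> \<in> C1_compact_support \<Omega>"
  shows "(\<phi> has_derivative frechet_derivative \<phi> (at x)) (at x)"
    and "continuous_on UNIV (\<lambda>x. frechet_derivative \<phi> (at x) v)"
    and "continuous_on UNIV \<phi>"
proof -
  have *: "\<phi> differentiable (at x)" for x
    using assms by (auto simp: C1_compact_support_def)
  show "(\<phi> has_derivative frechet_derivative \<phi> (at x)) (at x)"
    using * frechet_derivative_works by blast
  show "continuous_on UNIV (\<lambda>x. frechet_derivative \<phi> (at x) v)"
    using assms by (auto simp: C1_compact_support_def)
  show "continuous_on UNIV \<phi>"
    using * by (simp add: continuous_at_imp_continuous_on differentiable_imp_continuous_within)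
qed

lemma C1_compact_support_support:
  assumes "\<phi> \<in> C1_compact_support \<Omega>"
  shows "compact (closure {x. \<phi> x \<noteq> 0})" and "closure {x. \<phi> x \<noteq> 0} \<subseteq> \<Omega>"
    and "x \<notin> closure {x. \<phi> x \<noteq> 0} \<Longrightarrow> \<phi> x = 0"
    and "x \<notin> closure {x. \<phi> x \<noteq> 0} \<Longrightarrow> frechet_derivative \<phi> (at x) v = 0"
proof -
  let ?K = "closure {x. \<phi> x \<noteq> 0}"
  show "compact ?K" "?K \<subseteq> \<Omega>"
    using assms by (auto simp: C1_compact_support_def)
  have 0: "\<phi> x = 0" if "x \<notin> ?K" for x
    using that closure_subset[of "{x. \<phi> x \<noteq> 0}"] by auto
  then show "x \<notin> ?K \<Longrightarrow> \<phi> x = 0" .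
  show "frechet_derivative \<phi> (at x) v = 0" if "x \<notin> ?K"
  proof -
    have "(\<phi> has_derivative (\<lambda>h. 0)) (at x)"
    proof (rule has_derivative_transform_within_open[OF has_derivative_const])
      show "open (- ?K)"
        by (rule open_Compl[OF closed_closure])
      show "x \<in> - ?K"
        using that unfolding Compl_iff .
      show "0 = \<phi> y" if "y \<in> - ?K" for y
        using 0[of y] that by simp
    qed
    then show ?thesis
      by (simp add: has_derivative_frechet_eq)
  qed
qed

lemma C1_compact_support_bounded:
  fixes \<phi> :: "'a::euclidean_space \<Rightarrow> real"
  assumes "\<phi> \<in> C1_compact_support \<Omega>"
  obtains B where "0 \<le> B" "\<And>x. \<bar>\<phi> x\<bar> \<le> B" "\<And>x. \<bar>frechet_derivative \<phi> (at x) v\<bar> \<le> B"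
proof -
  define K where "K = closure {x. \<phi> x \<noteq> 0}"
  note K = C1_compact_support_support[OF assms, folded K_def]
  have bdd: "\<exists>B. \<forall>x\<in>K. \<bar>f x\<bar> \<le> B" if "continuous_on UNIV f" for f :: "'a \<Rightarrow> real"
    using compact_imp_bounded[OF compact_continuous_image[OF continuous_on_subset[OF that subset_UNIV] K(1)]]
    unfolding bounded_iff by auto
  obtain B1 where B1: "\<forall>x\<in>K. \<bar>\<phi> x\<bar> \<le> B1"
    using bdd[OF C1_compact_support_derivative(3)[OF assms]] by (rule exE)
  obtain B2 where B2: "\<forall>x\<in>K. \<bar>frechet_derivative \<phi> (at x) v\<bar> \<le> B2"
    using bdd[OF C1_compact_support_derivative(2)[OF assms, of v]] by (rule exE)
  show ?thesis
  proof (rule that[of "max 0 (max B1 B2)"])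
    show "\<bar>\<phi> x\<bar> \<le> max 0 (max B1 B2)" for x
      using bspec[OF B1, of x] K(3)[of x] by (cases "x \<in> K") auto
    show "\<bar>frechet_derivative \<phi> (at x) v\<bar> \<le> max 0 (max B1 B2)" for x
      using bspec[OF B2, of x] K(4)[of x] by (cases "x \<in> K") auto
  qed simp
qed

text \<open>The building block of all \<open>C\<^sup>1\<close> cutoffs below, both for bump functions on balls and for truncations.\<close>

lemma DERIV_pos_part_square: "((\<lambda>y::real. (max 0 y)\<^sup>2) has_real_derivative 2 * max 0 y) (at y)"
proof -
  consider "y > 0" | "y < 0" | "y = 0" by linarith
  then show ?thesis
  proof cases
    case 1
    have "((\<lambda>y::real. y\<^sup>2) has_real_derivative 2 * max 0 y) (at y)"
      using 1 by (auto intro!: derivative_eq_intros)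
    then show ?thesis
      by (rule has_field_derivative_transform_within_open[of _ _ _ "{0<..}"]) (use 1 in auto)
  next
    case 2
    have "((\<lambda>y::real. 0) has_real_derivative 2 * max 0 y) (at y)"
      using 2 by simp
    then show ?thesis
      by (rule has_field_derivative_transform_within_open[of _ _ _ "{..<0}"]) (use 2 in auto)
  next
    case 3
    have "((\<lambda>h::real. (max 0 h)\<^sup>2 / h) \<longlongrightarrow> 0) (at 0)"
    proof (rule Lim_null_comparison)
      show "\<forall>\<^sub>F h in at (0::real). norm ((max 0 h)\<^sup>2 / h) \<le> \<bar>h\<bar>"
        by (intro always_eventually) (auto simp: max_def power2_eq_square)
      show "((\<lambda>h::real. \<bar>h\<bar>) \<longlongrightarrow> 0) (at 0)"
        using tendsto_rabs_zero[OF tendsto_ident_at] .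
    qed
    then show ?thesis
      using 3 by (simp add: DERIV_def)
  qed
qed

text \<open>The sum of the functions \<open>((r\<^sub>i\<^sup>2 - |x - p\<^sub>i|\<^sup>2)\<^sup>+)\<^sup>2\<close> is \<open>C\<^sup>1\<close>, positive exactly on the union of the open
  balls, and supported in the union of the closed ones.\<close>

lemma finite_union_balls_bump:
  fixes p :: "nat \<Rightarrow> 'a::euclidean_space" and r :: "nat \<Rightarrow> real"
  assumes U: "\<And>i. cball (p i) (r i) \<subseteq> U" and r: "\<And>i. r i > 0"
  obtains B :: "'a \<Rightarrow> real" and D K where "\<And>x. (B has_derivative D x) (at x)"
    "\<And>v. continuous_on UNIV (\<lambda>x. D x v)" "\<And>x. B x \<ge> 0"
    "compact K" "K \<subseteq> U" "\<And>x. x \<notin> K \<Longrightarrow> B x = 0"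
    "\<And>x i. i < n \<Longrightarrow> ((max 0 ((r i)\<^sup>2 - (x - p i) \<bullet> (x - p i)))\<^sup>2) \<le> B x"
proof -
  define b where "b i x = (max 0 ((r i)\<^sup>2 - (x - p i) \<bullet> (x - p i)))\<^sup>2" for i x
  define d where "d i x v = - 2 * ((x - p i) \<bullet> v) * (2 * max 0 ((r i)\<^sup>2 - (x - p i) \<bullet> (x - p i)))" for i x v
  have bd: "(b i has_derivative d i x) (at x)" for i x
  proof -
    have "((\<lambda>x. (r i)\<^sup>2 - (x - p i) \<bullet> (x - p i)) has_derivative (\<lambda>v. - 2 * ((x - p i) \<bullet> v))) (at x)"
      by (auto intro!: derivative_eq_intros simp: inner_commute)
    from DERIV_compose_FDERIV[OF DERIV_pos_part_square this]
    show ?thesis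
      by (simp add: b_def[abs_def] d_def[abs_def])
  qed
  have b0: "b i x = 0" if "x \<notin> cball (p i) (r i)" for i x
  proof -
    have "(r i)\<^sup>2 \<le> (norm (x - p i))\<^sup>2"
      using that r[of i] by (intro power_mono) (auto simp: dist_norm norm_minus_commute)
    then show ?thesis
      by (simp add: b_def power2_norm_eq_inner)
  qed
  show ?thesis
  proof (rule that[of "\<lambda>x. \<Sum>i<n. b i x" "\<lambda>x v. \<Sum>i<n. d i x v" "\<Union>i<n. cball (p i) (r i)"])
    show "((\<lambda>x. \<Sum>i<n. b i x) has_derivative (\<lambda>v. \<Sum>i<n. d i x v)) (at x)" for x
      using bd by (intro has_derivative_sum) auto
    show "continuous_on UNIV (\<lambda>x. \<Sum>i<n. d i x v)" for v
      unfolding d_def by (intro continuous_intros)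
    show "(max 0 ((r i)\<^sup>2 - (x - p i) \<bullet> (x - p i)))\<^sup>2 \<le> (\<Sum>i<n. b i x)" if "i < n" for x i
      using member_le_sum[of i "{..<n}" "\<lambda>i. b i x"] that by (simp add: b_def)
    show "(\<Sum>i<n. b i x) \<ge> 0" for x
      by (intro sum_nonneg) (simp add: b_def)
    show "compact (\<Union>i<n. cball (p i) (r i))"
      by (intro compact_UN) auto
    show "(\<Union>i<n. cball (p i) (r i)) \<subseteq> U"
      using U by blast
    show "(\<Sum>i<n. b i x) = 0" if "x \<notin> (\<Union>i<n. cball (p i) (r i))" for x
      using that by (intro sum.neutral ballI b0) blast
  qed
qed

text \<open>Exhaust \<open>U\<close> by finite unions of balls whose closures lie in \<open>U\<close>. If \<open>B\<^sub>n\<close> is the bump on the \<open>n\<close>-th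
  union, then \<open>n B\<^sub>n / (1 + n B\<^sub>n)\<close> is a test function with values in \<open>[0, 1]\<close> that tends to \<open>1\<close> wherever
  \<open>B\<^sub>n\<close> is eventually bounded away from \<open>0\<close>, that is, on \<open>U\<close>.\<close>

lemma open_C1_approximation:
  fixes U :: "'a::euclidean_space set"
  assumes "open U"
  obtains \<Phi> :: "nat \<Rightarrow> 'a \<Rightarrow> real" where "\<And>n. \<Phi> n \<in> C1_compact_support U"
    "\<And>n x. 0 \<le> \<Phi> n x" "\<And>n x. \<Phi> n x \<le> 1" "\<And>x. (\<lambda>n. \<Phi> n x) \<longlonglongrightarrow> indicator U x"
proof (cases "U = {}")
  case True
  show ?thesis
    by (rule that[of "\<lambda>n x. 0"])
       (use True in \<open>auto intro!: C1_compact_supportI[where D = "\<lambda>x v. 0" and K = "{}"]\<close>)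
next
  case False
  define F where "F = {ball p r | p r. r > 0 \<and> cball p r \<subseteq> U}"
  have F_U: "\<Union>F = U"
  proof -
    have "x \<in> \<Union>F" if x: "x \<in> U" for x
    proof -
      obtain r where "r > 0" "cball x r \<subseteq> U"
        using x \<open>open U\<close> open_contains_cball by blast
      then have "ball x r \<in> F"
        unfolding F_def by auto
      then show ?thesis
        using \<open>r > 0\<close> centre_in_ball by blast
    qed
    moreover have "S \<subseteq> U" if "S \<in> F" for S
      using that ball_subset_cball unfolding F_def by blast
    ultimately show ?thesis by blast
  qed
  obtain F' where F': "F' \<subseteq> F" "countable F'" "\<Union>F' = \<Union>F"
    by (rule Lindelof[of F]) (auto simp: F_def)
  have "F' \<noteq> {}"
  proof
    assume "F' = {}"
    then have "\<Union>F = {}" using F'(3) by simp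
    then show False using F_U False by simp
  qed
  then have "from_nat_into F' i \<in> F" for i
    using subsetD[OF F'(1) from_nat_into] by simp
  then have "\<exists>p r. from_nat_into F' i = ball p r \<and> r > 0 \<and> cball p r \<subseteq> U" for i
    unfolding F_def by simp
  then obtain p r where pr: "\<And>i. from_nat_into F' i = ball (p i) (r i)" "\<And>i. r i > 0"
      "\<And>i. cball (p i) (r i) \<subseteq> U"
    by metis
  have cover: "\<exists>i. x \<in> ball (p i) (r i)" if x: "x \<in> U" for x
  proof -
    have "x \<in> \<Union>F'"
      using x by (simp only: F_U F'(3))
    then obtain S where "S \<in> F'" "x \<in> S" by blast
    then obtain i where "from_nat_into F' i = S"
      using from_nat_into_surj[OF F'(2), of S] by auto
    then show ?thesis
      using pr(1)[of i] \<open>x \<in> S\<close> by auto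
  qed
  define P where "P n B D K \<longleftrightarrow> (\<forall>x. (B has_derivative D x) (at x)) \<and>
    (\<forall>v. continuous_on UNIV (\<lambda>x. D x v)) \<and>
    (\<forall>x. B x \<ge> (0::real)) \<and> compact K \<and> K \<subseteq> U \<and> (\<forall>x. x \<notin> K \<longrightarrow> B x = 0) \<and>
    (\<forall>x i. i < n \<longrightarrow> ((max 0 ((r i)\<^sup>2 - (x - p i) \<bullet> (x - p i)))\<^sup>2) \<le> B x)" for n B D K
  have "\<exists>B D K. P n B D K" for n
  proof -
    obtain B D K where "P n B D K"
    proof (rule finite_union_balls_bump[OF pr(3) pr(2), where n = n])
      fix B :: "'a \<Rightarrow> real" and D K
      assume "\<And>x. (B has_derivative D x) (at x)"
        "\<And>v. continuous_on UNIV (\<lambda>x. D x v)" "\<And>x. B x \<ge> (0::real)" "compact K" "K \<subseteq> U"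
        "\<And>x. x \<notin> K \<Longrightarrow> B x = 0"
        "\<And>x i. i < n \<Longrightarrow> ((max 0 ((r i)\<^sup>2 - (x - p i) \<bullet> (x - p i)))\<^sup>2) \<le> B x"
      then have "P n B D K"
        unfolding P_def by (intro conjI allI impI)
      then show thesis ..
    qed
    then show ?thesis by blast
  qed
  then obtain B D K where P: "\<And>n. P n (B n) (D n) (K n)"
    by metis
  then have B: "\<And>n x. (B n has_derivative D n x) (at x)"
      "\<And>n v. continuous_on UNIV (\<lambda>x. D n x v)" "\<And>n x. B n x \<ge> (0::real)" "\<And>n. compact (K n)"
      "\<And>n. K n \<subseteq> U" "\<And>n x. x \<notin> K n \<Longrightarrow> B n x = 0"
      "\<And>n x i. i < n \<Longrightarrow> ((max 0 ((r i)\<^sup>2 - (x - p i) \<bullet> (x - p i)))\<^sup>2) \<le> B n x"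
    unfolding P_def by blast+
  define \<Phi> where "\<Phi> n x = real n * B n x / (1 + real n * B n x)" for n x
  show ?thesis
  proof (rule that[of \<Phi>])
    fix n
    have cB: "continuous_on UNIV (B n)"
      by (meson B(1) continuous_at_imp_continuous_on has_derivative_continuous)
    have pos: "1 + real n * B n x > 0" for x
      by (intro add_pos_nonneg mult_nonneg_nonneg) (auto simp: B(3))
    have d: "((\<lambda>y::real. y / (1 + y)) has_real_derivative 1 / (1 + y)\<^sup>2) (at y)" if "1 + y > 0" for y
      using that by (auto intro!: derivative_eq_intros simp: power2_eq_square field_simps)
    show "\<Phi> n \<in> C1_compact_support U"
    proof (rule C1_compact_supportI)
      show "(\<Phi> n has_derivative (\<lambda>v. (real n * D n x v) * (1 / (1 + real n * B n x)\<^sup>2))) (at x)" for x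
        unfolding \<Phi>_def
        by (rule DERIV_compose_FDERIV[OF d[OF pos] has_derivative_mult_right[OF B(1)]])
      show "continuous_on UNIV (\<lambda>x. (real n * D n x v) * (1 / (1 + real n * B n x)\<^sup>2))" for v
        using pos by (intro continuous_intros B(2) cB) (metis less_irrefl power_not_zero)
      show "compact (K n)" "K n \<subseteq> U"
        by (rule B(4), rule B(5))
      show "\<Phi> n x = 0" if "x \<notin> K n" for x
        using B(6)[OF that] by (simp add: \<Phi>_def)
    qed
    show "0 \<le> \<Phi> n x" for x
      using B(3) by (simp add: \<Phi>_def)
    show "\<Phi> n x \<le> 1" for x
      using pos[of x] by (simp add: \<Phi>_def field_simps)
  next
    fix x
    show "(\<lambda>n. \<Phi> n x) \<longlonglongrightarrow> indicator U x"
    proof (cases "x \<in> U")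
      case True
      then obtain i where i: "x \<in> ball (p i) (r i)"
        using cover by blast
      define c where "c = (max 0 ((r i)\<^sup>2 - (x - p i) \<bullet> (x - p i)))\<^sup>2"
      have "(norm (x - p i))\<^sup>2 < (r i)\<^sup>2"
        using i by (intro power_strict_mono) (auto simp: dist_norm norm_minus_commute)
      then have "c > 0"
        by (simp add: c_def power2_norm_eq_inner)
      show ?thesis
      proof (rule tendsto_sandwich)
        show "\<forall>\<^sub>F n in sequentially. 1 - 1 / (1 + real n * c) \<le> \<Phi> n x"
          using eventually_gt_at_top[of i]
        proof eventually_elim
          case (elim n)
          have "1 + real n * c \<le> 1 + real n * B n x"
            using B(7)[OF elim, of x] by (intro add_mono mult_left_mono) (auto simp: c_def)
          moreover have "1 + real n * c > 0"
            using \<open>c > 0\<close> by (intro add_pos_nonneg) auto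
          ultimately have "1 / (1 + real n * B n x) \<le> 1 / (1 + real n * c)"
            by (intro divide_left_mono) auto
          moreover have "\<Phi> n x = 1 - 1 / (1 + real n * B n x)"
            using \<open>1 + real n * c > 0\<close> \<open>1 + real n * c \<le> _\<close> by (simp add: \<Phi>_def field_simps)
          ultimately show ?case by simp
        qed
        show "\<forall>\<^sub>F n in sequentially. \<Phi> n x \<le> 1"
        proof (intro always_eventually allI)
          fix n
          have "real n * B n x \<ge> 0"
            by (intro mult_nonneg_nonneg) (auto simp: B(3))
          then show "\<Phi> n x \<le> 1"
            by (simp add: \<Phi>_def)
        qed
        have "filterlim (\<lambda>n. 1 + c * real n) at_top sequentially"
          using \<open>c > 0\<close> by (intro filterlim_tendsto_add_at_top[OF tendsto_const]
            filterlim_tendsto_pos_mult_at_top[OF tendsto_const] filterlim_real_sequentially)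
        then have "(\<lambda>n. 1 / (1 + real n * c)) \<longlonglongrightarrow> 0"
          by (intro tendsto_divide_0[OF tendsto_const] filterlim_at_top_imp_at_infinity)
             (simp add: mult.commute)
        then show "(\<lambda>n. 1 - 1 / (1 + real n * c)) \<longlonglongrightarrow> indicator U x"
          using True tendsto_diff[OF tendsto_const, of "\<lambda>n. 1 / (1 + real n * c)" 0 sequentially 1]
          by simp
        show "(\<lambda>n. 1) \<longlonglongrightarrow> (indicator U x :: real)"
          using True by simp
      qed
    next
      case False
      have "\<Phi> n x = 0" for n
      proof -
        have "x \<notin> K n"
          using False B(5) by blast
        then show ?thesis
          using B(6) by (simp add: \<Phi>_def)
      qed
      then show ?thesis
        using False by simp
    qed
  qed
qed

text \<open>Test functions approximate indicators of open sets, so \<open>f\<close> has integral \<open>0\<close> over every open subset of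
  \<open>W\<close>. The Borel sets over which the integral vanishes form a Dynkin system, hence contain all Borel
  sets.\<close>

lemma fundamental_lemma_weak_derivative:
  fixes f :: "'a::euclidean_space \<Rightarrow> real"
  assumes f: "integrable lborel f" and "open W"
    and test: "\<And>\<phi>. \<phi> \<in> C1_compact_support W \<Longrightarrow> (\<integral>x. f x * \<phi> x \<partial>lborel) = 0"
  shows "AE x in lborel. x \<in> W \<longrightarrow> f x = 0"
proof -
  have [measurable]: "f \<in> borel_measurable borel" "W \<in> sets borel"
    using f \<open>open W\<close> by auto
  have open0: "(\<integral>x. indicator U x * f x \<partial>lborel) = 0" if "open U" "U \<subseteq> W" for U
  proof -
    obtain \<Phi> where \<Phi>: "\<And>n. \<Phi> n \<in> C1_compact_support U"
      "\<And>n x. 0 \<le> \<Phi> n x" "\<And>n x. \<Phi> n x \<le> (1::real)" "\<And>x. (\<lambda>n. \<Phi> n x) \<longlonglongrightarrow> indicator U x"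
      using open_C1_approximation[OF \<open>open U\<close>] by blast
    have [measurable]: "\<Phi> n \<in> borel_measurable borel" "U \<in> sets borel" for n
      using C1_compact_support_derivative(3)[OF \<Phi>(1)] that
      by (auto intro: borel_measurable_continuous_onI)
    have "(\<lambda>n. \<integral>x. f x * \<Phi> n x \<partial>lborel) \<longlonglongrightarrow> (\<integral>x. f x * indicator U x \<partial>lborel)"
    proof (rule integral_dominated_convergence)
      show "integrable lborel (\<lambda>x. \<bar>f x\<bar>)"
        using f by simp
      show "AE x in lborel. norm (f x * \<Phi> n x) \<le> \<bar>f x\<bar>" for n
        using \<Phi>(2,3) by (intro AE_I2) (simp add: abs_mult mult_left_le)
    qed (auto intro!: tendsto_intros \<Phi>(4))
    moreover have "\<Phi> n \<in> C1_compact_support W" for n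
      using \<Phi>(1)[of n] that(2) by (auto simp: C1_compact_support_def)
    ultimately show ?thesis
      by (simp add: test LIMSEQ_const_iff mult.commute)
  qed
  define f' where "f' x = indicator W x * f x" for x
  have f': "integrable lborel f'"
    unfolding f'_def using f by (simp add: integrable_real_mult_indicator mult.commute)
  have [measurable]: "f' \<in> borel_measurable borel"
    using f' by auto
  have fi: "integrable lborel (\<lambda>x. indicator A x * f' x)" if "A \<in> sets borel" for A
    using f' that by (simp add: integrable_real_mult_indicator mult.commute)
  have all: "(\<integral>x. indicator A x * f' x \<partial>lborel) = 0" if A: "A \<in> sets borel" for A
  proof -
    have "Int_stable {S::'a set. open S}"
      by (auto simp: Int_stable_def)
    moreover have "{S::'a set. open S} \<subseteq> Pow UNIV"
      by simp
    moreover have "A \<in> sigma_sets UNIV {S::'a set. open S}"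
      using A unfolding borel_def by simp
    ultimately show ?thesis
    proof (induction rule: sigma_sets_induct_disjoint)
      case (basic A)
      then show ?case
        using open0[of "A \<inter> W"] \<open>open W\<close>
        by (simp add: f'_def indicator_inter_arith mult.assoc open_Int)
    next
      case (compl A)
      then have [measurable]: "A \<in> sets borel"
        unfolding borel_def by simp
      have "(\<integral>x. indicator (UNIV - A) x * f' x \<partial>lborel) = (\<integral>x. f' x - indicator A x * f' x \<partial>lborel)"
        by (intro Bochner_Integration.integral_cong) (auto simp: indicator_def)
      also have "\<dots> = 0"
        using open0[OF \<open>open W\<close>] compl f' fi[of A]
        by (subst Bochner_Integration.integral_diff) (simp_all add: f'_def[abs_def])
      finally show ?case .
    next
      case (union A)
      then have [measurable]: "A i \<in> sets borel" for i
        unfolding borel_def by (simp add: range_subsetD)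
      have "(LINT x:(\<Union>i. A i)|lborel. f' x) = (\<Sum>i. (LINT x:(A i)|lborel. f' x))"
        using union(1) fi[of "\<Union>i. A i"]
        by (intro lebesgue_integral_countable_add) (auto simp: disjoint_family_on_def set_integrable_def)
      then show ?case
        using union(3) by (simp add: set_lebesgue_integral_def)
    qed auto
  qed
  have "AE x in lborel. f' x = 0"
    by (rule density_unique_real) (use f' all in \<open>auto simp: set_lebesgue_integral_def\<close>)
  then show ?thesis
    by eventually_elim (auto simp: f'_def)
qed

section \<open>Chain rule and truncation of weakly differentiable functions\<close>

lemma integrable_mult_bounded:
  fixes f g :: "'a::euclidean_space \<Rightarrow> real"
  assumes f: "integrable lborel f" and [measurable]: "g \<in> borel_measurable borel"
    and B: "\<And>x. \<bar>g x\<bar> \<le> B"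
  shows "integrable lborel (\<lambda>x. f x * g x)"
proof (rule Bochner_Integration.integrable_bound)
  show "integrable lborel (\<lambda>x. B * \<bar>f x\<bar>)"
    using f by simp
  have [measurable]: "f \<in> borel_measurable borel"
    using f by auto
  show "(\<lambda>x. f x * g x) \<in> borel_measurable lborel"
    by simp
  have "\<bar>f x * g x\<bar> \<le> \<bar>B * \<bar>f x\<bar>\<bar>" for x
  proof -
    have "\<bar>f x * g x\<bar> \<le> B * \<bar>f x\<bar>"
      using mult_right_mono[OF B[of x], of "\<bar>f x\<bar>"] by (simp add: abs_mult mult.commute)
    then show ?thesis by linarith
  qed
  then show "AE x in lborel. norm (f x * g x) \<le> norm (B * \<bar>f x\<bar>)"
    by simp
qed

lemma C1_compact_support_measurable:
  fixes \<phi> :: "'a::euclidean_space \<Rightarrow> real"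
  assumes "\<phi> \<in> C1_compact_support \<Omega>"
  shows "\<phi> \<in> borel_measurable borel"
    and "(\<lambda>x. frechet_derivative \<phi> (at x) v) \<in> borel_measurable borel"
  using C1_compact_support_derivative[OF assms] by (auto intro: borel_measurable_continuous_onI)

lemma has_derivative_line:
  fixes \<phi> :: "'a::euclidean_space \<Rightarrow> real"
  assumes "(\<phi> has_derivative D) (at (x + s *\<^sub>R v))"
  shows "((\<lambda>h. \<phi> (x + h *\<^sub>R v)) has_real_derivative D v) (at s)"
proof -
  have "((\<lambda>h. x + h *\<^sub>R v) has_derivative (\<lambda>h. h *\<^sub>R v)) (at s)"
    by (auto intro!: derivative_eq_intros)
  from has_derivative_compose[OF this assms]
  have "((\<lambda>h. \<phi> (x + h *\<^sub>R v)) has_derivative (\<lambda>h. D (h *\<^sub>R v))) (at s)" .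
  moreover have "D (h *\<^sub>R v) = h * D v" for h
    using has_derivative_linear[OF assms] by (simp add: linear_scale)
  ultimately show ?thesis
    by (simp add: has_field_derivative_def mult.commute[of _ "D v"])
qed

lemma C1_compact_support_translate:
  fixes \<phi> :: "'a::euclidean_space \<Rightarrow> real"
  assumes \<phi>: "\<phi> \<in> C1_compact_support W" and sub: "\<And>x. x \<in> W \<Longrightarrow> x + v \<in> \<Omega>"
  shows "(\<lambda>x. \<phi> (x - v)) \<in> C1_compact_support \<Omega>"
    and "frechet_derivative (\<lambda>x. \<phi> (x - v)) (at x) w = frechet_derivative \<phi> (at (x - v)) w"
proof -
  define K where "K = closure {x. \<phi> x \<noteq> 0}"
  note K = C1_compact_support_support[OF \<phi>, folded K_def]
  have d: "((\<lambda>x. \<phi> (x - v)) has_derivative frechet_derivative \<phi> (at (x - v))) (at x)" for x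
  proof -
    have "((\<lambda>x. x - v) has_derivative (\<lambda>h. h)) (at x)"
      by (auto intro!: derivative_eq_intros)
    from has_derivative_compose[OF this C1_compact_support_derivative(1)[OF \<phi>]] show ?thesis .
  qed
  show "(\<lambda>x. \<phi> (x - v)) \<in> C1_compact_support \<Omega>"
  proof (rule C1_compact_supportI[OF d])
    show "continuous_on UNIV (\<lambda>x. frechet_derivative \<phi> (at (x - v)) w)" for w
      by (rule continuous_on_compose2[OF C1_compact_support_derivative(2)[OF \<phi>]])
         (auto intro!: continuous_intros)
    show "compact ((\<lambda>x. x + v) ` K)"
      using K(1) by (intro compact_continuous_image continuous_intros)
    show "(\<lambda>x. x + v) ` K \<subseteq> \<Omega>"
      using K(2) sub by blast
    show "\<phi> (x - v) = 0" if "x \<notin> (\<lambda>x. x + v) ` K" for x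
    proof (rule K(3))
      show "x - v \<notin> K"
      proof
        assume "x - v \<in> K"
        then have "(x - v) + v \<in> (\<lambda>x. x + v) ` K"
          by (rule imageI)
        then show False using that by simp
      qed
    qed
  qed
  show "frechet_derivative (\<lambda>x. \<phi> (x - v)) (at x) w = frechet_derivative \<phi> (at (x - v)) w"
    by (simp add: has_derivative_frechet_eq[OF d])
qed

text \<open>The setting of the chain rule. Both functions are Borel representatives on the whole space, so that
  Fubini's theorem and translations apply directly; the values outside \<open>\<Omega>\<close> never meet the support of a
  test function.\<close>

locale integrable_weak_gradient =
  fixes \<Omega> :: "'a::euclidean_space set" and u :: "'a \<Rightarrow> real" and g :: "'a \<Rightarrow> 'a"
  assumes open_\<Omega>: "open \<Omega>"
    and u_integrable: "integrable lborel u" and g_integrable: "integrable lborel g"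
    and weak: "\<And>\<phi> b. \<phi> \<in> C1_compact_support \<Omega> \<Longrightarrow> b \<in> Basis \<Longrightarrow>
      (\<integral>x. u x * frechet_derivative \<phi> (at x) b \<partial>lborel) = - (\<integral>x. (g x \<bullet> b) * \<phi> x \<partial>lborel)"
begin

lemma borel_measurable_u [measurable]: "u \<in> borel_measurable borel"
  using u_integrable by auto

lemma borel_measurable_g [measurable]: "g \<in> borel_measurable borel"
  using g_integrable by auto

lemma g_component_integrable: "integrable lborel (\<lambda>x. g x \<bullet> b)"
  using g_integrable by simp

text \<open>Along a coordinate direction, \<open>u(x + h b) - u(x)\<close> is the integral of the partial derivative over the
  segment, for almost every \<open>x\<close>. Tested against \<open>\<psi>\<close>, the difference falls on \<open>\<psi>\<close> and is the integral of
  \<open>D\<psi>\<close> over the reversed segment. The definition of the weak gradient then applies to each translate of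
  \<open>\<psi>\<close>, and the fundamental lemma removes \<open>\<psi>\<close>.\<close>

lemma difference_eq_steklov:
  assumes W: "open W" and sub: "\<And>x s. x \<in> W \<Longrightarrow> 0 \<le> s \<Longrightarrow> s \<le> 1 \<Longrightarrow> x + s *\<^sub>R (h *\<^sub>R b) \<in> \<Omega>"
    and b: "b \<in> Basis"
  shows "AE x in lborel. x \<in> W \<longrightarrow> u (x + h *\<^sub>R b) - u x = h * steklov (h *\<^sub>R b) (\<lambda>x. g x \<bullet> b) x"
proof -
  define v where "v = h *\<^sub>R b"
  define gb where "gb x = g x \<bullet> b" for x
  have gb: "integrable lborel gb"
    unfolding gb_def by (rule g_component_integrable)
  note iu = lborel_integrable_translate[OF u_integrable, of v] u_integrable
  note ist = integrable_steklov[OF gb, of v]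
  have [measurable]: "gb \<in> borel_measurable borel" "steklov v gb \<in> borel_measurable borel"
    using gb ist by auto
  have "AE x in lborel. x \<in> W \<longrightarrow> u (x + v) - u x - h * steklov v gb x = 0"
  proof (rule fundamental_lemma_weak_derivative[OF _ W])
    show "integrable lborel (\<lambda>x. u (x + v) - u x - h * steklov v gb x)"
      using iu ist by simp
    fix \<psi> :: "'a \<Rightarrow> real" assume \<psi>: "\<psi> \<in> C1_compact_support W"
    obtain B where B: "0 \<le> B" "\<And>x. \<bar>\<psi> x\<bar> \<le> B" "\<And>x. \<bar>frechet_derivative \<psi> (at x) b\<bar> \<le> B"
      using C1_compact_support_bounded[OF \<psi>] by blast
    note [measurable] = C1_compact_support_measurable[OF \<psi>]
    let ?d = "\<lambda>x. frechet_derivative \<psi> (at x) b"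
    have ftc: "\<psi> (x - v) - \<psi> x = - h * (\<integral>s. indicator {0..1} s * ?d (x - s *\<^sub>R v) \<partial>lborel)" for x
    proof -
      have der: "((\<lambda>s. \<psi> (x + s *\<^sub>R (- v))) has_real_derivative
          frechet_derivative \<psi> (at (x + s *\<^sub>R (- v))) (- v)) (at s)" for s
        by (rule has_derivative_line[OF C1_compact_support_derivative(1)[OF \<psi>]])
      have "(\<integral>s. frechet_derivative \<psi> (at (x + s *\<^sub>R (- v))) (- v) * indicator {0..1} s \<partial>lborel)
          = \<psi> (x + 1 *\<^sub>R (- v)) - \<psi> (x + 0 *\<^sub>R (- v))"
      proof (rule integral_FTC_Icc_real[OF _ der])
        have "continuous_on UNIV (\<lambda>s. frechet_derivative \<psi> (at (x + s *\<^sub>R (- v))) (- v))"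
          by (rule continuous_on_compose2[OF C1_compact_support_derivative(2)[OF \<psi>]])
             (auto intro!: continuous_intros)
        then show "isCont (\<lambda>s. frechet_derivative \<psi> (at (x + s *\<^sub>R (- v))) (- v)) s" for s
          by (simp add: continuous_on_eq_continuous_at)
      qed simp
      moreover have "frechet_derivative \<psi> (at y) (- v) = - h * ?d y" for y
        using has_derivative_linear[OF C1_compact_support_derivative(1)[OF \<psi>, of y]]
        by (simp add: v_def linear_neg linear_scale)
      ultimately show ?thesis
        by (simp add: mult.commute[of _ "indicator {0..1} _"] mult.left_commute[of _ h])
    qed
    have [measurable]: "(\<lambda>p. ?d (fst p - snd p *\<^sub>R v)) \<in> borel_measurable (borel \<Otimes>\<^sub>M borel)"
      by measurable
    \<comment> \<open>Both sides become double integrals over the segment parameter and the space variable; for a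
      fixed parameter they agree because a translate of \<open>\<psi>\<close> is a test function in \<open>\<Omega>\<close>.\<close>
    have i1: "integrable (lborel \<Otimes>\<^sub>M lborel) (\<lambda>(x, s). u x * (indicator {0..1::real} s * ?d (x - s *\<^sub>R v)))"
    proof (rule Bochner_Integration.integrable_bound)
      have "integrable (lborel \<Otimes>\<^sub>M lborel) (\<lambda>(s, x). indicator {0..1::real} s * u (x + s *\<^sub>R 0))"
        by (rule steklov_pair_integrable[OF u_integrable])
      then have "integrable (lborel \<Otimes>\<^sub>M lborel) (\<lambda>(x, s). indicator {0..1::real} s * u x)"
        by (subst lborel_pair.integrable_product_swap_iff[symmetric]) simp
      then show "integrable (lborel \<Otimes>\<^sub>M lborel) (\<lambda>p. B * (case p of (x, s) \<Rightarrow> indicator {0..1::real} s * u x))"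
        by simp
      have "\<bar>u x * (indicator {0..1::real} s * ?d (x - s *\<^sub>R v))\<bar> \<le> \<bar>B * (indicator {0..1::real} s * u x)\<bar>" for x s
        using mult_right_mono[OF B(3)[of "x - s *\<^sub>R v"], of "\<bar>u x\<bar> * indicator {0..1} s"] B(1)
        by (simp add: abs_mult mult_ac)
      then show "AE p in lborel \<Otimes>\<^sub>M lborel. norm (case p of (x, s) \<Rightarrow> u x * (indicator {0..1::real} s * ?d (x - s *\<^sub>R v)))
          \<le> norm (B * (case p of (x, s) \<Rightarrow> indicator {0..1::real} s * u x))"
        by (intro AE_I2) (simp add: case_prod_unfold)
    qed (simp add: case_prod_unfold)
    have i2: "integrable (lborel \<Otimes>\<^sub>M lborel) (\<lambda>(s, x). indicator {0..1::real} s * gb (x + s *\<^sub>R v) * \<psi> x)"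
    proof (rule Bochner_Integration.integrable_bound)
      show "integrable (lborel \<Otimes>\<^sub>M lborel) (\<lambda>p. B * (case p of (s, x) \<Rightarrow> indicator {0..1::real} s * gb (x + s *\<^sub>R v)))"
        using steklov_pair_integrable[OF gb, of v] by simp
      have "\<bar>indicator {0..1::real} s * gb (x + s *\<^sub>R v) * \<psi> x\<bar> \<le> \<bar>B * (indicator {0..1::real} s * gb (x + s *\<^sub>R v))\<bar>" for x s
        using mult_right_mono[OF B(2)[of x], of "\<bar>gb (x + s *\<^sub>R v)\<bar> * indicator {0..1} s"] B(1)
        by (simp add: abs_mult mult_ac)
      then show "AE p in lborel \<Otimes>\<^sub>M lborel. norm (case p of (s, x) \<Rightarrow> indicator {0..1::real} s * gb (x + s *\<^sub>R v) * \<psi> x)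
          \<le> norm (B * (case p of (s, x) \<Rightarrow> indicator {0..1::real} s * gb (x + s *\<^sub>R v)))"
        by (intro AE_I2) (simp add: case_prod_unfold)
    qed (simp add: case_prod_unfold)
    have i2': "integrable (lborel \<Otimes>\<^sub>M lborel) (\<lambda>(x, s). indicator {0..1::real} s * gb (x + s *\<^sub>R v) * \<psi> x)"
      using i2 by (subst lborel_pair.integrable_product_swap_iff[symmetric]) simp
    have "(\<integral>x. u x * (\<psi> (x - v) - \<psi> x) \<partial>lborel)
        = - h * (\<integral>x. (\<integral>s. u x * (indicator {0..1} s * ?d (x - s *\<^sub>R v)) \<partial>lborel) \<partial>lborel)"
      by (simp add: ftc mult.left_commute[of _ h])
    also have "(\<integral>x. (\<integral>s. u x * (indicator {0..1} s * ?d (x - s *\<^sub>R v)) \<partial>lborel) \<partial>lborel)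
        = (\<integral>s. (\<integral>x. u x * (indicator {0..1} s * ?d (x - s *\<^sub>R v)) \<partial>lborel) \<partial>lborel)"
      using lborel_pair.Fubini_integral[OF i1] by simp
    also have "\<dots> = (\<integral>s. - (\<integral>x. indicator {0..1} s * gb (x + s *\<^sub>R v) * \<psi> x \<partial>lborel) \<partial>lborel)"
    proof (intro Bochner_Integration.integral_cong refl)
      fix s :: real
      show "(\<integral>x. u x * (indicator {0..1} s * ?d (x - s *\<^sub>R v)) \<partial>lborel)
          = - (\<integral>x. indicator {0..1} s * gb (x + s *\<^sub>R v) * \<psi> x \<partial>lborel)"
      proof (cases "s \<in> {0..1}")
        case True
        have tr: "(\<lambda>x. \<psi> (x - s *\<^sub>R v)) \<in> C1_compact_support \<Omega>"
            "\<And>x w. frechet_derivative (\<lambda>x. \<psi> (x - s *\<^sub>R v)) (at x) w = frechet_derivative \<psi> (at (x - s *\<^sub>R v)) w"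
          using C1_compact_support_translate[OF \<psi>, of "s *\<^sub>R v" \<Omega>] sub True by (auto simp: v_def)
        have "(\<integral>x. u x * ?d (x - s *\<^sub>R v) \<partial>lborel) = - (\<integral>x. gb x * \<psi> (x - s *\<^sub>R v) \<partial>lborel)"
          using weak[OF tr(1) b] by (simp add: tr(2) gb_def)
        also have "(\<integral>x. gb x * \<psi> (x - s *\<^sub>R v) \<partial>lborel) = (\<integral>x. gb (x + s *\<^sub>R v) * \<psi> (x + s *\<^sub>R v - s *\<^sub>R v) \<partial>lborel)"
          by (rule lborel_integral_translate[symmetric]) simp
        finally show ?thesis
          using True by simp
      qed simp
    qed
    also have "\<dots> = - (\<integral>x. (\<integral>s. indicator {0..1} s * gb (x + s *\<^sub>R v) * \<psi> x \<partial>lborel) \<partial>lborel)"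
      using lborel_pair.Fubini_integral[OF i2'] by simp
    also have "\<dots> = - (\<integral>x. steklov v gb x * \<psi> x \<partial>lborel)"
      by (simp add: steklov_def)
    finally have main: "(\<integral>x. u x * (\<psi> (x - v) - \<psi> x) \<partial>lborel) = h * (\<integral>x. steklov v gb x * \<psi> x \<partial>lborel)"
      by simp
    have j: "integrable lborel (\<lambda>x. u (x + v) * \<psi> x)" "integrable lborel (\<lambda>x. u x * \<psi> x)"
        "integrable lborel (\<lambda>x. u x * \<psi> (x - v))" "integrable lborel (\<lambda>x. steklov v gb x * \<psi> x)"
      using iu ist by (auto intro!: integrable_mult_bounded[where B = B] B(2))
    have "(\<integral>x. u (x + v) * \<psi> (x + v - v) \<partial>lborel) = (\<integral>x. u x * \<psi> (x - v) \<partial>lborel)"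
      by (rule lborel_integral_translate) simp
    then show "(\<integral>x. (u (x + v) - u x - h * steklov v gb x) * \<psi> x \<partial>lborel) = 0"
      using main j by (simp add: left_diff_distrib right_diff_distrib mult.assoc)
  qed
  then show ?thesis
    by (simp add: v_def gb_def[abs_def] algebra_simps)
qed

end

text \<open>The difference quotient of \<open>F\<close>, completed by the derivative on the diagonal so that
  \<open>slope F F' a b * (b - a) = F b - F a\<close> holds without exception.\<close>

definition slope :: "(real \<Rightarrow> real) \<Rightarrow> (real \<Rightarrow> real) \<Rightarrow> real \<Rightarrow> real \<Rightarrow> real" where
  "slope F F' a b = (if a = b then F' a else (F b - F a) / (b - a))"

lemma slope_mult: "slope F F' a b * (b - a) = F b - F a"
  by (simp add: slope_def)

lemma slope_mean_value:
  assumes F: "\<And>y. (F has_real_derivative F' y) (at y)"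
  shows "\<exists>\<xi>. \<bar>\<xi> - a\<bar> \<le> \<bar>b - a\<bar> \<and> slope F F' a b = F' \<xi>"
proof -
  consider "a = b" | "a < b" | "b < a" by linarith
  then show ?thesis
  proof cases
    case 2
    then obtain z where "a < z" "z < b" "F b - F a = (b - a) * F' z"
      using MVT2[of a b F F'] F by blast
    then show ?thesis
      by (intro exI[of _ z]) (auto simp: slope_def field_simps)
  next
    case 3
    then obtain z where z: "b < z" "z < a" "F a - F b = (a - b) * F' z"
      using MVT2[of b a F F'] F by blast
    then have "slope F F' a b = F' z"
      using 3 by (simp add: slope_def field_simps)
    then show ?thesis
      using z by (intro exI[of _ z]) auto
  qed (auto simp: slope_def)
qed

lemma slope_tendsto:
  assumes F: "\<And>y. (F has_real_derivative F' y) (at y)" and F': "continuous_on UNIV F'"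
    and y: "y \<longlonglongrightarrow> a"
  shows "(\<lambda>n. slope F F' a (y n)) \<longlonglongrightarrow> F' a"
proof -
  obtain \<xi> where \<xi>: "\<And>n. \<bar>\<xi> n - a\<bar> \<le> \<bar>y n - a\<bar>" "\<And>n. slope F F' a (y n) = F' (\<xi> n)"
  proof -
    have "\<forall>n. \<exists>\<xi>. \<bar>\<xi> - a\<bar> \<le> \<bar>y n - a\<bar> \<and> slope F F' a (y n) = F' \<xi>"
      using slope_mean_value[OF F] by blast
    then show thesis
      using that by (auto dest!: choice)
  qed
  have "(\<lambda>n. \<xi> n - a) \<longlonglongrightarrow> 0"
  proof (rule Lim_null_comparison)
    show "\<forall>\<^sub>F n in sequentially. norm (\<xi> n - a) \<le> \<bar>y n - a\<bar>"
      using \<xi>(1) by simp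
    show "(\<lambda>n. \<bar>y n - a\<bar>) \<longlonglongrightarrow> 0"
      using y by (simp add: LIM_zero tendsto_rabs_zero)
  qed
  then have "\<xi> \<longlonglongrightarrow> a"
    by (rule LIM_zero_cancel)
  moreover have "isCont F' a"
    using F' by (simp add: continuous_on_eq_continuous_at)
  ultimately show ?thesis
    unfolding \<xi>(2) by (rule isCont_tendsto_compose[rotated])
qed

lemma integral_derivative_test_function:
  fixes \<phi> :: "'a::euclidean_space \<Rightarrow> real"
  assumes \<phi>: "\<phi> \<in> C1_compact_support \<Omega>"
  shows "(\<integral>x. frechet_derivative \<phi> (at x) v \<partial>lborel) = 0"
    and "integrable lborel (\<lambda>x. frechet_derivative \<phi> (at x) v)"
proof -
  define K where "K = closure {x. \<phi> x \<noteq> 0}"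
  note K = C1_compact_support_support[OF \<phi>, folded K_def]
  obtain R where R: "\<And>x. x \<in> K \<Longrightarrow> norm x \<le> R"
    using compact_imp_bounded[OF K(1)] unfolding bounded_iff by blast
  show "(\<integral>x. frechet_derivative \<phi> (at x) v \<partial>lborel) = 0"
  proof (rule integral_directional_derivative_eq_0)
    show "((\<lambda>h. \<phi> (x + h *\<^sub>R v)) has_real_derivative frechet_derivative \<phi> (at x) v) (at 0)" for x
      using has_derivative_line[of \<phi> "frechet_derivative \<phi> (at x)" x 0 v]
        C1_compact_support_derivative(1)[OF \<phi>] by simp
    show "\<phi> x = 0" if "norm x > R" for x
      using K(3)[of x] R[of x] that by force
  qed (rule C1_compact_support_derivative[OF \<phi>])+
  obtain B where B: "\<And>x. \<bar>frechet_derivative \<phi> (at x) v\<bar> \<le> B"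
    using C1_compact_support_bounded[OF \<phi>] by metis
  note [measurable] = C1_compact_support_measurable[OF \<phi>]
  have "K \<in> sets borel" "emeasure lborel K < \<infinity>"
    using K(1) emeasure_compact_finite by (auto simp: compact_imp_closed borel_closed)
  then have "integrable lborel (indicator K :: 'a \<Rightarrow> real)"
    by (simp add: integrable_indicator_iff)
  from integrable_mult_bounded[OF this _ B]
  have "integrable lborel (\<lambda>x. indicator K x * frechet_derivative \<phi> (at x) v)"
    by simp
  also have "(\<lambda>x. indicator K x * frechet_derivative \<phi> (at x) v) = (\<lambda>x. frechet_derivative \<phi> (at x) v)"
  proof
    show "indicator K x * frechet_derivative \<phi> (at x) v = frechet_derivative \<phi> (at x) v" for x
      using K(4)[of x v] by (cases "x \<in> K") simp_all
  qed
  finally show "integrable lborel (\<lambda>x. frechet_derivative \<phi> (at x) v)" .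
qed

context integrable_weak_gradient
begin

text \<open>The difference quotient of \<open>F \<circ> u\<close> is a slope of \<open>F\<close> times the difference quotient of \<open>u\<close>. The latter
  is a Steklov average of the weak gradient and converges in \<open>L\<^sup>1\<close>; the former is bounded and converges
  almost everywhere along a suitable sequence of steps. The normalization \<open>F 0 = 0\<close> makes \<open>F \<circ> u\<close>
  integrable.\<close>

lemma weak_chain_rule:
  fixes F F' :: "real \<Rightarrow> real"
  assumes F: "\<And>y. (F has_real_derivative F' y) (at y)" and F': "continuous_on UNIV F'"
    and C: "\<And>y. \<bar>F' y\<bar> \<le> C" and F0: "F 0 = 0"
    and \<phi>: "\<phi> \<in> C1_compact_support \<Omega>" and b: "b \<in> Basis"
  shows "(\<integral>x. F (u x) * frechet_derivative \<phi> (at x) b \<partial>lborel)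
    = - (\<integral>x. F' (u x) * (g x \<bullet> b) * \<phi> x \<partial>lborel)"
proof -
  define gb where "gb x = g x \<bullet> b" for x
  have gb: "integrable lborel gb"
    unfolding gb_def by (rule g_component_integrable)
  have [measurable]: "gb \<in> borel_measurable borel"
    using gb by auto
  have Fcont: "continuous_on UNIV F"
    by (meson F DERIV_isCont continuous_at_imp_continuous_on)
  have [measurable]: "F \<in> borel_measurable borel" "F' \<in> borel_measurable borel"
    using Fcont F' by (auto intro: borel_measurable_continuous_onI)
  note [measurable] = C1_compact_support_measurable[OF \<phi>]
  have C0: "0 \<le> C"
    using C[of 0] by linarith
  have slope_le: "\<bar>slope F F' y z\<bar> \<le> C" for y z
    using slope_mean_value[OF F, of y z] C by auto
  have F_le: "\<bar>F y\<bar> \<le> C * \<bar>y\<bar>" for y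
    using slope_mult[of F F' 0 y] mult_right_mono[OF slope_le[of 0 y], of "\<bar>y\<bar>"] F0
    by (simp add: abs_mult[symmetric])
  have iF: "integrable lborel (\<lambda>x. F (u x))"
  proof (rule Bochner_Integration.integrable_bound)
    show "integrable lborel (\<lambda>x. C * \<bar>u x\<bar>)"
      using u_integrable by simp
    show "AE x in lborel. norm (F (u x)) \<le> norm (C * \<bar>u x\<bar>)"
      using F_le C0 by (intro AE_I2) (simp add: abs_mult)
  qed simp
  obtain B where B: "0 \<le> B" "\<And>x. \<bar>\<phi> x\<bar> \<le> B" "\<And>x. \<bar>frechet_derivative \<phi> (at x) b\<bar> \<le> B"
    using C1_compact_support_bounded[OF \<phi>] by metis
  define K where "K = closure {x. \<phi> x \<noteq> 0}"
  note K = C1_compact_support_support[OF \<phi>, folded K_def]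
  obtain \<epsilon> where \<epsilon>: "\<epsilon> > 0" "(\<Union>x\<in>K. ball x \<epsilon>) \<subseteq> \<Omega>"
    using compact_subset_open_imp_ball_epsilon_subset[OF K(1) open_\<Omega> K(2)] by blast
  define W where "W = (\<Union>x\<in>K. ball x (\<epsilon> / 2))"
  have W: "open W" "K \<subseteq> W"
    using \<epsilon>(1) by (auto simp: W_def)
  \<comment> \<open>The first sequence of steps gives \<open>L\<^sup>1\<close> convergence of the translates of \<open>u\<close>. The slopes need
    pointwise convergence, hence the subsequence \<open>h\<close>. The bound \<open>\<epsilon> / 4\<close> keeps the segments that start
    in \<open>W\<close> inside \<open>\<Omega>\<close>.\<close>
  define h' where "h' n = (\<epsilon> / 4) * inverse (real (Suc n))" for n
  have h': "0 < h' n" "h' n \<le> \<epsilon> / 4" for n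
    using \<epsilon>(1) by (auto simp: h'_def field_simps)
  have h'_lim: "h' \<longlonglongrightarrow> 0"
    unfolding h'_def using tendsto_mult_left[OF LIMSEQ_inverse_real_of_nat, of "\<epsilon> / 4"] by simp
  have "(\<lambda>n. h' n *\<^sub>R b) \<longlonglongrightarrow> 0"
    using tendsto_scaleR[OF h'_lim tendsto_const, of b] by simp
  from translation_modulus_tendsto[OF u_integrable this]
  have L1: "(\<lambda>n. \<integral>x. norm (u (x + h' n *\<^sub>R b) - u x) \<partial>lborel) \<longlonglongrightarrow> 0"
    by (simp add: translation_modulus_def)
  have "integrable lborel (\<lambda>x. u (x + h' n *\<^sub>R b) - u x)" for n
    using lborel_integrable_translate[OF u_integrable] u_integrable by simp
  from tendsto_L1_AE_subseq[OF this L1] obtain \<rho> where \<rho>: "strict_mono \<rho>"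
      "AE x in lborel. (\<lambda>n. u (x + h' (\<rho> n) *\<^sub>R b) - u x) \<longlonglongrightarrow> 0"
    by blast
  define h where "h n = h' (\<rho> n)" for n
  have h: "0 < h n" "h n \<le> \<epsilon> / 4" for n
    using h' by (auto simp: h_def)
  have h_lim: "h \<longlonglongrightarrow> 0"
    using LIMSEQ_subseq_LIMSEQ[OF h'_lim \<rho>(1)] by (simp add: h_def[abs_def] comp_def)
  have hb_lim: "(\<lambda>n. h n *\<^sub>R b) \<longlonglongrightarrow> 0"
    using tendsto_scaleR[OF h_lim tendsto_const, of b] by simp
  have u_lim: "AE x in lborel. (\<lambda>n. u (x + h n *\<^sub>R b)) \<longlonglongrightarrow> u x"
    using \<rho>(2) unfolding h_def by eventually_elim (rule LIM_zero_cancel)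
  define D where "D n x = steklov (h n *\<^sub>R b) gb x" for n x
  have iD: "integrable lborel (D n)" for n
    unfolding D_def[abs_def] by (rule integrable_steklov[OF gb])
  have [measurable]: "D n \<in> borel_measurable borel" for n
    using iD[of n] by auto
  have D_L1: "(\<lambda>n. \<integral>x. \<bar>D n x - gb x\<bar> \<partial>lborel) \<longlonglongrightarrow> 0"
    unfolding D_def by (rule steklov_tendsto_L1[OF gb hb_lim])
  have diff: "AE x in lborel. x \<in> W \<longrightarrow> u (x + h n *\<^sub>R b) - u x = h n * D n x" for n
    unfolding D_def gb_def[abs_def]
  proof (rule difference_eq_steklov[OF W(1) _ b])
    fix x s assume "x \<in> W" "0 \<le> s" "s \<le> (1::real)"
    then obtain y where y: "y \<in> K" "dist y x < \<epsilon> / 2"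
      by (auto simp: W_def)
    have "norm (s *\<^sub>R (h n *\<^sub>R b)) \<le> 1 * (\<epsilon> / 4)"
      using \<open>0 \<le> s\<close> \<open>s \<le> 1\<close> h[of n] b by (simp only: norm_scaleR norm_Basis) (intro mult_mono; simp)
    then have "dist y (x + s *\<^sub>R (h n *\<^sub>R b)) < \<epsilon>"
      using y(2) dist_triangle[of y "x + s *\<^sub>R (h n *\<^sub>R b)" x] \<epsilon>(1) by (simp add: dist_norm)
    then have "x + s *\<^sub>R (h n *\<^sub>R b) \<in> (\<Union>x\<in>K. ball x \<epsilon>)"
      by (intro UN_I[OF y(1)]) simp
    then show "x + s *\<^sub>R (h n *\<^sub>R b) \<in> \<Omega>"
      using \<epsilon>(2) by blast
  qed
  define q where "q n x = slope F F' (u x) (u (x + h n *\<^sub>R b))" for n x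
  have [measurable]: "q n \<in> borel_measurable borel" for n
    unfolding q_def[abs_def] slope_def by measurable
  have q_le: "\<bar>q n x\<bar> \<le> C" for n x
    unfolding q_def by (rule slope_le)
  \<comment> \<open>Integration by parts for difference quotients is a change of variables; the difference of
    \<open>F \<circ> u\<close> is then rewritten with \<open>slope_mult\<close> and the Steklov formula for that of \<open>u\<close>.\<close>
  have parts: "(\<integral>x. F (u x) * ((\<phi> (x - h n *\<^sub>R b) - \<phi> x) / h n) \<partial>lborel) = (\<integral>x. q n x * D n x * \<phi> x \<partial>lborel)" for n
  proof -
    let ?v = "h n *\<^sub>R b"
    have j: "integrable lborel (\<lambda>x. F (u x) * \<phi> (x - ?v))" "integrable lborel (\<lambda>x. F (u x) * \<phi> x)"
        "integrable lborel (\<lambda>x. F (u (x + ?v)) * \<phi> x)"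
      using iF lborel_integrable_translate[OF iF, of ?v]
      by (auto intro!: integrable_mult_bounded[where B = B] B(2))
    have tr: "(\<integral>x. F (u (x + ?v)) * \<phi> (x + ?v - ?v) \<partial>lborel) = (\<integral>x. F (u x) * \<phi> (x - ?v) \<partial>lborel)"
      by (rule lborel_integral_translate) simp
    have "(\<integral>x. F (u x) * ((\<phi> (x - ?v) - \<phi> x) / h n) \<partial>lborel)
        = (\<integral>x. (F (u x) * \<phi> (x - ?v) - F (u x) * \<phi> x) / h n \<partial>lborel)"
      by (simp add: right_diff_distrib)
    also have "\<dots> = ((\<integral>x. F (u x) * \<phi> (x - ?v) \<partial>lborel) - (\<integral>x. F (u x) * \<phi> x \<partial>lborel)) / h n"
      using j by simp
    also have "\<dots> = ((\<integral>x. F (u (x + ?v)) * \<phi> x \<partial>lborel) - (\<integral>x. F (u x) * \<phi> x \<partial>lborel)) / h n"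
      using tr by simp
    also have "\<dots> = (\<integral>x. (F (u (x + ?v)) * \<phi> x - F (u x) * \<phi> x) / h n \<partial>lborel)"
      using j by simp
    also have "\<dots> = (\<integral>x. q n x * D n x * \<phi> x \<partial>lborel)"
    proof (rule integral_cong_AE)
      show "AE x in lborel. (F (u (x + ?v)) * \<phi> x - F (u x) * \<phi> x) / h n = q n x * D n x * \<phi> x"
        using diff[of n]
      proof eventually_elim
        case (elim x)
        show ?case
        proof (cases "x \<in> W")
          case True
          have "F (u (x + ?v)) - F (u x) = q n x * (h n * D n x)"
            using elim True slope_mult[of F F' "u x" "u (x + ?v)"] by (simp add: q_def)
          then have "F (u (x + ?v)) * \<phi> x - F (u x) * \<phi> x = q n x * (h n * D n x) * \<phi> x"
            by (simp add: left_diff_distrib[symmetric])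
          then show ?thesis
            using h(1)[of n] by simp
        next
          case False
          then have "\<phi> x = 0"
            using W(2) K(3) by blast
          then show ?thesis by simp
        qed
      qed
    qed simp_all
    finally show ?thesis .
  qed
  have lim1: "(\<lambda>n. \<integral>x. F (u x) * ((\<phi> (x - h n *\<^sub>R b) - \<phi> x) / h n) \<partial>lborel)
      \<longlonglongrightarrow> (\<integral>x. F (u x) * - frechet_derivative \<phi> (at x) b \<partial>lborel)"
  proof (rule integral_dominated_convergence)
    show "integrable lborel (\<lambda>x. \<bar>F (u x)\<bar> * B)"
      using iF by simp
    have der: "((\<lambda>s. \<phi> (x + s *\<^sub>R (- b))) has_real_derivative
        frechet_derivative \<phi> (at (x + s *\<^sub>R (- b))) (- b)) (at s)" for x s
      by (rule has_derivative_line[OF C1_compact_support_derivative(1)[OF \<phi>]])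
    have neg: "frechet_derivative \<phi> (at y) (- b) = - frechet_derivative \<phi> (at y) b" for y
      using has_derivative_linear[OF C1_compact_support_derivative(1)[OF \<phi>, of y]]
      by (simp add: linear_neg)
    show "AE x in lborel. norm (F (u x) * ((\<phi> (x - h n *\<^sub>R b) - \<phi> x) / h n)) \<le> \<bar>F (u x)\<bar> * B" for n
    proof (rule AE_I2)
      fix x
      obtain z where "\<phi> (x + h n *\<^sub>R (- b)) - \<phi> (x + 0 *\<^sub>R (- b))
          = (h n - 0) * frechet_derivative \<phi> (at (x + z *\<^sub>R (- b))) (- b)"
        using MVT2[OF h(1)[of n], OF der, of x] by blast
      then have "\<bar>(\<phi> (x - h n *\<^sub>R b) - \<phi> x) / h n\<bar> \<le> B"
        using B(3) h(1)[of n] by (simp add: neg)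
      then show "norm (F (u x) * ((\<phi> (x - h n *\<^sub>R b) - \<phi> x) / h n)) \<le> \<bar>F (u x)\<bar> * B"
        unfolding real_norm_def abs_mult by (intro mult_left_mono) simp_all
    qed
    show "AE x in lborel. (\<lambda>n. F (u x) * ((\<phi> (x - h n *\<^sub>R b) - \<phi> x) / h n))
        \<longlonglongrightarrow> F (u x) * - frechet_derivative \<phi> (at x) b"
    proof (intro AE_I2 tendsto_mult tendsto_const)
      fix x
      have "((\<lambda>k. (\<phi> (x + (0 + k) *\<^sub>R (- b)) - \<phi> (x + 0 *\<^sub>R (- b))) / k) \<longlongrightarrow>
          frechet_derivative \<phi> (at (x + 0 *\<^sub>R (- b))) (- b)) (at 0)"
        using der[of x 0] unfolding DERIV_def .
      moreover have "filterlim h (at 0) sequentially"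
        using h_lim h(1) by (auto simp: filterlim_at intro!: eventuallyI) (metis less_irrefl)
      ultimately have "(\<lambda>n. (\<phi> (x + (0 + h n) *\<^sub>R (- b)) - \<phi> (x + 0 *\<^sub>R (- b))) / h n) \<longlonglongrightarrow>
          frechet_derivative \<phi> (at (x + 0 *\<^sub>R (- b))) (- b)"
        by (rule filterlim_compose)
      then show "(\<lambda>n. (\<phi> (x - h n *\<^sub>R b) - \<phi> x) / h n) \<longlonglongrightarrow> - frechet_derivative \<phi> (at x) b"
        by (simp add: neg)
    qed
  qed simp_all
  have lim2: "(\<lambda>n. \<integral>x. q n x * D n x * \<phi> x \<partial>lborel) \<longlonglongrightarrow> (\<integral>x. F' (u x) * gb x * \<phi> x \<partial>lborel)"
  proof -
    have i1: "integrable lborel (\<lambda>x. (D n x - gb x) * (q n x * \<phi> x))" for n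
      using iD[of n] gb
      by (intro integrable_mult_bounded[where B = "C * B"]) (auto simp: abs_mult intro!: mult_mono q_le B C0)
    have i2: "integrable lborel (\<lambda>x. gb x * (q n x * \<phi> x))" for n
      using gb
      by (intro integrable_mult_bounded[where B = "C * B"]) (auto simp: abs_mult intro!: mult_mono q_le B C0)
    have split: "(\<integral>x. q n x * D n x * \<phi> x \<partial>lborel)
        = (\<integral>x. (D n x - gb x) * (q n x * \<phi> x) \<partial>lborel) + (\<integral>x. gb x * (q n x * \<phi> x) \<partial>lborel)" for n
      using i1[of n] i2[of n]
      by (subst Bochner_Integration.integral_add[symmetric])
         (auto intro!: Bochner_Integration.integral_cong simp: algebra_simps)
    have "(\<lambda>n. \<integral>x. (D n x - gb x) * (q n x * \<phi> x) \<partial>lborel) \<longlonglongrightarrow> 0"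
    proof (rule Lim_null_comparison)
      show "(\<lambda>n. (C * B) * (\<integral>x. \<bar>D n x - gb x\<bar> \<partial>lborel)) \<longlonglongrightarrow> 0"
        using tendsto_mult_left[OF D_L1, of "C * B"] by simp
      show "\<forall>\<^sub>F n in sequentially. norm (\<integral>x. (D n x - gb x) * (q n x * \<phi> x) \<partial>lborel)
          \<le> (C * B) * (\<integral>x. \<bar>D n x - gb x\<bar> \<partial>lborel)"
      proof (intro always_eventually allI)
        fix n
        have "norm (\<integral>x. (D n x - gb x) * (q n x * \<phi> x) \<partial>lborel)
            \<le> (\<integral>x. (C * B) * \<bar>D n x - gb x\<bar> \<partial>lborel)"
        proof (rule Bochner_Integration.integral_norm_bound_integral[OF i1])
          show "integrable lborel (\<lambda>x. (C * B) * \<bar>D n x - gb x\<bar>)"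
            using iD[of n] gb by simp
          fix x
          have "\<bar>q n x * \<phi> x\<bar> \<le> C * B"
            unfolding abs_mult by (intro mult_mono q_le B C0) simp
          then show "norm ((D n x - gb x) * (q n x * \<phi> x)) \<le> (C * B) * \<bar>D n x - gb x\<bar>"
            unfolding real_norm_def abs_mult[of "D n x - gb x"] mult.commute[of "C * B"]
            by (intro mult_left_mono) simp_all
        qed
        then show "norm (\<integral>x. (D n x - gb x) * (q n x * \<phi> x) \<partial>lborel)
            \<le> (C * B) * (\<integral>x. \<bar>D n x - gb x\<bar> \<partial>lborel)"
          by simp
      qed
    qed
    moreover have "(\<lambda>n. \<integral>x. gb x * (q n x * \<phi> x) \<partial>lborel) \<longlonglongrightarrow> (\<integral>x. gb x * (F' (u x) * \<phi> x) \<partial>lborel)"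
    proof (rule integral_dominated_convergence)
      show "integrable lborel (\<lambda>x. \<bar>gb x\<bar> * (C * B))"
        using gb by simp
      show "AE x in lborel. (\<lambda>n. gb x * (q n x * \<phi> x)) \<longlonglongrightarrow> gb x * (F' (u x) * \<phi> x)"
        using u_lim
      proof eventually_elim
        case (elim x)
        then show ?case
          unfolding q_def by (intro tendsto_mult tendsto_const slope_tendsto[OF F F'])
      qed
      show "AE x in lborel. norm (gb x * (q n x * \<phi> x)) \<le> \<bar>gb x\<bar> * (C * B)" for n
        unfolding real_norm_def abs_mult by (intro AE_I2 mult_left_mono mult_mono q_le B C0) simp_all
    qed simp_all
    ultimately show ?thesis
      unfolding split using tendsto_add[of _ 0 sequentially] by (fastforce simp: mult_ac)
  qed
  have "(\<integral>x. F (u x) * - frechet_derivative \<phi> (at x) b \<partial>lborel) = (\<integral>x. F' (u x) * gb x * \<phi> x \<partial>lborel)"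
    using lim1 lim2 unfolding parts by (rule LIMSEQ_unique)
  then show ?thesis
    by (simp add: gb_def)
qed

end

text \<open>A \<open>C\<^sup>1\<close> function within distance \<open>1\<close> of the positive part, whose derivative is the clamp of \<open>y\<close> to
  \<open>[0, 1]\<close>.\<close>

definition ramp :: "real \<Rightarrow> real" where
  "ramp y = ((max 0 y)\<^sup>2 - (max 0 (y - 1))\<^sup>2) / 2"

lemma DERIV_ramp: "(ramp has_real_derivative max 0 y - max 0 (y - 1)) (at y)"
proof -
  have "((\<lambda>y. (max 0 (y - 1))\<^sup>2) has_real_derivative 2 * max 0 (y - 1) * 1) (at y)"
    by (rule DERIV_chain2[OF DERIV_pos_part_square]) (auto intro!: derivative_eq_intros)
  from DERIV_cdivide[OF DERIV_diff[OF DERIV_pos_part_square this], of 2]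
  show ?thesis
    unfolding ramp_def[abs_def] by (simp add: diff_divide_distrib)
qed

lemma ramp_bounds: "max 0 y - 1 \<le> ramp y" "ramp y \<le> max 0 y"
proof -
  consider "y \<le> 0" | "0 < y" "y \<le> 1" | "1 < y" by linarith
  then have "max 0 y - 1 \<le> ramp y \<and> ramp y \<le> max 0 y"
  proof cases
    case 2
    then show ?thesis
      using zero_le_power2[of "y - 1"] mult_mono[of y 1 y y]
      by (auto simp: ramp_def max_def power2_eq_square algebra_simps)
  next
    case 3
    then show ?thesis
      by (simp add: ramp_def max_def power2_eq_square algebra_simps)
  qed (auto simp: ramp_def)
  then show "max 0 y - 1 \<le> ramp y" "ramp y \<le> max 0 y" by auto
qed

context integrable_weak_gradient
begin

text \<open>Apply the chain rule to ramps of slope one that bend on an interval of length \<open>1/N\<close> to the right of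
  \<open>a\<close>. Their derivatives converge everywhere to the indicator of \<open>(a, \<infinity>)\<close>, including at \<open>a\<close> itself. The
  constant \<open>max 0 (- a)\<close> comes from the normalization of the chain rule.\<close>

lemma weak_gradient_pos_part:
  assumes \<phi>: "\<phi> \<in> C1_compact_support \<Omega>" and b: "b \<in> Basis"
  shows "(\<integral>x. (max 0 (u x - a) - max 0 (- a)) * frechet_derivative \<phi> (at x) b \<partial>lborel)
    = - (\<integral>x. indicator {x. a < u x} x * (g x \<bullet> b) * \<phi> x \<partial>lborel)"
proof -
  note [measurable] = C1_compact_support_measurable[OF \<phi>]
  obtain B where B: "0 \<le> B" "\<And>x. \<bar>\<phi> x\<bar> \<le> B" "\<And>x. \<bar>frechet_derivative \<phi> (at x) b\<bar> \<le> B"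
    using C1_compact_support_bounded[OF \<phi>] by metis
  define N where "N n = real (Suc n)" for n
  have N: "N n > 0" for n
    by (simp add: N_def)
  have N_lim: "filterlim N at_top sequentially"
    unfolding N_def by (rule filterlim_compose[OF filterlim_real_sequentially filterlim_Suc])
  define F where "F n y = (ramp ((y - a) * N n) - ramp (- a * N n)) / N n" for n y
  define F' where "F' n y = max 0 ((y - a) * N n) - max 0 ((y - a) * N n - 1)" for n y
  have F: "(F n has_real_derivative F' n y) (at y)" for n y
  proof -
    have "((\<lambda>y. ramp ((y - a) * N n)) has_real_derivative F' n y * N n) (at y)"
      unfolding F'_def by (rule DERIV_chain2[OF DERIV_ramp]) (auto intro!: derivative_eq_intros)
    from DERIV_cdivide[OF DERIV_diff[OF this DERIV_const], of "ramp (- a * N n)" "N n"]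
    show ?thesis
      using N[of n] unfolding F_def by simp
  qed
  have F'_cont: "continuous_on UNIV (F' n)" for n
    unfolding F'_def by (intro continuous_intros)
  have F'_le: "\<bar>F' n y\<bar> \<le> 1" for n y
    by (auto simp: F'_def max_def)
  have "F n 0 = 0" for n
    by (simp add: F_def)
  note chain = weak_chain_rule[OF F F'_cont F'_le this \<phi> b]
  have F_cont: "continuous_on UNIV (F n)" for n
    by (meson F DERIV_isCont continuous_at_imp_continuous_on)
  have [measurable]: "F n \<in> borel_measurable borel" "F' n \<in> borel_measurable borel" for n
    using F_cont F'_cont by (auto intro: borel_measurable_continuous_onI)
  have F_le: "\<bar>F n y\<bar> \<le> \<bar>y\<bar>" for n y
  proof -
    obtain \<xi> where "slope (F n) (F' n) 0 y = F' n \<xi>"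
      using slope_mean_value[OF F] by blast
    then have "\<bar>slope (F n) (F' n) 0 y\<bar> * \<bar>y\<bar> \<le> 1 * \<bar>y\<bar>"
      using F'_le by (intro mult_right_mono) auto
    then show ?thesis
      using slope_mult[of "F n" "F' n" 0 y] by (simp add: F_def abs_mult[symmetric])
  qed
  have ramp_lim: "(\<lambda>n. ramp (z * N n) / N n) \<longlonglongrightarrow> max 0 z" for z
  proof (rule tendsto_sandwich)
    have max_eq: "max 0 (z * N n) = max 0 z * N n" for n
      using N[of n] by (auto simp: max_def zero_le_mult_iff)
    show "\<forall>\<^sub>F n in sequentially. max 0 z - 1 / N n \<le> ramp (z * N n) / N n"
    proof (intro always_eventually allI)
      fix n
      have "(max 0 z * N n - 1) / N n \<le> ramp (z * N n) / N n"
        using ramp_bounds(1)[of "z * N n"] N[of n] by (intro divide_right_mono) (simp_all add: max_eq)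
      then show "max 0 z - 1 / N n \<le> ramp (z * N n) / N n"
        using N[of n] by (simp add: diff_divide_distrib)
    qed
    show "\<forall>\<^sub>F n in sequentially. ramp (z * N n) / N n \<le> max 0 z"
      using ramp_bounds(2)[of "z * N _"] N by (intro always_eventually allI) (simp add: max_eq divide_le_eq)
    have "(\<lambda>n. 1 / N n) \<longlonglongrightarrow> 0"
      by (intro tendsto_divide_0[OF tendsto_const] filterlim_at_top_imp_at_infinity N_lim)
    then show "(\<lambda>n. max 0 z - 1 / N n) \<longlonglongrightarrow> max 0 z"
      using tendsto_diff[OF tendsto_const, of _ 0 sequentially "max 0 z"] by fastforce
  qed simp
  have F_lim: "(\<lambda>n. F n y) \<longlonglongrightarrow> max 0 (y - a) - max 0 (- a)" for y
    unfolding F_def diff_divide_distrib by (intro tendsto_diff ramp_lim)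
  have F'_lim: "(\<lambda>n. F' n y) \<longlonglongrightarrow> indicator {a<..} y" for y
  proof (cases "y > a")
    case True
    have "filterlim (\<lambda>n. (y - a) * N n) at_top sequentially"
      using True by (intro filterlim_tendsto_pos_mult_at_top[OF tendsto_const _ N_lim]) simp
    then have "\<forall>\<^sub>F n in sequentially. (y - a) * N n \<ge> 1"
      by (simp add: filterlim_at_top)
    then have "\<forall>\<^sub>F n in sequentially. F' n y = indicator {a<..} y"
      by eventually_elim (use True in \<open>auto simp: F'_def max_def\<close>)
    then show ?thesis
      by (rule tendsto_eventually)
  next
    case False
    then have z: "(y - a) * N n \<le> 0" for n
      using N[of n] by (simp add: mult_le_0_iff)
    have "F' n y = 0" for n
    proof -
      have "(y - a) * N n - 1 \<le> 0"
        using z[of n] by linarith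
      then show ?thesis
        unfolding F'_def max_absorb1[OF z] by (simp add: max_absorb1)
    qed
    then show ?thesis
      using False by simp
  qed
  have ib: "integrable lborel (\<lambda>x. \<bar>u x\<bar> * B)" "integrable lborel (\<lambda>x. norm (g x) * B)"
    using u_integrable g_integrable by simp_all
  have "(\<lambda>n. \<integral>x. F n (u x) * frechet_derivative \<phi> (at x) b \<partial>lborel)
      \<longlonglongrightarrow> (\<integral>x. (max 0 (u x - a) - max 0 (- a)) * frechet_derivative \<phi> (at x) b \<partial>lborel)"
  proof (rule integral_dominated_convergence[OF _ _ ib(1)])
    show "AE x in lborel. norm (F n (u x) * frechet_derivative \<phi> (at x) b) \<le> \<bar>u x\<bar> * B" for n
      unfolding real_norm_def abs_mult by (intro AE_I2 mult_mono F_le B) simp_all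
  qed (auto intro!: tendsto_mult F_lim)
  moreover have "(\<lambda>n. - (\<integral>x. F' n (u x) * (g x \<bullet> b) * \<phi> x \<partial>lborel))
      \<longlonglongrightarrow> - (\<integral>x. indicator {a<..} (u x) * (g x \<bullet> b) * \<phi> x \<partial>lborel)"
  proof (rule tendsto_minus, rule integral_dominated_convergence[OF _ _ ib(2)])
    show "AE x in lborel. norm (F' n (u x) * (g x \<bullet> b) * \<phi> x) \<le> norm (g x) * B" for n
    proof (rule AE_I2)
      fix x
      have "\<bar>g x \<bullet> b\<bar> \<le> norm (g x)"
        using b by (rule Basis_le_norm)
      then have "\<bar>F' n (u x)\<bar> * \<bar>g x \<bullet> b\<bar> \<le> 1 * norm (g x)"
        by (intro mult_mono F'_le) simp_all
      then show "norm (F' n (u x) * (g x \<bullet> b) * \<phi> x) \<le> norm (g x) * B"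
        unfolding real_norm_def abs_mult by (intro mult_mono B) simp_all
    qed
  qed (auto intro!: tendsto_mult F'_lim)
  ultimately have "(\<integral>x. (max 0 (u x - a) - max 0 (- a)) * frechet_derivative \<phi> (at x) b \<partial>lborel)
      = - (\<integral>x. indicator {a<..} (u x) * (g x \<bullet> b) * \<phi> x \<partial>lborel)"
    unfolding chain by (rule LIMSEQ_unique)
  then show ?thesis
    by (simp add: indicator_def)
qed

lemma weak_gradient_truncation:
  assumes \<phi>: "\<phi> \<in> C1_compact_support \<Omega>" and b: "b \<in> Basis" and "a \<le> c"
  shows "(\<integral>x. (max 0 (u x - a) - max 0 (u x - c)) * frechet_derivative \<phi> (at x) b \<partial>lborel)
    = - (\<integral>x. indicator {x. a < u x \<and> u x \<le> c} x * (g x \<bullet> b) * \<phi> x \<partial>lborel)"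
proof -
  note [measurable] = C1_compact_support_measurable[OF \<phi>]
  let ?d = "\<lambda>x. frechet_derivative \<phi> (at x) b"
  obtain B where B: "0 \<le> B" "\<And>x. \<bar>\<phi> x\<bar> \<le> B" "\<And>x. \<bar>?d x\<bar> \<le> B"
    using C1_compact_support_bounded[OF \<phi>] by metis
  have iT: "integrable lborel (\<lambda>x. (max 0 (u x - r) - max 0 (- r)) * ?d x)" for r
  proof (rule integrable_mult_bounded[OF _ _ B(3)])
    show "integrable lborel (\<lambda>x. max 0 (u x - r) - max 0 (- r))"
      by (rule Bochner_Integration.integrable_bound[OF u_integrable]) (auto simp: max_def)
  qed simp
  have ig: "integrable lborel (\<lambda>x. indicator {x. r < u x} x * (g x \<bullet> b) * \<phi> x)" for r
  proof (rule integrable_mult_bounded[OF _ _ B(2)])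
    show "integrable lborel (\<lambda>x. indicator {x. r < u x} x * (g x \<bullet> b))"
      using integrable_mult_bounded[OF g_component_integrable[of b], of "indicator {x. r < u x}" 1]
      by (simp add: mult.commute)
  qed simp
  define \<kappa> where "\<kappa> = max 0 (- a) - max 0 (- c)"
  have i\<kappa>: "integrable lborel (\<lambda>x. \<kappa> * ?d x)" "(\<integral>x. \<kappa> * ?d x \<partial>lborel) = 0"
    using integral_derivative_test_function[OF \<phi>, of b] by simp_all
  have "(\<integral>x. (max 0 (u x - a) - max 0 (u x - c)) * ?d x \<partial>lborel)
      = (\<integral>x. ((max 0 (u x - a) - max 0 (- a)) * ?d x - (max 0 (u x - c) - max 0 (- c)) * ?d x) + \<kappa> * ?d x \<partial>lborel)"
    by (intro Bochner_Integration.integral_cong) (auto simp: \<kappa>_def algebra_simps)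
  also have "\<dots> = (\<integral>x. (max 0 (u x - a) - max 0 (- a)) * ?d x \<partial>lborel)
      - (\<integral>x. (max 0 (u x - c) - max 0 (- c)) * ?d x \<partial>lborel)"
    using iT i\<kappa> by simp
  also have "\<dots> = - ((\<integral>x. indicator {x. a < u x} x * (g x \<bullet> b) * \<phi> x \<partial>lborel)
      - (\<integral>x. indicator {x. c < u x} x * (g x \<bullet> b) * \<phi> x \<partial>lborel))"
    by (simp add: weak_gradient_pos_part[OF \<phi> b])
  also have "\<dots> = - (\<integral>x. indicator {x. a < u x} x * (g x \<bullet> b) * \<phi> x
      - indicator {x. c < u x} x * (g x \<bullet> b) * \<phi> x \<partial>lborel)"
    using ig by (subst Bochner_Integration.integral_diff) auto
  also have "\<dots> = - (\<integral>x. indicator {x. a < u x \<and> u x \<le> c} x * (g x \<bullet> b) * \<phi> x \<partial>lborel)"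
    using \<open>a \<le> c\<close> by (intro arg_cong[where f = uminus] Bochner_Integration.integral_cong)
      (auto simp: indicator_def)
  finally show ?thesis .
qed

end

section \<open>Perimeters of superlevel sets\<close>

text \<open>Split off the part of \<open>f\<close> above a large level, whose integral is small; below that level the integral
  over \<open>S\<close> is at most the level times the measure of \<open>S\<close>.\<close>

lemma integral_absolutely_continuous:
  fixes f :: "'a \<Rightarrow> real"
  assumes f: "integrable M f" and pos: "\<And>x. 0 \<le> f x" and "e > 0"
  obtains \<delta> where "\<delta> > 0"
    "\<And>S. S \<in> sets M \<Longrightarrow> emeasure M S < ennreal \<delta> \<Longrightarrow> (\<integral>x. indicator S x * f x \<partial>M) < e"
proof -
  have [measurable]: "f \<in> borel_measurable M"
    using f by auto
  have iN: "integrable M (\<lambda>x. max 0 (f x - real N))" for N :: nat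
    by (rule Bochner_Integration.integrable_bound[OF f]) (use pos in auto)
  have "(\<lambda>N. \<integral>x. max 0 (f x - real N) \<partial>M) \<longlonglongrightarrow> (\<integral>x. 0 \<partial>M)"
  proof (rule integral_dominated_convergence[OF _ _ f])
    show "AE x in M. (\<lambda>N. max 0 (f x - real N)) \<longlonglongrightarrow> 0"
    proof (rule AE_I2)
      fix x
      have "\<forall>\<^sub>F N in sequentially. f x \<le> real N"
        using eventually_ge_at_top[of "nat \<lceil>f x\<rceil>"] by eventually_elim linarith
      then have "\<forall>\<^sub>F N in sequentially. max 0 (f x - real N) = 0"
        by eventually_elim auto
      then show "(\<lambda>N. max 0 (f x - real N)) \<longlonglongrightarrow> 0"
        by (rule tendsto_eventually)
    qed
    show "AE x in M. norm (max 0 (f x - real N)) \<le> f x" for N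
      using pos by (intro AE_I2) auto
  qed auto
  then have "\<forall>\<^sub>F N in sequentially. (\<integral>x. max 0 (f x - real N) \<partial>M) < e / 2"
    using \<open>e > 0\<close> by (intro order_tendstoD) auto
  then obtain N where N: "(\<integral>x. max 0 (f x - real N) \<partial>M) < e / 2"
    by (meson eventually_happens trivial_limit_sequentially)
  show thesis
  proof (rule that[of "e / (2 * (real N + 1))"])
    show "e / (2 * (real N + 1)) > 0"
      using \<open>e > 0\<close> by simp
    fix S assume S: "S \<in> sets M" "emeasure M S < ennreal (e / (2 * (real N + 1)))"
    have fin: "emeasure M S < \<infinity>"
      using less_trans[OF S(2) ennreal_less_top] by simp
    have iS: "integrable M (indicator S :: 'a \<Rightarrow> real)"
      using S(1) fin by (simp add: integrable_indicator_iff)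
    have m: "measure M S < e / (2 * (real N + 1))"
      using S(2) fin \<open>e > 0\<close> by (simp add: emeasure_eq_ennreal_measure ennreal_less_iff less_top)
    have "(\<integral>x. indicator S x * f x \<partial>M) \<le> (\<integral>x. real N * indicator S x + max 0 (f x - real N) \<partial>M)"
    proof (rule integral_mono)
      show "integrable M (\<lambda>x. indicator S x * f x)"
        using integrable_real_mult_indicator[OF S(1) f] by (simp add: mult.commute)
      show "integrable M (\<lambda>x. real N * indicator S x + max 0 (f x - real N))"
        using iS iN by simp
    qed (use pos in \<open>auto simp: indicator_def\<close>)
    also have "\<dots> = real N * measure M S + (\<integral>x. max 0 (f x - real N) \<partial>M)"
      using iS iN S(1) by simp
    also have "real N * measure M S \<le> (real N + 1) * (e / (2 * (real N + 1)))"
      using m by (intro mult_mono) auto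
    also have "\<dots> = e / 2"
      by (simp add: field_simps)
    finally show "(\<integral>x. indicator S x * f x \<partial>M) < e"
      using N by linarith
  qed
qed

text \<open>Lower growth at rate \<open>k\<close> to the right of each point integrates to the whole interval: the largest \<open>c\<close> up
  to which the inequality holds can be enlarged as long as \<open>c < b\<close>.\<close>

lemma measure_ge_of_local_growth:
  fixes M :: "real measure"
  assumes "finite_measure M" and M: "sets M = sets borel" and "a \<le> b" and "k \<ge> 0"
    and growth: "\<And>t. a \<le> t \<Longrightarrow> t < b \<Longrightarrow> \<forall>\<^sub>F h in at_right 0. k * h \<le> measure M {t<..t + h}"
  shows "k * (b - a) \<le> measure M {a<..<b}"
proof (cases "k = 0 \<or> a = b")
  case False
  then have k: "k > 0" and ab: "a < b"
    using assms by auto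
  interpret finite_measure M by fact
  define S where "S = {t\<in>{a..b}. k * (t - a) \<le> measure M {a<..<t}}"
  define c where "c = Sup S"
  have "a \<in> S" and S_le: "\<And>t. t \<in> S \<Longrightarrow> t \<le> b"
    using \<open>a \<le> b\<close> by (auto simp: S_def)
  then have bdd: "bdd_above S" and ne: "S \<noteq> {}"
    by (auto simp: bdd_above_def)
  have c: "a \<le> c" "c \<le> b"
    unfolding c_def using \<open>a \<in> S\<close> S_le by (auto intro: cSup_upper bdd cSup_least)
  have "c \<le> a + measure M {a<..<c} / k"
    unfolding c_def
  proof (rule cSup_least[OF ne])
    fix t assume t: "t \<in> S"
    then have "t \<le> Sup S"
      by (rule cSup_upper[OF _ bdd])
    then have "measure M {a<..<t} \<le> measure M {a<..<Sup S}"
      by (intro finite_measure_mono) (auto simp: M)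
    then have "k * (t - a) \<le> measure M {a<..<Sup S}"
      using t by (auto simp: S_def)
    then show "t \<le> a + measure M {a<..<Sup S} / k"
      using k by (simp add: field_simps)
  qed
  then have cS: "k * (c - a) \<le> measure M {a<..<c}"
    using k by (simp add: field_simps)
  have "c = b"
  proof (rule ccontr)
    assume "c \<noteq> b"
    then have "c < b"
      using c by simp
    obtain \<delta> where \<delta>: "\<delta> > 0" "\<And>h. 0 < h \<Longrightarrow> h < \<delta> \<Longrightarrow> k * h \<le> measure M {c<..c + h}"
      using growth[OF c(1) \<open>c < b\<close>] unfolding eventually_at_right_field by auto
    define c' where "c' = min b (c + \<delta>)"
    have c': "c < c'" "c' \<le> b" "c' \<le> c + \<delta>"
      using \<open>c < b\<close> \<delta>(1) by (auto simp: c'_def)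
    have "c' - c \<le> (measure M {a<..<c'} - k * (c - a)) / k"
    proof (rule dense_le_bounded[of 0])
      show "0 < c' - c" using c' by simp
      fix h assume h: "0 < h" "h < c' - c"
      have "k * (c - a) + k * h \<le> measure M {a<..<c} + measure M {c<..c + h}"
        using cS \<delta>(2)[of h] h c' by (intro add_mono) auto
      also have "\<dots> = measure M ({a<..<c} \<union> {c<..c + h})"
        by (rule finite_measure_Union[symmetric]) (auto simp: M)
      also have "\<dots> \<le> measure M {a<..<c'}"
        using c c' h by (intro finite_measure_mono) (auto simp: M)
      finally show "h \<le> (measure M {a<..<c'} - k * (c - a)) / k"
        using k by (simp add: field_simps)
    qed
    then have "k * (c' - a) \<le> measure M {a<..<c'}"
      using k by (simp add: field_simps)
    then have "c' \<in> S"
      using c c' by (simp add: S_def)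
    then have "c' \<le> c"
      unfolding c_def by (rule cSup_upper[OF _ bdd])
    then show False
      using c' by simp
  qed
  then show ?thesis
    using cS by simp
qed auto

context integrable_weak_gradient
begin

definition grad_measure :: "'a measure" where
  "grad_measure = density lborel (\<lambda>x. ennreal (norm (g x)))"

lemma sets_grad_measure [simp, measurable_cong]: "sets grad_measure = sets borel"
  by (simp add: grad_measure_def)

lemma space_grad_measure [simp]: "space grad_measure = UNIV"
  by (simp add: grad_measure_def)

lemma emeasure_grad_measure:
  assumes [measurable]: "S \<in> sets borel"
  shows "emeasure grad_measure S = ennreal (\<integral>x. indicator S x * norm (g x) \<partial>lborel)"
proof -
  have "integrable lborel (\<lambda>x. indicator S x * norm (g x))"
    using integrable_real_mult_indicator[of S lborel "\<lambda>x. norm (g x)"] g_integrable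
    by (simp add: mult.commute)
  then have "(\<integral>\<^sup>+ x. ennreal (indicator S x * norm (g x)) \<partial>lborel)
      = ennreal (\<integral>x. indicator S x * norm (g x) \<partial>lborel)"
    by (rule nn_integral_eq_integral) simp
  moreover have "emeasure grad_measure S = (\<integral>\<^sup>+ x. ennreal (indicator S x * norm (g x)) \<partial>lborel)"
    unfolding grad_measure_def
    by (subst emeasure_density) (auto intro!: nn_integral_cong simp: indicator_def)
  ultimately show ?thesis by simp
qed

lemma measure_grad_measure:
  assumes "S \<in> sets borel"
  shows "measure grad_measure S = (\<integral>x. indicator S x * norm (g x) \<partial>lborel)"
  unfolding measure_def emeasure_grad_measure[OF assms] by (simp add: integral_nonneg_AE)

lemma finite_grad_measure: "finite_measure grad_measure"
  by (rule finite_measureI) (simp add: emeasure_grad_measure)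

text \<open>Choose a field \<open>\<phi>\<close> that witnesses \<open>k < P({u > t})\<close>. The truncations of \<open>u\<close> between \<open>t\<close> and \<open>t + h\<close>,
  divided by \<open>h\<close>, converge to the indicator of \<open>{u > t}\<close>, so for small \<open>h\<close> their integral against
  \<open>div \<phi>\<close> still exceeds \<open>k\<close>; integrated by parts it is at most the mass of \<open>|Du|\<close> between the two
  levels, divided by \<open>h\<close>.\<close>

lemma perimeter_less_imp_growth:
  assumes k: "ereal k < perimeter \<Omega> {x \<in> \<Omega>. t < u x}"
  shows "\<forall>\<^sub>F h in at_right 0. k * h \<le> measure grad_measure {x. t < u x \<and> u x \<le> t + h}"
proof -
  let ?E = "{x \<in> \<Omega>. t < u x}"
  have [measurable]: "\<Omega> \<in> sets borel"
    using open_\<Omega> by simp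
  obtain \<phi> :: "'a \<Rightarrow> 'a" where \<phi>: "\<phi> \<in> C1_compact_support \<Omega>" "\<And>x. norm (\<phi> x) \<le> 1"
      and k\<phi>: "k < (LINT x|lebesgue_on ?E. divergence \<phi> x)"
    using k unfolding perimeter_def less_SUP_iff by auto
  define \<phi>' where "\<phi>' b x = \<phi> x \<bullet> b" for b x
  define K where "K = closure {x. \<phi> x \<noteq> 0}"
  note K = C1_compact_support_support[OF \<phi>(1), folded K_def]
  have der: "(\<phi>' b has_derivative (\<lambda>v. frechet_derivative \<phi> (at x) v \<bullet> b)) (at x)" for b x
    unfolding \<phi>'_def[abs_def]
    by (rule has_derivative_inner_left[OF C1_compact_support_derivative(1)[OF \<phi>(1)]])
  have \<phi>': "\<phi>' b \<in> C1_compact_support \<Omega>" for b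
    by (rule C1_compact_supportI[OF der _ K(1) _ K(2)])
       (auto intro!: continuous_intros C1_compact_support_derivative(2)[OF \<phi>(1)] simp: K(3) \<phi>'_def)
  have fd: "frechet_derivative (\<phi>' b) (at x) v = frechet_derivative \<phi> (at x) v \<bullet> b" for b x v
    by (simp add: has_derivative_frechet_eq[OF der])
  have div: "divergence \<phi> x = (\<Sum>b\<in>Basis. frechet_derivative (\<phi>' b) (at x) b)" for x
    by (simp add: divergence_def fd)
  note [measurable] = C1_compact_support_measurable[OF \<phi>']
  have div_meas [measurable]: "divergence \<phi> \<in> borel_measurable borel"
    unfolding div[abs_def] by measurable
  have idiv: "integrable lborel (divergence \<phi>)"
    unfolding div[abs_def] by (intro Bochner_Integration.integrable_sum integral_derivative_test_function[OF \<phi>'])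
  have \<phi>_meas [measurable]: "\<phi> \<in> borel_measurable borel"
    using C1_compact_support_derivative(3)[OF \<phi>(1)] by (rule borel_measurable_continuous_onI)
  have div0: "divergence \<phi> x = 0" if "x \<notin> \<Omega>" for x
  proof -
    have "x \<notin> K"
      using K(2) that by blast
    then show ?thesis
      by (simp add: divergence_def K(4))
  qed
  have E_int: "(LINT x|lebesgue_on ?E. divergence \<phi> x) = (\<integral>x. indicator {x. t < u x} x * divergence \<phi> x \<partial>lborel)"
  proof -
    have "(LINT x|lebesgue_on ?E. divergence \<phi> x) = (\<integral>x. indicator ?E x *\<^sub>R divergence \<phi> x \<partial>lebesgue)"
      by (rule integral_restrict_space) (auto intro!: sets_completionI_sets)
    also have "\<dots> = (\<integral>x. indicator ?E x *\<^sub>R divergence \<phi> x \<partial>lborel)"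
      by (rule integral_completion) simp
    also have "\<dots> = (\<integral>x. indicator {x. t < u x} x * divergence \<phi> x \<partial>lborel)"
      using div0 by (intro Bochner_Integration.integral_cong) (auto simp: indicator_def)
    finally show ?thesis .
  qed
  have parts: "(\<integral>x. (max 0 (u x - t) - max 0 (u x - (t + h))) * divergence \<phi> x \<partial>lborel)
      \<le> measure grad_measure {x. t < u x \<and> u x \<le> t + h}" if "h > 0" for h
  proof -
    let ?I = "\<lambda>x. indicator {x. t < u x \<and> u x \<le> t + h} x :: real"
    have iT: "integrable lborel (\<lambda>x. (max 0 (u x - t) - max 0 (u x - (t + h))) * frechet_derivative (\<phi>' b) (at x) b)" for b
    proof -
      have "\<bar>max 0 (u x - t) - max 0 (u x - (t + h))\<bar> \<le> h" for x
        using that by (auto simp: max_def)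
      then have "integrable lborel (\<lambda>x. frechet_derivative (\<phi>' b) (at x) b * (max 0 (u x - t) - max 0 (u x - (t + h))))"
        by (intro integrable_mult_bounded[OF integral_derivative_test_function(2)[OF \<phi>']]) simp_all
      then show ?thesis
        by (simp add: mult.commute)
    qed
    have ig: "integrable lborel (\<lambda>x. ?I x * (g x \<bullet> b) * \<phi>' b x)" if "b \<in> Basis" for b
    proof (rule integrable_mult_bounded)
      show "integrable lborel (\<lambda>x. ?I x * (g x \<bullet> b))"
        using integrable_mult_bounded[OF g_component_integrable[of b], of ?I 1]
        by (simp add: mult.commute)
      show "\<bar>\<phi>' b x\<bar> \<le> 1" for x
        using \<phi>(2)[of x] Basis_le_norm[OF that, of "\<phi> x"] by (simp add: \<phi>'_def)
    qed simp
    have "(\<integral>x. (max 0 (u x - t) - max 0 (u x - (t + h))) * divergence \<phi> x \<partial>lborel)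
        = (\<Sum>b\<in>Basis. - (\<integral>x. ?I x * (g x \<bullet> b) * \<phi>' b x \<partial>lborel))"
      unfolding div sum_distrib_left using iT that
      by (subst Bochner_Integration.integral_sum) (auto intro!: sum.cong weak_gradient_truncation[OF \<phi>'])
    also have "\<dots> = (\<integral>x. - (\<Sum>b\<in>Basis. ?I x * (g x \<bullet> b) * \<phi>' b x) \<partial>lborel)"
      using ig by (simp add: Bochner_Integration.integral_sum sum_negf)
    also have "\<dots> \<le> (\<integral>x. ?I x * norm (g x) \<partial>lborel)"
    proof (rule integral_mono)
      show "integrable lborel (\<lambda>x. - (\<Sum>b\<in>Basis. ?I x * (g x \<bullet> b) * \<phi>' b x))"
        using ig by (intro Bochner_Integration.integrable_minus Bochner_Integration.integrable_sum) auto
      show "integrable lborel (\<lambda>x. ?I x * norm (g x))"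
        using integrable_mult_bounded[OF integrable_norm[OF g_integrable], of ?I 1]
        by (simp add: mult.commute)
      fix x
      have "- (\<Sum>b\<in>Basis. ?I x * (g x \<bullet> b) * \<phi>' b x) = ?I x * (- (g x \<bullet> \<phi> x))"
        by (simp add: \<phi>'_def euclidean_inner[of "g x" "\<phi> x"] sum_distrib_left mult.assoc)
      also have "\<dots> \<le> ?I x * norm (g x)"
      proof (rule mult_left_mono)
        have "\<bar>g x \<bullet> \<phi> x\<bar> \<le> norm (g x) * norm (\<phi> x)"
          by (rule Cauchy_Schwarz_ineq2)
        also have "\<dots> \<le> norm (g x)"
          using \<phi>(2)[of x] by (simp add: mult_left_le)
        finally show "- (g x \<bullet> \<phi> x) \<le> norm (g x)"
          by linarith
      qed simp
      finally show "- (\<Sum>b\<in>Basis. ?I x * (g x \<bullet> b) * \<phi>' b x) \<le> ?I x * norm (g x)" .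
    qed
    finally show ?thesis
      by (simp add: measure_grad_measure)
  qed
  show ?thesis
  proof (rule sequentially_imp_eventually_at_right[of 0 1])
    fix h :: "nat \<Rightarrow> real"
    assume h: "\<And>n. 0 < h n" "h \<longlonglongrightarrow> 0"
    have "(\<lambda>n. \<integral>x. (max 0 (u x - t) - max 0 (u x - (t + h n))) / h n * divergence \<phi> x \<partial>lborel)
        \<longlonglongrightarrow> (\<integral>x. indicator {x. t < u x} x * divergence \<phi> x \<partial>lborel)"
    proof (rule integral_dominated_convergence)
      show "integrable lborel (\<lambda>x. \<bar>divergence \<phi> x\<bar>)"
        using idiv by simp
      show "AE x in lborel. norm ((max 0 (u x - t) - max 0 (u x - (t + h n))) / h n * divergence \<phi> x)
          \<le> \<bar>divergence \<phi> x\<bar>" for n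
      proof (rule AE_I2)
        fix x
        have "\<bar>(max 0 (u x - t) - max 0 (u x - (t + h n))) / h n\<bar> \<le> 1"
          using h(1)[of n] by (auto simp: max_def)
        from mult_right_mono[OF this, of "\<bar>divergence \<phi> x\<bar>"]
        show "norm ((max 0 (u x - t) - max 0 (u x - (t + h n))) / h n * divergence \<phi> x) \<le> \<bar>divergence \<phi> x\<bar>"
          by (simp add: abs_mult)
      qed
      show "AE x in lborel. (\<lambda>n. (max 0 (u x - t) - max 0 (u x - (t + h n))) / h n * divergence \<phi> x)
          \<longlonglongrightarrow> indicator {x. t < u x} x * divergence \<phi> x"
      proof (intro AE_I2 tendsto_mult tendsto_const)
        fix x
        show "(\<lambda>n. (max 0 (u x - t) - max 0 (u x - (t + h n))) / h n) \<longlonglongrightarrow> indicator {x. t < u x} x"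
        proof (cases "t < u x")
          case True
          then have "\<forall>\<^sub>F n in sequentially. h n < u x - t"
            using h(2) by (intro order_tendstoD) auto
          then have "\<forall>\<^sub>F n in sequentially. (max 0 (u x - t) - max 0 (u x - (t + h n))) / h n = indicator {x. t < u x} x"
          proof eventually_elim
            case (elim n)
            then show ?case
              using True h(1)[of n] by (simp add: max_def)
          qed
          then show ?thesis
            by (rule tendsto_eventually)
        next
          case False
          then have *: "(max 0 (u x - t) - max 0 (u x - (t + h n))) / h n = 0" for n
            using h(1)[of n] by (simp add: max_def)
          show ?thesis
            unfolding * using False by simp
        qed
      qed
    qed simp_all
    then have "\<forall>\<^sub>F n in sequentially. k < (\<integral>x. (max 0 (u x - t) - max 0 (u x - (t + h n))) / h n * divergence \<phi> x \<partial>lborel)"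
      using k\<phi> unfolding E_int by (rule order_tendstoD)
    then show "\<forall>\<^sub>F n in sequentially. k * h n \<le> measure grad_measure {x. t < u x \<and> u x \<le> t + h n}"
    proof eventually_elim
      case (elim n)
      have "k * h n \<le> (\<integral>x. (max 0 (u x - t) - max 0 (u x - (t + h n))) / h n * divergence \<phi> x \<partial>lborel) * h n"
        using elim h(1)[of n] by (intro mult_right_mono) auto
      also have "\<dots> = (\<integral>x. (max 0 (u x - t) - max 0 (u x - (t + h n))) * divergence \<phi> x \<partial>lborel)"
        using h(1)[of n] by simp
      also have "\<dots> \<le> measure grad_measure {x. t < u x \<and> u x \<le> t + h n}"
        by (rule parts[OF h(1)])
      finally show ?case .
    qed
  qed simp
qed

end

section \<open>The decreasing rearrangement and its absolute continuity\<close>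

lemma abs_continuous_imp_small_interval:
  assumes "abs_continuous_on_interval f c d" "e > 0"
  obtains \<delta> where "\<delta> > 0" "\<And>x y. c \<le> x \<Longrightarrow> x \<le> y \<Longrightarrow> y \<le> d \<Longrightarrow> y - x < \<delta> \<Longrightarrow> \<bar>f y - f x\<bar> < e"
proof -
  obtain \<delta> where \<delta>: "\<delta> > 0" "\<And>(n::nat) x y. (\<forall>i<n. c \<le> x i \<and> x i \<le> y i \<and> y i \<le> d) \<Longrightarrow>
        disjoint_family_on (\<lambda>i. {x i<..<y i}) {..<n} \<Longrightarrow>
        (\<Sum>i<n. y i - x i) < \<delta> \<Longrightarrow> (\<Sum>i<n. \<bar>f (y i) - f (x i)\<bar>) < e"
    using assms unfolding abs_continuous_on_interval_def by meson
  show thesis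
  proof (rule that[OF \<delta>(1)])
    fix x y assume "c \<le> x" "x \<le> y" "y \<le> d" "y - x < \<delta>"
    then show "\<bar>f y - f x\<bar> < e"
      using \<delta>(2)[of 1 "\<lambda>_. x" "\<lambda>_. y"] by (simp add: disjoint_family_on_def)
  qed
qed

text \<open>The part of the theory of rearrangements that concerns only the distribution of \<open>u\<close>.\<close>

locale rearranged_function =
  fixes \<Omega> :: "'a::euclidean_space set" and u :: "'a \<Rightarrow> real"
  assumes \<Omega>_borel [measurable]: "\<Omega> \<in> sets borel" and \<Omega>_finite: "emeasure lborel \<Omega> < \<infinity>"
    and u_borel [measurable]: "u \<in> borel_measurable borel"
begin

definition V :: real where "V = measure lborel \<Omega>"

text \<open>The distribution of \<open>u\<close> on \<open>\<Omega>\<close>, so that \<open>\<mu> t\<close> is the mass of \<open>(t, \<infinity>)\<close> and monotone limits of level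
  sets are continuity properties of a finite measure.\<close>

definition value_measure :: "real measure" where
  "value_measure = distr (restrict_space lborel \<Omega>) borel u"

lemma emeasure_value_measure:
  assumes [measurable]: "B \<in> sets borel"
  shows "emeasure value_measure B = emeasure lborel {x \<in> \<Omega>. u x \<in> B}"
proof -
  have "u \<in> borel_measurable (restrict_space lborel \<Omega>)"
    by (rule measurable_restrict_space1) simp
  then have "emeasure value_measure B = emeasure (restrict_space lborel \<Omega>) (u -` B \<inter> space (restrict_space lborel \<Omega>))"
    unfolding value_measure_def by (rule emeasure_distr) simp
  also have "\<dots> = emeasure lborel (u -` B \<inter> space (restrict_space lborel \<Omega>))"
    by (rule emeasure_restrict_space) (auto simp: space_restrict_space)
  also have "u -` B \<inter> space (restrict_space lborel \<Omega>) = {x \<in> \<Omega>. u x \<in> B}"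
    by (auto simp: space_restrict_space)
  finally show ?thesis .
qed

lemma measure_value_measure: "B \<in> sets borel \<Longrightarrow> measure value_measure B = measure lborel {x \<in> \<Omega>. u x \<in> B}"
  by (simp add: measure_def emeasure_value_measure)

lemma sets_value_measure [simp, measurable_cong]: "sets value_measure = sets borel"
  by (simp add: value_measure_def)

lemma space_value_measure [simp]: "space value_measure = UNIV"
  by (simp add: value_measure_def)

lemma finite_value_measure: "finite_measure value_measure"
  by (rule finite_measureI) (use \<Omega>_finite in \<open>simp add: emeasure_value_measure less_top\<close>)

sublocale value_measure: finite_measure value_measure
  by (rule finite_value_measure)

abbreviation \<mu> :: "real \<Rightarrow> real" where
  "\<mu> \<equiv> distribution_function \<Omega> u"

lemma \<mu>_eq_lborel: "\<mu> t = measure lborel {x \<in> \<Omega>. t < u x}"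
  unfolding distribution_function_def by (rule measure_completion) simp

lemma \<mu>_eq: "\<mu> t = measure value_measure {t<..}"
  by (simp add: \<mu>_eq_lborel measure_value_measure)

lemma measure_values_UNIV: "measure value_measure UNIV = V"
  by (simp add: measure_value_measure V_def)

lemma \<mu>_antimono: "s \<le> t \<Longrightarrow> \<mu> t \<le> \<mu> s"
  unfolding \<mu>_eq by (intro value_measure.finite_measure_mono) auto

lemma \<mu>_borel [measurable]: "\<mu> \<in> borel_measurable borel"
proof -
  have "mono (\<lambda>t. - \<mu> t)"
    using \<mu>_antimono by (intro monoI) simp
  then have "(\<lambda>t. - (- \<mu> t)) \<in> borel_measurable borel"
    by (intro borel_measurable_uminus borel_measurable_mono)
  then show ?thesis by simp
qed

lemma \<mu>_at_top: "(\<lambda>n. \<mu> (real n)) \<longlonglongrightarrow> 0"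
proof -
  have "(\<lambda>n. measure value_measure {real n<..}) \<longlonglongrightarrow> measure value_measure (\<Inter>n. {real n<..})"
    by (intro value_measure.finite_Lim_measure_decseq) (auto simp: decseq_def)
  moreover have "(\<Inter>n. {real n<..}) = {}"
  proof -
    have "\<exists>n. x \<le> real n" for x
      using real_arch_simple by blast
    then have "\<exists>n. \<not> real n < x" for x
      by (simp add: not_less)
    then show ?thesis by auto
  qed
  ultimately show ?thesis
    by (simp add: \<mu>_eq)
qed

lemma \<mu>_at_bot: "(\<lambda>n. \<mu> (- real n)) \<longlonglongrightarrow> V"
proof -
  have "(\<lambda>n. measure value_measure {- real n<..}) \<longlonglongrightarrow> measure value_measure (\<Union>n. {- real n<..})"
    by (intro value_measure.finite_Lim_measure_incseq) (auto simp: incseq_def)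
  moreover have "(\<Union>n. {- real n<..}) = UNIV"
  proof -
    have "\<exists>n. - x < real n" for x
      using reals_Archimedean2 by blast
    then have "\<exists>n. - real n < x" for x
      by (simp add: minus_less_iff)
    then show ?thesis by auto
  qed
  ultimately show ?thesis
    by (simp add: \<mu>_eq measure_values_UNIV)
qed

lemma \<mu>_right_continuous: "(\<lambda>n. \<mu> (t + inverse (real (Suc n)))) \<longlonglongrightarrow> \<mu> t"
proof -
  have "(\<lambda>n. measure value_measure {t + inverse (real (Suc n))<..}) \<longlonglongrightarrow> measure value_measure (\<Union>n. {t + inverse (real (Suc n))<..})"
  proof (intro value_measure.finite_Lim_measure_incseq)
    have "inverse (real (Suc n)) \<le> inverse (real (Suc m))" if "m \<le> n" for m n
      using that by (intro le_imp_inverse_le) auto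
    then show "incseq (\<lambda>n. {t + inverse (real (Suc n))<..})"
      by (fastforce simp: incseq_def)
  qed auto
  moreover have "(\<Union>n. {t + inverse (real (Suc n))<..}) = {t<..}"
  proof (intro equalityI subsetI)
    fix x assume "x \<in> {t<..}"
    then obtain n where "inverse (real (Suc n)) < x - t"
      using reals_Archimedean[of "x - t"] by auto
    then show "x \<in> (\<Union>n. {t + inverse (real (Suc n))<..})"
      by (intro UN_I[of n]) auto
  next
    fix x assume "x \<in> (\<Union>n. {t + inverse (real (Suc n))<..})"
    then obtain n where "t + inverse (real (Suc n)) < x" by auto
    moreover have "inverse (real (Suc n)) > 0" by simp
    ultimately show "x \<in> {t<..}"
      unfolding greaterThan_iff by linarith
  qed
  ultimately show ?thesis
    by (simp add: \<mu>_eq)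
qed

definition r :: "real \<Rightarrow> real" where
  "r s = real_of_ereal (decreasing_rearrangement \<Omega> u s)"

text \<open>For \<open>0 < s < V\<close> the set of heights \<open>t\<close> with \<open>\<mu> t \<le> s\<close> is nonempty and bounded below by the limits of
  \<open>\<mu>\<close> at \<open>\<plusminus>\<infinity>\<close>, and it contains its infimum because \<open>\<mu>\<close> is continuous from the right. This Galois
  connection carries all later computations with \<open>r\<close>.\<close>

lemma \<mu>_le_iff:
  assumes "0 < s" "s < V"
  shows "\<mu> t \<le> s \<longleftrightarrow> r s \<le> t"
proof -
  define S where "S = {t. \<mu> t \<le> s}"
  have "\<forall>\<^sub>F n in sequentially. \<mu> (real n) < s"
    using \<mu>_at_top assms by (intro order_tendstoD) auto
  then obtain n where "\<mu> (real n) < s"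
    by (meson eventually_happens trivial_limit_sequentially)
  then have ne: "S \<noteq> {}"
    by (auto simp: S_def intro!: exI[of _ "real n"])
  have "\<forall>\<^sub>F n in sequentially. s < \<mu> (- real n)"
    using \<mu>_at_bot assms by (intro order_tendstoD) auto
  then obtain m where m: "s < \<mu> (- real m)"
    by (meson eventually_happens trivial_limit_sequentially)
  have lower: "- real m \<le> t" if "t \<in> S" for t
  proof (rule ccontr)
    assume "\<not> - real m \<le> t"
    then have "\<mu> (- real m) \<le> \<mu> t"
      by (intro \<mu>_antimono) simp
    then show False
      using m that by (simp add: S_def)
  qed
  then have bdd: "bdd_below S"
    by (auto simp: bdd_below_def)
  have "decreasing_rearrangement \<Omega> u s = Inf (ereal ` S)"
    unfolding decreasing_rearrangement_def S_def by (simp add: image_def setcompr_eq_image)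
  also have "\<dots> = ereal (Inf S)"
    by (rule ereal_Inf'[OF bdd ne, symmetric])
  finally have eq: "decreasing_rearrangement \<Omega> u s = ereal (Inf S)" .
  then have r: "r s = Inf S"
    by (simp add: r_def)
  show "\<mu> t \<le> s \<longleftrightarrow> r s \<le> t"
  proof
    assume "\<mu> t \<le> s"
    then show "r s \<le> t"
      unfolding r by (intro cInf_lower bdd) (simp add: S_def)
  next
    assume "r s \<le> t"
    have "\<mu> (t + inverse (real (Suc n))) \<le> s" for n
    proof -
      have "Inf S < t + inverse (real (Suc n))"
      proof -
        have "0 < inverse (real (Suc n))" by simp
        then show ?thesis
          using \<open>r s \<le> t\<close> unfolding r by linarith
      qed
      then obtain z where "z \<in> S" "z < t + inverse (real (Suc n))"
        using cInf_lessD[OF ne] by blast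
      then show ?thesis
        using \<mu>_antimono[of z "t + inverse (real (Suc n))"] by (simp add: S_def)
    qed
    then show "\<mu> t \<le> s"
      by (intro LIMSEQ_le_const2[OF \<mu>_right_continuous]) blast
  qed
qed

lemma less_\<mu>_iff: "0 < s \<Longrightarrow> s < V \<Longrightarrow> s < \<mu> t \<longleftrightarrow> t < r s"
  using \<mu>_le_iff[of s t] by linarith

lemma r_antimono:
  assumes "0 < s" "s \<le> s'" "s' < V"
  shows "r s' \<le> r s"
proof -
  have "\<mu> (r s) \<le> s"
    using assms by (simp add: \<mu>_le_iff)
  then have "\<mu> (r s) \<le> s'"
    using assms by simp
  then show ?thesis
    using assms by (simp add: \<mu>_le_iff)
qed

lemma measure_ge_level:
  assumes "0 < s" "s < V"
  shows "s \<le> measure value_measure {r s..}"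
proof -
  have "(\<lambda>n. measure value_measure {r s - inverse (real (Suc n))<..}) \<longlonglongrightarrow> measure value_measure (\<Inter>n. {r s - inverse (real (Suc n))<..})"
  proof (intro value_measure.finite_Lim_measure_decseq)
    have "inverse (real (Suc n)) \<le> inverse (real (Suc m))" if "m \<le> n" for m n
      using that by (intro le_imp_inverse_le) auto
    then show "decseq (\<lambda>n. {r s - inverse (real (Suc n))<..})"
      by (fastforce simp: decseq_def)
  qed auto
  moreover have "(\<Inter>n. {r s - inverse (real (Suc n))<..}) = {r s..}"
  proof (intro equalityI subsetI)
    fix x assume x: "x \<in> (\<Inter>n. {r s - inverse (real (Suc n))<..})"
    show "x \<in> {r s..}"
    proof (rule ccontr)
      assume "x \<notin> {r s..}"
      then obtain n where "inverse (real (Suc n)) < r s - x"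
        using reals_Archimedean[of "r s - x"] by auto
      moreover have "r s - inverse (real (Suc n)) < x"
        using x by blast
      ultimately show False by linarith
    qed
  next
    fix x assume "x \<in> {r s..}"
    moreover have "inverse (real (Suc n)) > 0" for n by simp
    ultimately show "x \<in> (\<Inter>n. {r s - inverse (real (Suc n))<..})"
      by (smt (verit) INT_I atLeast_iff greaterThan_iff)
  qed
  ultimately have lim: "(\<lambda>n. \<mu> (r s - inverse (real (Suc n)))) \<longlonglongrightarrow> measure value_measure {r s..}"
    by (simp add: \<mu>_eq)
  have "s \<le> \<mu> (r s - inverse (real (Suc n)))" for n
    using assms less_\<mu>_iff[of s "r s - inverse (real (Suc n))"] by simp
  then show ?thesis
    by (intro LIMSEQ_le_const[OF lim]) blast
qed

text \<open>The set \<open>{u > r s'}\<close> has measure at most \<open>s'\<close> and contains \<open>{u \<ge> r s}\<close>, which has measure at least \<open>s\<close>.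
  Only the open slab between the two levels can be estimated like this: the level sets themselves may
  have positive measure.\<close>

lemma measure_between_levels_le:
  assumes "0 < s" "s \<le> s'" "s' < V"
  shows "measure value_measure {r s'<..<r s} \<le> s' - s"
proof (cases "r s' < r s")
  case True
  have "s + measure value_measure {r s'<..<r s} \<le> measure value_measure {r s..} + measure value_measure {r s'<..<r s}"
    using measure_ge_level[of s] assms by simp
  also have "\<dots> = measure value_measure ({r s..} \<union> {r s'<..<r s})"
    by (rule value_measure.finite_measure_Union[symmetric]) auto
  also have "\<dots> \<le> measure value_measure {r s'<..}"
    using True by (intro value_measure.finite_measure_mono) auto
  also have "\<dots> \<le> s'"
    using \<mu>_le_iff[of s' "r s'"] assms by (simp add: \<mu>_eq)
  finally show ?thesis by simp
qed (use assms in auto)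

text \<open>The Stieltjes measure of \<open>- r\<close> on \<open>(0, V)\<close>, obtained as the image of Lebesgue measure on the heights
  under \<open>\<mu>\<close>.\<close>

definition level_measure :: "real measure" where
  "level_measure = distr lborel borel \<mu>"

lemma sets_level_measure [simp, measurable_cong]: "sets level_measure = sets borel"
  by (simp add: level_measure_def)

lemma emeasure_level_measure_Ioc:
  assumes "0 < s" "s \<le> s'" "s' < V"
  shows "emeasure level_measure {s<..s'} = ennreal (r s - r s')"
proof -
  have "\<mu> -` {s<..s'} = {r s'..<r s}"
    using less_\<mu>_iff[of s] \<mu>_le_iff[of s'] assms by auto
  then show ?thesis
    using r_antimono[OF assms] by (simp add: level_measure_def emeasure_distr)
qed

end

text \<open>The exponent is a parameter here; it becomes \<open>1 - 1/n\<close> when radial functions come in.\<close>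

locale isoperimetric_function = integrable_weak_gradient \<Omega> u g + rearranged_function \<Omega> u
  for \<Omega> :: "'a::euclidean_space set" and u g +
  fixes p Q :: real
  assumes Q: "Q > 0" and p: "p \<ge> 0" and g_zero: "\<And>x. x \<notin> \<Omega> \<Longrightarrow> g x = 0"
    and isoperimetric: "\<And>E. E \<in> sets lebesgue \<Longrightarrow> E \<subseteq> \<Omega> \<Longrightarrow>
      ereal Q * perimeter \<Omega> E \<ge> ereal (min (measure lebesgue E) (measure lebesgue (\<Omega> - E)) powr p)"
begin

text \<open>A lower bound of the isoperimetric profile \<open>min m (V - m)\<^sup>p\<close> that is valid for all \<open>m\<close> between \<open>s\<close> and
  \<open>s'\<close>.\<close>

definition profile :: "real \<Rightarrow> real \<Rightarrow> real" where
  "profile s s' = min s (V - s') powr p"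

sublocale grad: finite_measure grad_measure
  by (rule finite_grad_measure)

lemma perimeter_superlevel:
  assumes "0 < s" "s < \<mu> t" "\<mu> t \<le> s'" "s' < V"
  shows "ereal (profile s s') \<le> ereal Q * perimeter \<Omega> {x \<in> \<Omega>. t < u x}"
proof -
  let ?E = "{x \<in> \<Omega>. t < u x}"
  have mE: "measure lebesgue ?E = \<mu> t"
    by (simp add: distribution_function_def)
  have "measure lebesgue (\<Omega> - ?E) = measure lebesgue \<Omega> - measure lebesgue ?E"
    using \<Omega>_finite by (intro measure_Diff) auto
  also have "measure lebesgue \<Omega> = V"
    unfolding V_def by (rule measure_completion) simp
  finally have mD: "measure lebesgue (\<Omega> - ?E) = V - \<mu> t"
    by (simp add: mE)
  have "profile s s' \<le> min (\<mu> t) (V - \<mu> t) powr p"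
    unfolding profile_def using assms p by (intro powr_mono2) auto
  then have "ereal (profile s s') \<le> ereal (min (measure lebesgue ?E) (measure lebesgue (\<Omega> - ?E)) powr p)"
    unfolding mE mD by simp
  also have "\<dots> \<le> ereal Q * perimeter \<Omega> ?E"
    by (rule isoperimetric) auto
  finally show ?thesis .
qed

text \<open>The superlevel sets at heights between \<open>r s'\<close> and \<open>r s\<close> have measure between \<open>s\<close> and \<open>s'\<close>, so their
  perimeters are at least \<open>profile s s' / Q\<close>. Every \<open>k\<close> below this bound is a growth rate of the mass of
  \<open>|Du|\<close> over these heights.\<close>

lemma rearrangement_increment_le:
  assumes s: "0 < s" "s \<le> s'" "s' < V"
  shows "profile s s' * (r s - r s') \<le> Q * measure grad_measure {x \<in> \<Omega>. r s' < u x \<and> u x < r s}"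
proof -
  have w0: "profile s s' > 0"
    using s by (simp add: profile_def)
  have rr: "r s' \<le> r s"
    by (rule r_antimono[OF s])
  define M where "M = distr grad_measure borel u"
  have [measurable]: "u \<in> borel_measurable grad_measure"
    using u_borel measurable_cong_sets[OF sets_grad_measure refl] by blast
  have sM: "sets M = sets borel"
    by (simp add: M_def)
  have mM: "measure M B = measure grad_measure (u -` B)" if "B \<in> sets borel" for B
    unfolding M_def using that by (subst measure_distr) auto
  have "finite_measure M"
    unfolding M_def by (rule grad.finite_measure_distr) simp
  have key: "k * (r s - r s') \<le> measure M {r s'<..<r s}" if k: "0 < k" "Q * k < profile s s'" for k
  proof (rule measure_ge_of_local_growth[OF \<open>finite_measure M\<close> sM rr])
    fix t assume t: "r s' \<le> t" "t < r s"
    then have *: "s < \<mu> t" "\<mu> t \<le> s'"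
      using less_\<mu>_iff[of s t] \<mu>_le_iff[of s' t] s by auto
    have "ereal k < perimeter \<Omega> {x \<in> \<Omega>. t < u x}"
    proof (rule ccontr)
      assume "\<not> ?thesis"
      then have "ereal Q * perimeter \<Omega> {x \<in> \<Omega>. t < u x} \<le> ereal Q * ereal k"
        using Q by (intro ereal_mult_left_mono) auto
      with perimeter_superlevel[OF s(1) * s(3)] have "ereal (profile s s') \<le> ereal Q * ereal k"
        by (rule order_trans)
      then show False
        using k(2) by simp
    qed
    from perimeter_less_imp_growth[OF this]
    show "\<forall>\<^sub>F h in at_right 0. k * h \<le> measure M {t<..t + h}"
      by (simp add: mM vimage_def)
  qed (use k in auto)
  have "r s - r s' \<le> Q * measure M {r s'<..<r s} / profile s s'"
  proof (cases "r s = r s'")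
    case False
    then have pos: "r s - r s' > 0"
      using rr by simp
    have "profile s s' / Q \<le> measure M {r s'<..<r s} / (r s - r s')"
    proof (rule dense_le_bounded[of 0])
      show "0 < profile s s' / Q"
        using w0 Q by simp
      fix k assume "0 < k" "k < profile s s' / Q"
      then show "k \<le> measure M {r s'<..<r s} / (r s - r s')"
        using key[of k] Q pos by (simp add: field_simps)
    qed
    then show ?thesis
      using Q pos w0 by (simp add: field_simps)
  qed (use Q w0 in auto)
  then have "profile s s' * (r s - r s') \<le> Q * measure M {r s'<..<r s}"
    using w0 by (simp add: field_simps)
  also have "measure M {r s'<..<r s} = measure grad_measure {x \<in> \<Omega>. r s' < u x \<and> u x < r s}"
  proof -
    have "measure M {r s'<..<r s} = measure grad_measure {x. r s' < u x \<and> u x < r s}"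
      by (subst mM) (simp_all add: vimage_def)
    also have "\<dots> = measure grad_measure {x \<in> \<Omega>. r s' < u x \<and> u x < r s}"
      using g_zero by (subst (1 2) measure_grad_measure)
        (auto intro!: Bochner_Integration.integral_cong simp: indicator_def)
    finally show ?thesis .
  qed
  finally show ?thesis .
qed

text \<open>Disjoint intervals of \<open>s\<close> correspond to disjoint slabs of \<open>u\<close> whose measures do not exceed the lengths of
  the intervals. On \<open>[c, d]\<close> the profile is bounded below, so the increments of \<open>r\<close> are controlled by the
  integral of \<open>|Du|\<close> over a set of small measure.\<close>

lemma rearrangement_abs_continuous:
  assumes "0 < c" "c \<le> d" "d < V"
  shows "abs_continuous_on_interval r c d"
  unfolding abs_continuous_on_interval_def
proof (intro allI impI)
  fix e :: real assume "e > 0"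
  define w where "w = profile c d"
  have w: "w > 0"
    using assms by (simp add: w_def profile_def)
  have "e * w / Q > 0"
    using \<open>e > 0\<close> w Q by simp
  then obtain \<delta> where \<delta>: "\<delta> > 0" "\<And>S. S \<in> sets borel \<Longrightarrow> emeasure lborel S < ennreal \<delta> \<Longrightarrow>
      (\<integral>x. indicator S x * norm (g x) \<partial>lborel) < e * w / Q"
    using integral_absolutely_continuous[OF integrable_norm[OF g_integrable] norm_ge_zero]
    by (metis sets_lborel)
  show "\<exists>\<delta>>0. \<forall>(n::nat) x y.
        (\<forall>i<n. c \<le> x i \<and> x i \<le> y i \<and> y i \<le> d) \<and>
        disjoint_family_on (\<lambda>i. {x i<..<y i}) {..<n} \<and>
        (\<Sum>i<n. y i - x i) < \<delta> \<longrightarrow> (\<Sum>i<n. \<bar>r (y i) - r (x i)\<bar>) < e"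
  proof (intro exI[of _ \<delta>] conjI allI impI \<delta>(1), elim conjE)
    fix n :: nat and x y :: "nat \<Rightarrow> real"
    assume xy: "\<forall>i<n. c \<le> x i \<and> x i \<le> y i \<and> y i \<le> d"
      and disj: "disjoint_family_on (\<lambda>i. {x i<..<y i}) {..<n}"
      and small: "(\<Sum>i<n. y i - x i) < \<delta>"
    have xyV: "0 < x i" "x i \<le> y i" "y i < V" if "i < n" for i
      using xy that assms by (auto intro: less_le_trans le_less_trans)
    define I where "I i = {r (y i)<..<r (x i)}" for i
    define S where "S i = {z \<in> \<Omega>. r (y i) < u z \<and> u z < r (x i)}" for i
    have I_borel [measurable, simp]: "I i \<in> sets borel" for i
      by (simp add: I_def)
    have S_borel [measurable]: "S i \<in> sets borel" for i
      unfolding S_def by measurable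
    have I_disj: "disjoint_family_on I {..<n}"
      unfolding disjoint_family_on_def
    proof (intro ballI impI)
      fix i j assume ij: "i \<in> {..<n}" "j \<in> {..<n}" "i \<noteq> j"
      have "{x i<..<y i} \<inter> {x j<..<y j} = {}"
        using disj ij by (auto simp: disjoint_family_on_def)
      then have "x i = y i \<or> x j = y j \<or> y i \<le> x j \<or> y j \<le> x i"
      proof -
        have False if "x i < y i" "x j < y j" "x j < y i" "x i < y j"
        proof -
          have "max (x i) (x j) < min (y i) (y j)"
            using that by auto
          then obtain z where "max (x i) (x j) < z" "z < min (y i) (y j)"
            using dense by blast
          then have "z \<in> {x i<..<y i} \<inter> {x j<..<y j}" by auto
          then show False
            using \<open>{x i<..<y i} \<inter> {x j<..<y j} = {}\<close> by blast
        qed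
        then show ?thesis
          using xyV(2)[of i] xyV(2)[of j] ij by fastforce
      qed
      moreover have "r (x j) \<le> r (y i)" if "y i \<le> x j"
        using xyV[of i] xyV[of j] ij that by (intro r_antimono) auto
      moreover have "r (x i) \<le> r (y j)" if "y j \<le> x i"
        using xyV[of i] xyV[of j] ij that by (intro r_antimono) auto
      ultimately show "I i \<inter> I j = {}"
        by (auto simp: I_def)
    qed
    have S_eq: "S i = {z \<in> \<Omega>. u z \<in> I i}" for i
      by (simp add: S_def I_def)
    have S_disj: "disjoint_family_on S {..<n}"
      using I_disj unfolding disjoint_family_on_def S_eq by fast
    have "measure value_measure (\<Union>i<n. I i) = (\<Sum>i<n. measure value_measure (I i))"
      using I_disj by (intro value_measure.finite_measure_finite_Union) (auto simp del: image_subset_iff)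
    also have "\<dots> \<le> (\<Sum>i<n. y i - x i)"
      using xyV by (intro sum_mono, unfold I_def) (rule measure_between_levels_le; simp)
    finally have "measure value_measure (\<Union>i<n. I i) < \<delta>"
      using small by simp
    then have "emeasure value_measure (\<Union>i<n. I i) < ennreal \<delta>"
      using \<delta>(1) by (simp add: value_measure.emeasure_eq_measure ennreal_less_iff)
    moreover have "{z \<in> \<Omega>. u z \<in> (\<Union>i<n. I i)} = (\<Union>i<n. S i)"
      by (auto simp: I_def S_def)
    moreover have "(\<Union>i<n. I i) \<in> sets borel"
      by (auto simp: I_def)
    ultimately have "emeasure lborel (\<Union>i<n. S i) < ennreal \<delta>"
      using emeasure_value_measure[of "\<Union>i<n. I i"] by simp
    then have gS: "measure grad_measure (\<Union>i<n. S i) < e * w / Q"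
      using \<delta>(2)[of "\<Union>i<n. S i"] by (subst measure_grad_measure) auto
    have "w * (\<Sum>i<n. \<bar>r (y i) - r (x i)\<bar>) = (\<Sum>i<n. w * (r (x i) - r (y i)))"
      unfolding sum_distrib_left using xyV r_antimono by (intro sum.cong) auto
    also have "\<dots> \<le> (\<Sum>i<n. Q * measure grad_measure (S i))"
    proof (rule sum_mono)
      fix i assume "i \<in> {..<n}"
      then have i: "i < n" by simp
      have "w \<le> profile (x i) (y i)"
        unfolding w_def profile_def using assms xy i p by (intro powr_mono2) auto
      then have "w * (r (x i) - r (y i)) \<le> profile (x i) (y i) * (r (x i) - r (y i))"
        using r_antimono[OF xyV[OF i]] by (intro mult_right_mono) auto
      also have "\<dots> \<le> Q * measure grad_measure (S i)"
        unfolding S_def by (rule rearrangement_increment_le[OF xyV[OF i]])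
      finally show "w * (r (x i) - r (y i)) \<le> Q * measure grad_measure (S i)" .
    qed
    also have "\<dots> = Q * measure grad_measure (\<Union>i<n. S i)"
      using S_disj by (subst grad.finite_measure_finite_Union) (auto simp: sum_distrib_left)
    also have "\<dots> < w * e"
      using gS Q by (simp add: field_simps)
    finally show "(\<Sum>i<n. \<bar>r (y i) - r (x i)\<bar>) < e"
      using w by simp
  qed
qed

end

section \<open>The density of the rearrangement\<close>

context isoperimetric_function
begin

lemma emeasure_level_measure_singleton:
  assumes "0 < s" "s < V"
  shows "emeasure level_measure {s} = 0"
proof -
  have eps: "emeasure level_measure {s} \<le> 0 + ennreal e" if e: "e > 0" for e
  proof -
    obtain \<delta> where \<delta>: "\<delta> > 0" "\<And>x y. s / 2 \<le> x \<Longrightarrow> x \<le> y \<Longrightarrow> y \<le> s \<Longrightarrow> y - x < \<delta> \<Longrightarrow> \<bar>r y - r x\<bar> < e"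
      using abs_continuous_imp_small_interval[OF rearrangement_abs_continuous[of "s / 2" s] e] assms by auto
    define s0 where "s0 = max (s / 2) (s - \<delta> / 2)"
    have s0: "s / 2 \<le> s0" "s0 < s" "s - s0 < \<delta>" "0 < s0"
      using assms \<delta>(1) by (auto simp: s0_def)
    have "emeasure level_measure {s} \<le> emeasure level_measure {s0<..s}"
      using s0 by (intro emeasure_mono) auto
    also have "\<dots> = ennreal (r s0 - r s)"
      using s0 assms by (intro emeasure_level_measure_Ioc) auto
    also have "\<dots> \<le> ennreal e"
      using \<delta>(2)[of s0 s] s0 by (intro ennreal_leI) auto
    finally show ?thesis by simp
  qed
  have "emeasure level_measure {s} \<le> 0"
    by (rule ennreal_le_epsilon) (rule eps)
  then show ?thesis by simp
qed

lemma emeasure_level_measure_Icc: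
  assumes "0 < s" "s \<le> s'" "s' < V"
  shows "emeasure level_measure {s..s'} = ennreal (r s - r s')"
proof -
  have "emeasure level_measure ({s} \<union> {s<..s'}) = emeasure level_measure {s} + emeasure level_measure {s<..s'}"
    by (rule plus_emeasure[symmetric]) auto
  also have "{s} \<union> {s<..s'} = {s..s'}"
    using assms by auto
  finally show ?thesis
    using assms by (simp add: emeasure_level_measure_singleton emeasure_level_measure_Ioc)
qed

text \<open>Cover the null set by countably many closed intervals of small total length with disjoint interiors.
  Absolute continuity bounds the total increment of \<open>r\<close> over every finite subfamily.\<close>

lemma level_measure_null:
  assumes c: "0 < c" "c \<le> d" "d < V" and Z: "Z \<in> sets borel" "Z \<subseteq> {c..d}" "emeasure lborel Z = 0"
  shows "emeasure level_measure Z = 0"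
proof -
  have eps: "emeasure level_measure Z \<le> 0 + ennreal e" if "e > 0" for e
  proof -
    have "\<exists>\<delta>>0. \<forall>(n::nat) x y.
        (\<forall>i<n. c \<le> x i \<and> x i \<le> y i \<and> y i \<le> d) \<and>
        disjoint_family_on (\<lambda>i. {x i<..<y i}) {..<n} \<and>
        (\<Sum>i<n. y i - x i) < \<delta> \<longrightarrow> (\<Sum>i<n. \<bar>r (y i) - r (x i)\<bar>) < e"
      using rearrangement_abs_continuous[OF c] that unfolding abs_continuous_on_interval_def by simp
    then obtain \<delta> where \<delta>: "\<delta> > 0" and ac: "\<And>(n::nat) x y. (\<forall>i<n. c \<le> x i \<and> x i \<le> y i \<and> y i \<le> d) \<and>
        disjoint_family_on (\<lambda>i. {x i<..<y i}) {..<n} \<and>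
        (\<Sum>i<n. y i - x i) < \<delta> \<Longrightarrow> (\<Sum>i<n. \<bar>r (y i) - r (x i)\<bar>) < e"
      by blast
    have Zl: "Z \<in> lmeasurable" "measure lebesgue Z = 0"
      using Z by (auto simp: fmeasurable_def measure_def)
    obtain \<D> where \<D>: "countable \<D>"
        "\<forall>K\<in>\<D>. K \<subseteq> cbox c d \<and> K \<noteq> {} \<and> (\<exists>c d. K = cbox c d)"
        "pairwise (\<lambda>A B. interior A \<inter> interior B = {}) \<D>"
        "Z \<subseteq> \<Union>\<D>" "\<Union>\<D> \<in> lmeasurable" "measure lebesgue (\<Union>\<D>) \<le> \<delta> / 2"
    proof (rule measurable_outer_intervals_bounded[of Z c d "\<delta> / 2"])
      show "Z \<in> lmeasurable" "Z \<subseteq> cbox c d" "0 < \<delta> / 2"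
        using Zl Z(2) \<delta> by simp_all
      fix \<D>
      assume D: "countable \<D>" "\<And>K. K \<in> \<D> \<Longrightarrow> K \<subseteq> cbox c d \<and> K \<noteq> {} \<and> (\<exists>c d. K = cbox c d)"
        "pairwise (\<lambda>A B. interior A \<inter> interior B = {}) \<D>" "Z \<subseteq> \<Union>\<D>" "\<Union>\<D> \<in> lmeasurable"
      assume "measure lebesgue (\<Union>\<D>) \<le> measure lebesgue Z + \<delta> / 2"
      then have "measure lebesgue (\<Union>\<D>) \<le> \<delta> / 2"
        using Zl(2) by simp
      then show thesis
        using D by (intro that ballI)
    qed
    have finite_bound: "emeasure level_measure (\<Union>\<D>') \<le> ennreal e" if \<D>': "finite \<D>'" "\<D>' \<subseteq> \<D>" for \<D>'
    proof -
      define P where "P K a b \<longleftrightarrow> (c \<le> a \<and> a \<le> b \<and> b \<le> d) \<and> K \<in> sets borel \<and> K \<in> lmeasurable \<and>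
          convex K \<and> interior K = {a<..<b} \<and> measure lebesgue K = b - a \<and>
          emeasure level_measure K = ennreal \<bar>r b - r a\<bar>" for K a b
      have "\<forall>K\<in>\<D>. \<exists>a b. P K a b"
      proof
        fix K assume "K \<in> \<D>"
        then obtain a b where K: "K = {a..b}" "K \<noteq> {}" "K \<subseteq> {c..d}"
          using bspec[OF \<D>(2), of K] by auto
        then have ab: "c \<le> a" "a \<le> b" "b \<le> d"
          by auto
        then have *: "0 < a" "a \<le> b" "b < V"
          using c by auto
        have "emeasure level_measure K = ennreal \<bar>r b - r a\<bar>"
          unfolding K(1) using emeasure_level_measure_Icc[OF *] r_antimono[OF *] by simp
        then have "P K a b"
          unfolding P_def using ab by (auto simp: K(1))
        then show "\<exists>a b. P K a b" by blast
      qed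
      then obtain lo hi where P: "\<And>K. K \<in> \<D> \<Longrightarrow> P K (lo K) (hi K)"
        by metis
      have lh: "c \<le> lo K \<and> lo K \<le> hi K \<and> hi K \<le> d" and K_borel: "K \<in> sets borel"
          and K_lm: "K \<in> lmeasurable" and K_convex: "convex K"
          and K_interior: "interior K = {lo K<..<hi K}"
          and K_length: "measure lebesgue K = hi K - lo K"
          and K_level: "emeasure level_measure K = ennreal \<bar>r (hi K) - r (lo K)\<bar>" if "K \<in> \<D>" for K
        using P[OF that] unfolding P_def by blast+
      note \<D>'_D = subsetD[OF \<D>'(2)]
      obtain I :: "nat \<Rightarrow> real set" where I: "bij_betw I {..<card \<D>'} \<D>'"
        using ex_bij_betw_nat_finite[OF \<D>'(1)] by (auto simp: atLeast0LessThan)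
      have ID: "I i \<in> \<D>" "I i \<in> \<D>'" if "i < card \<D>'" for i
        using I \<D>'(2) that by (auto dest: bij_betwE)
      have sum_eq: "(\<Sum>i<card \<D>'. F (I i)) = (\<Sum>K\<in>\<D>'. F K)" for F :: "real set \<Rightarrow> real"
        using I by (rule sum.reindex_bij_betw)
      have "(\<Sum>K\<in>\<D>'. hi K - lo K) = (\<Sum>K\<in>\<D>'. measure lebesgue K)"
        using K_length \<D>'_D by (intro sum.cong) simp_all
      also have "\<dots> = measure lebesgue (\<Union>\<D>')"
      proof (rule measure_negligible_finite_Union[symmetric, OF \<D>'(1)])
        show "pairwise (\<lambda>S T. negligible (S \<inter> T)) \<D>'"
        proof (rule pairwiseI)
          fix S T assume ST: "S \<in> \<D>'" "T \<in> \<D>'" "S \<noteq> T"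
          have "interior S \<inter> interior T = {}"
            by (rule pairwiseD[OF \<D>(3) \<D>'_D[OF ST(1)] \<D>'_D[OF ST(2)] ST(3)])
          moreover have "convex (S \<inter> T)"
            by (intro convex_Int K_convex \<D>'_D ST)
          ultimately show "negligible (S \<inter> T)"
            by (simp add: negligible_convex_interior)
        qed
      qed (rule K_lm[OF \<D>'_D])
      also have "\<dots> \<le> measure lebesgue (\<Union>\<D>)"
      proof (rule measure_mono_fmeasurable[OF _ _ \<D>(5)])
        show "\<Union>\<D>' \<in> sets lebesgue"
          using K_lm \<D>'_D by (intro sets.finite_Union[OF \<D>'(1)]) auto
        show "\<Union>\<D>' \<subseteq> \<Union>\<D>"
          using \<D>'(2) by (rule Union_mono)
      qed
      finally have len: "(\<Sum>i<card \<D>'. hi (I i) - lo (I i)) < \<delta>"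
        using \<D>(6) \<delta> sum_eq[of "\<lambda>K. hi K - lo K"] by simp
      have "disjoint_family_on (\<lambda>i. {lo (I i)<..<hi (I i)}) {..<card \<D>'}"
        unfolding disjoint_family_on_def
      proof (intro ballI impI)
        fix i j assume ij: "i \<in> {..<card \<D>'}" "j \<in> {..<card \<D>'}" "i \<noteq> j"
        then have "I i \<noteq> I j"
          using I by (auto simp: bij_betw_def inj_on_def)
        then have "interior (I i) \<inter> interior (I j) = {}"
          using pairwiseD[OF \<D>(3) ID(1) ID(1), of i j] ij by simp
        then show "{lo (I i)<..<hi (I i)} \<inter> {lo (I j)<..<hi (I j)} = {}"
          using K_interior[OF ID(1)[of i]] K_interior[OF ID(1)[of j]] ij by simp
      qed
      with len have "(\<Sum>i<card \<D>'. \<bar>r (hi (I i)) - r (lo (I i))\<bar>) < e"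
        using lh ID by (intro ac) auto
      then have small: "(\<Sum>K\<in>\<D>'. \<bar>r (hi K) - r (lo K)\<bar>) < e"
        using sum_eq[of "\<lambda>K. \<bar>r (hi K) - r (lo K)\<bar>"] by simp
      have "emeasure level_measure (\<Union>K\<in>\<D>'. K) \<le> (\<Sum>K\<in>\<D>'. emeasure level_measure K)"
      proof (rule emeasure_subadditive_finite[OF \<D>'(1)])
        show "(\<lambda>K. K) ` \<D>' \<subseteq> sets level_measure"
          using K_borel \<D>'_D by auto
      qed
      also have "\<dots> = (\<Sum>K\<in>\<D>'. ennreal \<bar>r (hi K) - r (lo K)\<bar>)"
        using K_level \<D>'_D by (intro sum.cong) simp_all
      also have "\<dots> = ennreal (\<Sum>K\<in>\<D>'. \<bar>r (hi K) - r (lo K)\<bar>)"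
        by simp
      also have "\<dots> \<le> ennreal e"
        using small by (intro ennreal_leI) simp
      finally show ?thesis by simp
    qed
    show ?thesis
    proof (cases "\<D> = {}")
      case True
      then show ?thesis
        using \<D>(4) by simp
    next
      case False
      define A where "A n = \<Union>(from_nat_into \<D> ` {..<n})" for n :: nat
      have sub: "from_nat_into \<D> ` {..<n} \<subseteq> \<D>" for n
        using from_nat_into[OF False] by blast
      have A_borel: "A n \<in> sets borel" for n
        unfolding A_def
      proof (rule sets.finite_Union)
        show "from_nat_into \<D> ` {..<n} \<subseteq> sets borel"
        proof
          fix K assume "K \<in> from_nat_into \<D> ` {..<n}"
          then obtain a b where "K = cbox a b"
            using bspec[OF \<D>(2) subsetD[OF sub]] by blast
          then show "K \<in> sets borel" by simp
        qed
      qed simp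
      have "incseq A"
        unfolding incseq_def A_def by (intro allI impI Union_mono image_mono) auto
      moreover have "(\<Union>n. A n) = \<Union>\<D>"
      proof -
        have "K \<subseteq> (\<Union>n. A n)" if K: "K \<in> \<D>" for K
        proof -
          obtain n where "from_nat_into \<D> n = K"
            using from_nat_into_surj[OF \<D>(1) K] by blast
          then have "K \<subseteq> A (Suc n)"
            unfolding A_def by auto
          then show ?thesis by blast
        qed
        moreover have "A n \<subseteq> \<Union>\<D>" for n
          unfolding A_def using sub by (rule Union_mono)
        ultimately show ?thesis by blast
      qed
      ultimately have "emeasure level_measure (\<Union>\<D>) = (SUP n. emeasure level_measure (A n))"
        using SUP_emeasure_incseq[of A level_measure] A_borel by (simp add: image_subset_iff)
      also have "\<dots> \<le> ennreal e"
        unfolding A_def by (intro SUP_least finite_bound sub) simp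
      finally have "emeasure level_measure (\<Union>\<D>) \<le> ennreal e" .
      moreover have "\<Union>\<D> \<in> sets borel"
        using \<open>(\<Union>n. A n) = \<Union>\<D>\<close> A_borel by (metis sets.countable_UN'' countableI_type)
      then have "emeasure level_measure Z \<le> emeasure level_measure (\<Union>\<D>)"
        using \<D>(4) by (intro emeasure_mono) auto
      ultimately show ?thesis by simp
    qed
  qed
  have "emeasure level_measure Z \<le> 0"
    by (rule ennreal_le_epsilon) (rule eps)
  then show ?thesis by simp
qed

text \<open>Restricted to \<open>(0, V)\<close>, the Stieltjes measure of \<open>- r\<close> is absolutely continuous, and the Radon-Nikodym
  theorem applies. The density may be infinite only on a null set, where \<open>enn2real\<close> replaces it by \<open>0\<close>.\<close>

lemma rearrangement_density_exists:
  "\<exists>f::real \<Rightarrow> real. f \<in> borel_measurable borel \<and> (\<forall>s. 0 \<le> f s) \<and>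
    (\<forall>s s'. 0 < s \<longrightarrow> s \<le> s' \<longrightarrow> s' < V \<longrightarrow>
      integrable lborel (\<lambda>\<sigma>. indicator {s..s'} \<sigma> * f \<sigma>) \<and>
      (\<integral>\<sigma>. indicator {s..s'} \<sigma> * f \<sigma> \<partial>lborel) = r s - r s')"
proof -
  define N where "N = density level_measure (indicator {0<..<V})"
  have sN: "sets N = sets borel"
    by (simp add: N_def)
  have N: "emeasure N B = emeasure level_measure ({0<..<V} \<inter> B)" if "B \<in> sets borel" for B
    unfolding N_def using that
    by (subst emeasure_density) (auto simp: nn_integral_indicator[symmetric] indicator_inter_arith
      simp del: nn_integral_indicator)
  have null: "emeasure N Z = 0" if Z: "Z \<in> sets borel" "emeasure lborel Z = 0" for Z
  proof (cases "V > 0")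
    case True
    define c where "c n = V / (2 + real n)" for n
    define Y where "Y n = Z \<inter> {c n..V - c n}" for n
    have c: "0 < c n" "c n \<le> V - c n" "V - c n < V" for n
      using True by (auto simp: c_def field_simps)
    have "emeasure level_measure (Y n) = 0" for n
    proof (rule level_measure_null[OF c])
      show "emeasure lborel (Y n) = 0"
        using emeasure_mono[of "Y n" Z lborel] Z by (auto simp: Y_def)
    qed (use Z in \<open>auto simp: Y_def\<close>)
    then have "emeasure level_measure (\<Union>n. Y n) = 0"
      using Z by (intro emeasure_UN_eq_0) (auto simp: Y_def)
    moreover have "(\<Union>n. Y n) = {0<..<V} \<inter> Z"
    proof (intro equalityI subsetI)
      fix s assume "s \<in> (\<Union>n. Y n)"
      then obtain n where "s \<in> Z" "c n \<le> s" "s \<le> V - c n"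
        by (auto simp: Y_def)
      then show "s \<in> {0<..<V} \<inter> Z"
        using c[of n] by auto
    next
      fix s assume s: "s \<in> {0<..<V} \<inter> Z"
      have "c \<longlonglongrightarrow> 0"
        unfolding c_def by (intro tendsto_divide_0[OF tendsto_const] filterlim_at_top_imp_at_infinity
          filterlim_tendsto_add_at_top[OF tendsto_const] filterlim_real_sequentially)
      then have "\<forall>\<^sub>F n in sequentially. c n < min s (V - s)"
        using s by (intro order_tendstoD) auto
      then obtain n where "c n < min s (V - s)"
        by (meson eventually_happens trivial_limit_sequentially)
      then have "s \<in> Y n"
        using s by (auto simp: Y_def)
      then show "s \<in> (\<Union>n. Y n)" by blast
    qed
    ultimately show ?thesis
      using N[OF Z(1)] by simp
  next
    case False
    then have "{0<..<V} = {}" by simp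
    then show ?thesis
      using N[OF Z(1)] by simp
  qed
  then have "absolutely_continuous lborel N"
    unfolding absolutely_continuous_def by (auto simp: null_sets_def sN)
  then obtain f' where f' [measurable]: "f' \<in> borel_measurable borel" and dens: "density lborel f' = N"
    using sigma_finite_measure.Radon_Nikodym[OF sigma_finite_lborel, of N] sN by auto
  define f where "f s = enn2real (f' s)" for s
  have f_borel [measurable]: "f \<in> borel_measurable borel"
    unfolding f_def by measurable
  have "integrable lborel (\<lambda>\<sigma>. indicator {s..s'} \<sigma> * f \<sigma>) \<and>
      (\<integral>\<sigma>. indicator {s..s'} \<sigma> * f \<sigma> \<partial>lborel) = r s - r s'" if s: "0 < s" "s \<le> s'" "s' < V" for s s'
  proof -
    have "emeasure N {s..s'} = emeasure level_measure {s..s'}"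
      using N[of "{s..s'}"] s by (simp add: Int_absorb1 subset_iff)
    then have mass: "(\<integral>\<^sup>+ \<sigma>. f' \<sigma> * indicator {s..s'} \<sigma> \<partial>lborel) = ennreal (r s - r s')"
      unfolding dens[symmetric] using emeasure_level_measure_Icc[OF s] by (simp add: emeasure_density)
    then have "AE \<sigma> in lborel. f' \<sigma> * indicator {s..s'} \<sigma> \<noteq> \<infinity>"
      by (intro nn_integral_noteq_infinite) simp_all
    then have "AE \<sigma> in lborel. ennreal (indicator {s..s'} \<sigma> * f \<sigma>) = f' \<sigma> * indicator {s..s'} \<sigma>"
      by eventually_elim (auto simp: f_def indicator_def less_top)
    then have "(\<integral>\<^sup>+ \<sigma>. ennreal (indicator {s..s'} \<sigma> * f \<sigma>) \<partial>lborel) = ennreal (r s - r s')"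
      unfolding mass[symmetric] by (rule nn_integral_cong_AE)
    then have "has_bochner_integral lborel (\<lambda>\<sigma>. indicator {s..s'} \<sigma> * f \<sigma>) (r s - r s')"
      using r_antimono[OF s] by (intro has_bochner_integral_nn_integral) (auto simp: f_def)
    then show ?thesis
      by (simp add: has_bochner_integral_iff)
  qed
  then show ?thesis
    by (intro exI[of _ f]) (auto simp: f_def)
qed

text \<open>A version of \<open>- r'\<close> on \<open>(0, V)\<close>; its values elsewhere are arbitrary nonnegative numbers.\<close>

definition slope_density :: "real \<Rightarrow> real" where
  "slope_density = (SOME f. f \<in> borel_measurable borel \<and> (\<forall>s. 0 \<le> f s) \<and>
    (\<forall>s s'. 0 < s \<longrightarrow> s \<le> s' \<longrightarrow> s' < V \<longrightarrow>
      integrable lborel (\<lambda>\<sigma>. indicator {s..s'} \<sigma> * f \<sigma>) \<and>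
      (\<integral>\<sigma>. indicator {s..s'} \<sigma> * f \<sigma> \<partial>lborel) = r s - r s'))"

lemma slope_density_borel [measurable]: "slope_density \<in> borel_measurable borel"
  and slope_density_nonneg: "0 \<le> slope_density s"
  and slope_density_integrable: "0 < s \<Longrightarrow> s \<le> s' \<Longrightarrow> s' < V \<Longrightarrow>
    integrable lborel (\<lambda>\<sigma>. indicator {s..s'} \<sigma> * slope_density \<sigma>)"
  and slope_density_integral: "0 < s \<Longrightarrow> s \<le> s' \<Longrightarrow> s' < V \<Longrightarrow>
    (\<integral>\<sigma>. indicator {s..s'} \<sigma> * slope_density \<sigma> \<partial>lborel) = r s - r s'"
  using someI_ex[OF rearrangement_density_exists] unfolding slope_density_def[symmetric] by blast+

end

section \<open>Modular inequality for the density\<close>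

lemma N_functionD:
  assumes "N_function A"
  shows "\<And>t. 0 \<le> t \<Longrightarrow> 0 \<le> A t" and "\<And>s t. 0 \<le> s \<Longrightarrow> s \<le> t \<Longrightarrow> A s \<le> A t"
    and "continuous_on {0..} A" and "convex_on {0..} A"
  using assms by (auto simp: N_function_def mono_on_def)

lemma N_function_zero:
  assumes A: "N_function A"
  shows "A 0 = 0"
proof -
  have "(A \<longlongrightarrow> A 0) (at 0 within {0..})"
    using N_functionD(3)[OF A] by (simp add: continuous_on_def)
  then have 1: "(A \<longlongrightarrow> A 0) (at_right 0)"
    by (rule tendsto_within_subset) auto
  have "((\<lambda>t. A t / t * t) \<longlongrightarrow> 0 * 0) (at_right 0)"
    using A by (intro tendsto_mult) (auto simp: N_function_def)
  moreover have "\<forall>\<^sub>F t in at_right 0. A t / t * t = A t"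
    by (auto simp: eventually_at_right_field intro!: exI[of _ 1])
  ultimately have "(A \<longlongrightarrow> 0) (at_right 0)"
    by (simp add: filterlim_cong)
  with 1 show ?thesis
    by (rule tendsto_unique[OF trivial_limit_at_right_real])
qed

text \<open>An N-function is only constrained on the half line. These two extensions agree with it there and are
  measurable on the whole line.\<close>

lemma N_function_extend:
  assumes A: "N_function A"
  shows "continuous_on UNIV (\<lambda>t. A (max 0 t))" and "(\<lambda>t. A (max 0 t)) \<in> borel_measurable borel"
    and "(\<lambda>t. A \<bar>t\<bar>) \<in> borel_measurable borel"
proof -
  show "continuous_on UNIV (\<lambda>t. A (max 0 t))"
    by (rule continuous_on_compose2[OF N_functionD(3)[OF A]]) (auto intro!: continuous_intros)
  then show "(\<lambda>t. A (max 0 t)) \<in> borel_measurable borel"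
    by (rule borel_measurable_continuous_onI)
  have "continuous_on UNIV (\<lambda>t. A \<bar>t\<bar>)"
    by (rule continuous_on_compose2[OF N_functionD(3)[OF A]]) (auto intro!: continuous_intros)
  then show "(\<lambda>t. A \<bar>t\<bar>) \<in> borel_measurable borel"
    by (rule borel_measurable_continuous_onI)
qed

lemma N_function_tendsto:
  assumes A: "N_function A" and "\<And>n. 0 \<le> X n" "0 \<le> l" "X \<longlonglongrightarrow> l"
  shows "(\<lambda>n. A (X n)) \<longlonglongrightarrow> A l"
proof -
  have "(\<lambda>n. A (max 0 (X n))) \<longlonglongrightarrow> A (max 0 l)"
    using N_function_extend(1)[OF A] assms(4)
    by (intro isCont_tendsto_compose[where g = "\<lambda>t. A (max 0 t)"]) (auto simp: continuous_on_eq_continuous_at)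
  then show ?thesis
    using assms by simp
qed

text \<open>Jensen's inequality on a set whose measure may be smaller than the normalizing constant \<open>h\<close>. A
  supporting line of \<open>A\<close> at the average has nonpositive value at \<open>0\<close> because \<open>A 0 = 0\<close>, so
  replacing the measure of \<open>S\<close> by \<open>h\<close> only weakens the estimate.\<close>

lemma jensen_small_measure:
  fixes \<psi> :: "'a \<Rightarrow> real"
  assumes A: "N_function A" and S: "S \<in> sets M" "emeasure M S \<le> ennreal h" "h > 0"
    and \<psi>: "integrable M \<psi>" "\<And>x. 0 \<le> \<psi> x"
  shows "ennreal (A ((\<integral>x. indicator S x * \<psi> x \<partial>M) / h))
    \<le> ennreal (1 / h) * (\<integral>\<^sup>+x. ennreal (A (\<psi> x)) * indicator S x \<partial>M)"
proof -
  note [measurable] = S(1) N_function_extend(2)[OF A]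
  have \<psi>_meas [measurable]: "\<psi> \<in> borel_measurable M"
    using \<psi>(1) by auto
  define q where "q = (\<integral>x. indicator S x * \<psi> x \<partial>M) / h"
  have q0: "q \<ge> 0"
    unfolding q_def using \<psi>(2) S(3) by (intro divide_nonneg_pos integral_nonneg_AE) auto
  have fin: "emeasure M S < \<infinity>"
    using le_less_trans[OF S(2) ennreal_less_top] by simp
  have mS: "measure M S \<le> h"
    using S(2,3) fin by (simp add: emeasure_eq_ennreal_measure less_top)
  have iS: "integrable M (indicator S :: 'a \<Rightarrow> real)"
    using S(1) fin by (simp add: integrable_indicator_iff)
  have i\<psi>: "integrable M (\<lambda>x. indicator S x * \<psi> x)"
    using integrable_real_mult_indicator[OF S(1) \<psi>(1)] by (simp add: mult.commute)
  have A\<psi>: "A (\<psi> x) = A (max 0 (\<psi> x))" for x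
    using \<psi>(2)[of x] by simp
  have A\<psi>_meas [measurable]: "(\<lambda>x. A (\<psi> x)) \<in> borel_measurable M"
    unfolding A\<psi> by measurable
  show ?thesis
  proof (cases "q = 0 \<or> (\<integral>\<^sup>+x. ennreal (A (\<psi> x)) * indicator S x \<partial>M) = \<infinity>")
    case True
    then show ?thesis
      using N_function_zero[OF A] S(3) unfolding q_def[symmetric]
      by (auto simp: ennreal_mult_top)
  next
    case False
    then have "q > 0"
      using q0 by simp
    define \<sigma> where "\<sigma> = Inf ((\<lambda>t. (A q - A t) / (q - t)) ` ({q<..} \<inter> {0..}))"
    have slope: "A q + \<sigma> * (z - q) \<le> A z" if "z \<ge> 0" for z
      unfolding \<sigma>_def using N_functionD(4)[OF A] \<open>q > 0\<close> that
      by (intro convex_le_Inf_differential) (auto simp: interior_real_atLeast)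
    have offset: "A q - \<sigma> * q \<le> 0"
      using slope[of 0] N_function_zero[OF A] by simp
    have iA: "integrable M (\<lambda>x. indicator S x * A (\<psi> x))"
    proof (rule integrableI_nonneg)
      show "AE x in M. 0 \<le> indicator S x * A (\<psi> x)"
        using N_functionD(1)[OF A] \<psi>(2) by simp
      have "(\<integral>\<^sup>+x. ennreal (indicator S x * A (\<psi> x)) \<partial>M) = (\<integral>\<^sup>+x. ennreal (A (\<psi> x)) * indicator S x \<partial>M)"
        by (intro nn_integral_cong) (auto simp: indicator_def)
      then show "(\<integral>\<^sup>+x. ennreal (indicator S x * A (\<psi> x)) \<partial>M) < \<infinity>"
        using False by (simp add: less_top)
    qed simp
    have "h * A q = h * (A q - \<sigma> * q) + \<sigma> * (h * q)"
      by (simp add: algebra_simps)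
    also have "\<dots> \<le> measure M S * (A q - \<sigma> * q) + \<sigma> * (h * q)"
      using mS offset by (intro add_right_mono mult_right_mono_neg)
    also have "h * q = (\<integral>x. indicator S x * \<psi> x \<partial>M)"
      using S(3) by (simp add: q_def)
    also have "measure M S * (A q - \<sigma> * q) + \<sigma> * (\<integral>x. indicator S x * \<psi> x \<partial>M)
        = (\<integral>x. indicator S x * (A q - \<sigma> * q) + \<sigma> * (indicator S x * \<psi> x) \<partial>M)"
      using iS i\<psi> S(1) by simp
    also have "\<dots> \<le> (\<integral>x. indicator S x * A (\<psi> x) \<partial>M)"
    proof (rule integral_mono)
      show "integrable M (\<lambda>x. indicator S x * (A q - \<sigma> * q) + \<sigma> * (indicator S x * \<psi> x))"
        using iS i\<psi> by simp
      show "indicator S x * (A q - \<sigma> * q) + \<sigma> * (indicator S x * \<psi> x) \<le> indicator S x * A (\<psi> x)" for x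
        using slope[OF \<psi>(2)[of x]] by (simp add: indicator_def algebra_simps)
    qed (rule iA)
    finally have "A q \<le> (1 / h) * (\<integral>x. indicator S x * A (\<psi> x) \<partial>M)"
      using S(3) by (simp add: field_simps)
    then have "ennreal (A q) \<le> ennreal (1 / h) * ennreal (\<integral>x. indicator S x * A (\<psi> x) \<partial>M)"
      using S(3) by (simp add: ennreal_leI flip: ennreal_mult')
    also have "ennreal (\<integral>x. indicator S x * A (\<psi> x) \<partial>M) = (\<integral>\<^sup>+x. ennreal (indicator S x * A (\<psi> x)) \<partial>M)"
      using iA N_functionD(1)[OF A] \<psi>(2) by (intro nn_integral_eq_integral[symmetric]) auto
    also have "\<dots> = (\<integral>\<^sup>+x. ennreal (A (\<psi> x)) * indicator S x \<partial>M)"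
      by (intro nn_integral_cong) (auto simp: indicator_def)
    finally show ?thesis
      by (simp add: q_def)
  qed
qed

context isoperimetric_function
begin

lemma steklov_slope_density:
  assumes "0 < c" "c \<le> s" "0 < h" "s + h \<le> d" "d < V"
  shows "steklov h (\<lambda>\<sigma>. indicator {c..d} \<sigma> * slope_density \<sigma>) s = (r s - r (s + h)) / h"
proof -
  have "r s - r (s + h) = (\<integral>\<sigma>. indicator {s..s + h} \<sigma> * slope_density \<sigma> \<partial>lborel)"
    using assms by (subst slope_density_integral) auto
  also have "\<dots> = \<bar>h\<bar> *\<^sub>R (\<integral>t. indicator {s..s + h} (s + h * t) * slope_density (s + h * t) \<partial>lborel)"
    using assms by (intro lborel_integral_real_affine) simp
  also have "(\<lambda>t. indicator {s..s + h} (s + h * t) * slope_density (s + h * t))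
      = (\<lambda>t. indicator {0..1} t * (indicator {c..d} (s + t *\<^sub>R h) * slope_density (s + t *\<^sub>R h)))"
  proof
    fix t
    have "s + h * t \<in> {s..s + h} \<longleftrightarrow> t \<in> {0..1}"
      using assms by (auto simp: zero_le_mult_iff mult_le_cancel_left2)
    moreover have "s + h * t \<in> {c..d}" if "t \<in> {0..1}"
    proof -
      have "0 \<le> h * t" "h * t \<le> h"
        using that assms by (auto simp: mult_left_le)
      then show ?thesis
        using assms unfolding atLeastAtMost_iff by linarith
    qed
    ultimately show "indicator {s..s + h} (s + h * t) * slope_density (s + h * t)
      = indicator {0..1} t * (indicator {c..d} (s + t *\<^sub>R h) * slope_density (s + t *\<^sub>R h))"
      by (simp add: indicator_def mult.commute[of t h])
  qed
  finally show ?thesis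
    using assms by (simp add: steklov_def)
qed

text \<open>Jensen's inequality turns \<open>A(\<theta> s / k)\<close> into an average of \<open>A(|Du| / k)\<close> over the slab that belongs to
  \<open>s\<close>. Integrate in \<open>s\<close> and exchange the integrals: each \<open>x\<close> is counted for a set of \<open>s\<close> of length at
  most \<open>h\<close>, which cancels the factor \<open>1/h\<close>.\<close>

lemma averaged_gradient_modular_le:
  assumes A: "N_function A" and k: "k > 0" and h: "h > 0" and cd: "0 < c" "c \<le> d" "d + h < V"
    and \<theta>: "\<And>s. c \<le> s \<Longrightarrow> s \<le> d \<Longrightarrow> 0 \<le> \<theta> s \<and>
      \<theta> s \<le> measure grad_measure {x \<in> \<Omega>. r (s + h) < u x \<and> u x < r s} / h"
  shows "(\<integral>\<^sup>+s. ennreal (A (\<theta> s / k)) * indicator {c..d} s \<partial>lborel)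
    \<le> (\<integral>\<^sup>+x. ennreal (A (norm (g x) / k)) \<partial>lborel)"
proof -
  note [measurable] = N_function_extend(3)[OF A]
  define \<psi> where "\<psi> x = norm (g x) / k" for x
  have \<psi>: "integrable lborel \<psi>" "\<And>x. 0 \<le> \<psi> x"
    unfolding \<psi>_def using g_integrable k by auto
  have [measurable]: "\<psi> \<in> borel_measurable borel"
    using \<psi>(1) by auto
  have A\<psi>: "A (\<psi> x) = A \<bar>\<psi> x\<bar>" for x
    using \<psi>(2)[of x] by simp
  have [measurable]: "(\<lambda>x. A (\<psi> x)) \<in> borel_measurable borel"
    unfolding A\<psi> by measurable
  \<comment> \<open>This contains the slab \<open>r (s + h) < u x < r s\<close>. It is jointly measurable in \<open>s\<close> and \<open>x\<close>, and
    for fixed \<open>x\<close> it confines \<open>s\<close> to an interval of length \<open>h\<close>.\<close>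
  define B where "B s x \<longleftrightarrow> s < \<mu> (u x) \<and> \<mu> (u x) \<le> s + h" for s x
  have pointwise: "ennreal (A (\<theta> s / k)) * indicator {c..d} s
      \<le> ennreal (1 / h) * (\<integral>\<^sup>+x. ennreal (A (\<psi> x)) * indicator {x. B s x} x * indicator {c..d} s \<partial>lborel)" for s
  proof (cases "s \<in> {c..d}")
    case True
    then have s: "0 < s" "s \<le> s + h" "s + h < V"
      using cd h by auto
    define S where "S = {x \<in> \<Omega>. r (s + h) < u x \<and> u x < r s}"
    have [measurable]: "S \<in> sets borel"
      unfolding S_def by measurable
    have "emeasure lborel S = emeasure value_measure {r (s + h)<..<r s}"
      by (simp add: emeasure_value_measure S_def)
    also have "\<dots> \<le> ennreal h"
      using measure_between_levels_le[OF s] by (simp add: value_measure.emeasure_eq_measure ennreal_leI)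
    finally have eS: "emeasure lborel S \<le> ennreal h" .
    have S_B: "indicator S x \<le> (indicator {x. B s x} x :: ennreal)" for x
      using less_\<mu>_iff[of s "u x"] \<mu>_le_iff[of "s + h" "u x"] s
      by (auto simp: S_def B_def indicator_def)
    have "\<theta> s / k \<le> (\<integral>x. indicator S x * norm (g x) \<partial>lborel) / h / k"
      using \<theta>[of s] True k by (intro divide_right_mono) (auto simp: S_def[symmetric] measure_grad_measure)
    also have "\<dots> = (\<integral>x. indicator S x * \<psi> x \<partial>lborel) / h"
      by (simp add: \<psi>_def)
    finally have "A (\<theta> s / k) \<le> A ((\<integral>x. indicator S x * \<psi> x \<partial>lborel) / h)"
      using \<theta>[of s] True k by (intro N_functionD(2)[OF A]) auto
    then have "ennreal (A (\<theta> s / k)) \<le> ennreal (1 / h) * (\<integral>\<^sup>+x. ennreal (A (\<psi> x)) * indicator S x \<partial>lborel)"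
      using jensen_small_measure[OF A _ eS h \<psi>] by (auto intro: order_trans ennreal_leI)
    also have "\<dots> \<le> ennreal (1 / h) * (\<integral>\<^sup>+x. ennreal (A (\<psi> x)) * indicator {x. B s x} x \<partial>lborel)"
      by (intro mult_left_mono nn_integral_mono S_B) auto
    finally show ?thesis
      using True by simp
  qed simp
  have "(\<integral>\<^sup>+s. ennreal (A (\<theta> s / k)) * indicator {c..d} s \<partial>lborel)
      \<le> (\<integral>\<^sup>+s. ennreal (1 / h) * (\<integral>\<^sup>+x. ennreal (A (\<psi> x)) * indicator {x. B s x} x * indicator {c..d} s \<partial>lborel) \<partial>lborel)"
    by (intro nn_integral_mono pointwise)
  also have "\<dots> = ennreal (1 / h) * (\<integral>\<^sup>+s. (\<integral>\<^sup>+x. ennreal (A (\<psi> x)) * indicator {x. B s x} x * indicator {c..d} s \<partial>lborel) \<partial>lborel)"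
    unfolding B_def by (intro nn_integral_cmult) measurable
  also have "(\<integral>\<^sup>+s. (\<integral>\<^sup>+x. ennreal (A (\<psi> x)) * indicator {x. B s x} x * indicator {c..d} s \<partial>lborel) \<partial>lborel)
      = (\<integral>\<^sup>+x. (\<integral>\<^sup>+s. ennreal (A (\<psi> x)) * indicator {x. B s x} x * indicator {c..d} s \<partial>lborel) \<partial>lborel)"
    unfolding B_def by (intro lborel_pair.Fubini') measurable
  also have "\<dots> \<le> (\<integral>\<^sup>+x. ennreal (A (\<psi> x)) * ennreal h \<partial>lborel)"
  proof (intro nn_integral_mono)
    fix x
    have "(\<integral>\<^sup>+s. ennreal (A (\<psi> x)) * indicator {x. B s x} x * indicator {c..d} s \<partial>lborel)
        \<le> (\<integral>\<^sup>+s. ennreal (A (\<psi> x)) * indicator {\<mu> (u x) - h..<\<mu> (u x)} s \<partial>lborel)"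
      by (intro nn_integral_mono) (auto simp: B_def indicator_def)
    also have "\<dots> = ennreal (A (\<psi> x)) * ennreal h"
      using h by (simp add: nn_integral_cmult_indicator)
    finally show "(\<integral>\<^sup>+s. ennreal (A (\<psi> x)) * indicator {x. B s x} x * indicator {c..d} s \<partial>lborel)
        \<le> ennreal (A (\<psi> x)) * ennreal h" .
  qed
  also have "\<dots> = (\<integral>\<^sup>+x. ennreal (A (\<psi> x)) \<partial>lborel) * ennreal h"
    by (rule nn_integral_multc) measurable
  finally have "(\<integral>\<^sup>+s. ennreal (A (\<theta> s / k)) * indicator {c..d} s \<partial>lborel)
      \<le> ennreal (1 / h) * ((\<integral>\<^sup>+x. ennreal (A (\<psi> x)) \<partial>lborel) * ennreal h)"
    by (simp add: mult_left_mono)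
  also have "\<dots> = (ennreal (1 / h) * ennreal h) * (\<integral>\<^sup>+x. ennreal (A (\<psi> x)) \<partial>lborel)"
    by (simp add: mult_ac)
  also have "ennreal (1 / h) * ennreal h = 1"
    using h by (simp flip: ennreal_mult)
  finally show ?thesis
    by (simp add: \<psi>_def)
qed

text \<open>The length of the gradient of the symmetrization at \<open>s = c\<^sub>n|x|\<^sup>n\<close>, divided by the constant of the final
  estimate.\<close>

definition weighted_slope :: "real \<Rightarrow> real \<Rightarrow> real" where
  "weighted_slope \<epsilon> s = slope_density s * s powr p / (Q * ((V - \<epsilon>) / \<epsilon>) powr p)"

text \<open>For \<open>s \<le> V - \<epsilon>\<close> the ratio of \<open>s\<close> to \<open>min s (V - (s + h))\<close> is at most \<open>(V - \<epsilon>) / (\<epsilon> - h)\<close>, by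
  monotonicity if the minimum is \<open>V - (s + h)\<close> and because \<open>\<epsilon> < V / 2\<close> otherwise.\<close>

lemma weighted_difference_quotient_le:
  assumes \<epsilon>: "0 < h" "h < \<epsilon>" "\<epsilon> < V / 2" and s: "0 < s" "s \<le> V - \<epsilon>"
  shows "0 \<le> (r s - r (s + h)) / h * s powr p / (Q * ((V - \<epsilon>) / (\<epsilon> - h)) powr p) \<and>
    (r s - r (s + h)) / h * s powr p / (Q * ((V - \<epsilon>) / (\<epsilon> - h)) powr p)
      \<le> measure grad_measure {x \<in> \<Omega>. r (s + h) < u x \<and> u x < r s} / h"
proof -
  define m where "m = measure grad_measure {x \<in> \<Omega>. r (s + h) < u x \<and> u x < r s}"
  define K where "K = ((V - \<epsilon>) / (\<epsilon> - h)) powr p"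
  have sh: "0 < s" "s \<le> s + h" "s + h < V"
    using assms by auto
  have K: "K > 0"
    using assms by (simp add: K_def)
  have "s / min s (V - (s + h)) \<le> (V - \<epsilon>) / (\<epsilon> - h)"
  proof (cases "s \<le> V - (s + h)")
    case True
    then show ?thesis
      using assms by (simp add: field_simps)
  next
    case False
    have "s / (V - (s + h)) \<le> (V - \<epsilon>) / (\<epsilon> - h)"
      using assms by (intro frac_le) auto
    then show ?thesis
      using False by (simp add: min_def)
  qed
  then have "(s / min s (V - (s + h))) powr p \<le> K"
    unfolding K_def using p sh by (intro powr_mono2) auto
  then have "s powr p \<le> K * profile s (s + h)"
    using sh by (simp add: profile_def powr_divide divide_le_eq)
  then have "s powr p * (r s - r (s + h)) \<le> K * profile s (s + h) * (r s - r (s + h))"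
    using r_antimono[OF sh] by (intro mult_right_mono) auto
  also have "\<dots> \<le> K * (Q * m)"
    unfolding mult.assoc m_def using K by (intro mult_left_mono rearrangement_increment_le sh) simp
  finally have "(r s - r (s + h)) * s powr p \<le> (Q * K) * m"
    by (simp add: mult_ac)
  then have "(r s - r (s + h)) * s powr p / (Q * K) \<le> m"
    using K Q by (simp add: divide_le_eq mult.commute)
  then have "(r s - r (s + h)) * s powr p / (Q * K) / h \<le> m / h"
    using assms by (intro divide_right_mono) auto
  moreover have "0 \<le> (r s - r (s + h)) * s powr p / (Q * K) / h"
    using r_antimono[OF sh] Q K assms by (intro divide_nonneg_nonneg mult_nonneg_nonneg) auto
  ultimately show ?thesis
    unfolding m_def[symmetric] K_def[symmetric] by (simp add: mult_ac)
qed

text \<open>Difference quotients of \<open>- r\<close> are Steklov averages of its density and converge almost everywhere along a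
  sequence of steps; Fatou's lemma passes the bound for the quotients to the limit. This is done on
  \<open>[c, V - \<epsilon>]\<close>, where the density is integrable, and then \<open>c\<close> tends to \<open>0\<close>.\<close>

lemma weighted_slope_modular_le:
  assumes A: "N_function A" and k: "k > 0" and \<epsilon>: "0 < \<epsilon>" "\<epsilon> < V / 2"
  shows "(\<integral>\<^sup>+s. ennreal (A (weighted_slope \<epsilon> s / k)) * indicator {0<..V - \<epsilon>} s \<partial>lborel)
    \<le> (\<integral>\<^sup>+x. ennreal (A (norm (g x) / k)) \<partial>lborel)"
proof -
  let ?M = "\<integral>\<^sup>+x. ennreal (A (norm (g x) / k)) \<partial>lborel"
  note [measurable] = N_function_extend(3)[OF A]
  have ws_nonneg: "0 \<le> weighted_slope \<epsilon> s" for s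
    unfolding weighted_slope_def using Q slope_density_nonneg by (intro divide_nonneg_nonneg mult_nonneg_nonneg) auto
  have [measurable]: "weighted_slope \<epsilon> \<in> borel_measurable borel"
    unfolding weighted_slope_def[abs_def] by measurable
  have A_ws: "A (weighted_slope \<epsilon> s / k) = A \<bar>weighted_slope \<epsilon> s / k\<bar>" for s
    using ws_nonneg[of s] k by simp
  have A_ws_meas [measurable]: "(\<lambda>s. A (weighted_slope \<epsilon> s / k)) \<in> borel_measurable borel"
    unfolding A_ws by measurable
  have interval: "(\<integral>\<^sup>+s. ennreal (A (weighted_slope \<epsilon> s / k)) * indicator {c..V - \<epsilon>} s \<partial>lborel) \<le> ?M"
    if c: "0 < c" "c \<le> V - \<epsilon>" for c
  proof -
    \<comment> \<open>Steps of length at most \<open>\<epsilon> / 2\<close> that start in \<open>[c, V - \<epsilon>]\<close> end before \<open>d\<close>.\<close>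
    define d where "d = V - \<epsilon> / 2"
    have d: "c \<le> d" "d < V"
      using c \<epsilon> by (auto simp: d_def)
    define f where "f \<sigma> = indicator {c..d} \<sigma> * slope_density \<sigma>" for \<sigma> :: real
    have f: "integrable lborel f"
      unfolding f_def by (rule slope_density_integrable[OF c(1) d])
    define h' where "h' n = (\<epsilon> / 2) * inverse (real (Suc n))" for n
    have h': "0 < h' n" "h' n \<le> \<epsilon> / 2" for n
      using \<epsilon>(1) by (auto simp: h'_def field_simps)
    have h'_lim: "h' \<longlonglongrightarrow> 0"
      unfolding h'_def using tendsto_mult_left[OF LIMSEQ_inverse_real_of_nat, of "\<epsilon> / 2"] by simp
    have "(\<lambda>n. \<integral>s. norm (steklov (h' n) f s - f s) \<partial>lborel) \<longlonglongrightarrow> 0"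
      using steklov_tendsto_L1[OF f h'_lim] by simp
    moreover have "integrable lborel (\<lambda>s. steklov (h' n) f s - f s)" for n
      using integrable_steklov[OF f] f by simp
    ultimately obtain \<rho> where \<rho>: "strict_mono \<rho>" "AE s in lborel. (\<lambda>n. steklov (h' (\<rho> n)) f s - f s) \<longlonglongrightarrow> 0"
      using tendsto_L1_AE_subseq[of lborel "\<lambda>n s. steklov (h' n) f s - f s"] by blast
    define h where "h n = h' (\<rho> n)" for n
    have h: "0 < h n" "h n \<le> \<epsilon> / 2" for n
      using h' by (auto simp: h_def)
    have h_lim: "h \<longlonglongrightarrow> 0"
      using LIMSEQ_subseq_LIMSEQ[OF h'_lim \<rho>(1)] by (simp add: h_def[abs_def] comp_def)
    define K where "K n = Q * ((V - \<epsilon>) / (\<epsilon> - h n)) powr p" for n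
    have K_lim: "K \<longlonglongrightarrow> Q * ((V - \<epsilon>) / (\<epsilon> - 0)) powr p"
      unfolding K_def using \<epsilon> by (intro tendsto_intros h_lim) auto
    define \<theta> where "\<theta> n s = steklov (h n) f s * s powr p / K n" for n s
    have [measurable]: "\<theta> n \<in> borel_measurable borel" for n
      unfolding \<theta>_def[abs_def] using integrable_steklov[OF f, of "h n"] by (auto dest!: borel_measurable_integrable)
    have st: "steklov (h n) f s = (r s - r (s + h n)) / h n" if "s \<in> {c..V - \<epsilon>}" for n s
      unfolding f_def[abs_def] using that h[of n] c(1) d
      by (intro steklov_slope_density) (auto simp: d_def)
    have \<theta>_bounds: "0 \<le> \<theta> n s \<and> \<theta> n s \<le> measure grad_measure {x \<in> \<Omega>. r (s + h n) < u x \<and> u x < r s} / h n"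
      if "c \<le> s" "s \<le> V - \<epsilon>" for n s
      unfolding \<theta>_def K_def using weighted_difference_quotient_le[of "h n" \<epsilon> s] h[of n] \<epsilon> c that
      by (subst (1 2) st) auto
    have step: "(\<integral>\<^sup>+s. ennreal (A (\<theta> n s / k)) * indicator {c..V - \<epsilon>} s \<partial>lborel) \<le> ?M" for n
      using \<theta>_bounds[of _ n] h[of n] \<epsilon> c by (intro averaged_gradient_modular_le[OF A k h(1)[of n]]) auto
    have A_\<theta>: "ennreal (A (\<theta> n s / k)) * indicator {c..V - \<epsilon>} s = ennreal (A \<bar>\<theta> n s / k\<bar>) * indicator {c..V - \<epsilon>} s" for n s
      using \<theta>_bounds[of s n] k by (auto simp: indicator_def)
    have ae: "AE s in lborel. (\<lambda>n. ennreal (A \<bar>\<theta> n s / k\<bar>) * indicator {c..V - \<epsilon>} s) \<longlonglongrightarrow>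
        ennreal (A (weighted_slope \<epsilon> s / k)) * indicator {c..V - \<epsilon>} s"
      using \<rho>(2)
    proof eventually_elim
      case (elim s)
      show ?case
      proof (cases "s \<in> {c..V - \<epsilon>}")
        case True
        have "(\<lambda>n. steklov (h n) f s) \<longlonglongrightarrow> f s"
          using elim unfolding h_def by (rule LIM_zero_cancel)
        moreover have "f s = slope_density s"
          using True \<epsilon> by (simp add: f_def d_def)
        ultimately have "(\<lambda>n. \<theta> n s / k) \<longlonglongrightarrow> slope_density s * s powr p / (Q * ((V - \<epsilon>) / (\<epsilon> - 0)) powr p) / k"
          unfolding \<theta>_def using k Q \<epsilon> by (intro tendsto_intros K_lim) auto
        then have "(\<lambda>n. \<theta> n s / k) \<longlonglongrightarrow> weighted_slope \<epsilon> s / k"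
          by (simp add: weighted_slope_def)
        then have "(\<lambda>n. A \<bar>\<theta> n s / k\<bar>) \<longlonglongrightarrow> A \<bar>weighted_slope \<epsilon> s / k\<bar>"
          by (intro N_function_tendsto[OF A] tendsto_rabs) auto
        then show ?thesis
          using True by (simp add: A_ws)
      qed simp
    qed
    have "(\<integral>\<^sup>+s. ennreal (A (weighted_slope \<epsilon> s / k)) * indicator {c..V - \<epsilon>} s \<partial>lborel)
        = (\<integral>\<^sup>+s. liminf (\<lambda>n. ennreal (A \<bar>\<theta> n s / k\<bar>) * indicator {c..V - \<epsilon>} s) \<partial>lborel)"
      using ae by (intro nn_integral_cong_AE, eventually_elim) (simp add: tendsto_iff_Liminf_eq_Limsup)
    also have "\<dots> \<le> liminf (\<lambda>n. \<integral>\<^sup>+s. ennreal (A \<bar>\<theta> n s / k\<bar>) * indicator {c..V - \<epsilon>} s \<partial>lborel)"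
      by (intro nn_integral_liminf) measurable
    also have "\<dots> \<le> ?M"
      using step unfolding A_\<theta> by (intro Liminf_le) (auto intro: always_eventually)
    finally show ?thesis .
  qed
  define c where "c n = (V - \<epsilon>) / (2 + real n)" for n
  have c: "0 < c n" "c n \<le> V - \<epsilon>" for n
  proof -
    show "0 < c n"
      using \<epsilon> by (simp add: c_def)
    have "(V - \<epsilon>) / (2 + real n) \<le> (V - \<epsilon>) / 1"
      using \<epsilon> by (intro divide_left_mono) auto
    then show "c n \<le> V - \<epsilon>"
      by (simp add: c_def)
  qed
  have "(\<integral>\<^sup>+s. ennreal (A (weighted_slope \<epsilon> s / k)) * indicator {0<..V - \<epsilon>} s \<partial>lborel)
      = (\<integral>\<^sup>+s. (SUP n. ennreal (A (weighted_slope \<epsilon> s / k)) * indicator {c n..V - \<epsilon>} s) \<partial>lborel)"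
  proof (intro nn_integral_cong)
    fix s
    have "(\<lambda>n. ennreal (A (weighted_slope \<epsilon> s / k)) * indicator {c n..V - \<epsilon>} s)
        \<longlonglongrightarrow> ennreal (A (weighted_slope \<epsilon> s / k)) * indicator {0<..V - \<epsilon>} s"
    proof (cases "0 < s")
      case True
      have "c \<longlonglongrightarrow> 0"
        unfolding c_def by (intro tendsto_divide_0[OF tendsto_const] filterlim_at_top_imp_at_infinity
          filterlim_tendsto_add_at_top[OF tendsto_const] filterlim_real_sequentially)
      then have "\<forall>\<^sub>F n in sequentially. c n < s"
        using True by (intro order_tendstoD) auto
      then have "\<forall>\<^sub>F n in sequentially. ennreal (A (weighted_slope \<epsilon> s / k)) * indicator {c n..V - \<epsilon>} s
          = ennreal (A (weighted_slope \<epsilon> s / k)) * indicator {0<..V - \<epsilon>} s"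
        by eventually_elim (use True in \<open>auto simp: indicator_def\<close>)
      then show ?thesis
        by (rule tendsto_eventually)
    next
      case False
      then have "s \<notin> {c n..V - \<epsilon>}" for n
        using c(1)[of n] by auto
      then show ?thesis
        using False by simp
    qed
    moreover have "incseq (\<lambda>n. ennreal (A (weighted_slope \<epsilon> s / k)) * indicator {c n..V - \<epsilon>} s)"
    proof (rule incseq_SucI)
      fix n
      have "c (Suc n) \<le> c n"
        unfolding c_def using \<epsilon> by (intro divide_left_mono) auto
      then show "ennreal (A (weighted_slope \<epsilon> s / k)) * indicator {c n..V - \<epsilon>} s
          \<le> ennreal (A (weighted_slope \<epsilon> s / k)) * indicator {c (Suc n)..V - \<epsilon>} s"
        by (auto simp: indicator_def)
    qed
    ultimately show "ennreal (A (weighted_slope \<epsilon> s / k)) * indicator {0<..V - \<epsilon>} s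
        = (SUP n. ennreal (A (weighted_slope \<epsilon> s / k)) * indicator {c n..V - \<epsilon>} s)"
      using LIMSEQ_unique LIMSEQ_SUP by blast
  qed
  also have "\<dots> = (SUP n. \<integral>\<^sup>+s. ennreal (A (weighted_slope \<epsilon> s / k)) * indicator {c n..V - \<epsilon>} s \<partial>lborel)"
  proof (rule nn_integral_monotone_convergence_SUP)
    show "incseq (\<lambda>n s. ennreal (A (weighted_slope \<epsilon> s / k)) * indicator {c n..V - \<epsilon>} s)"
    proof (rule incseq_SucI, rule le_funI)
      fix n s
      have "c (Suc n) \<le> c n"
        unfolding c_def using \<epsilon> by (intro divide_left_mono) auto
      then show "ennreal (A (weighted_slope \<epsilon> s / k)) * indicator {c n..V - \<epsilon>} s
          \<le> ennreal (A (weighted_slope \<epsilon> s / k)) * indicator {c (Suc n)..V - \<epsilon>} s"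
        by (auto simp: indicator_def)
    qed
  qed measurable
  also have "\<dots> \<le> ?M"
    by (intro SUP_least interval c)
  finally show ?thesis .
qed

end

section \<open>Radial functions\<close>

text \<open>The measure of the ball centred at the origin whose boundary contains \<open>x\<close>.\<close>

definition radial_volume :: "'a::euclidean_space \<Rightarrow> real" where
  "radial_volume x = ball_const TYPE('a) * norm x ^ DIM('a)"

lemma ball_const_pos: "ball_const TYPE('a::euclidean_space) > 0"
  by (simp add: ball_const_def content_ball)

lemma radial_volume_nonneg: "0 \<le> radial_volume x"
  unfolding radial_volume_def using ball_const_pos[where 'a = 'a] by simp

lemma radial_volume_0_iff: "radial_volume (x::'a::euclidean_space) = 0 \<longleftrightarrow> x = 0"
  unfolding radial_volume_def using ball_const_pos[where 'a = 'a] by simp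

lemma continuous_radial_volume: "continuous_on S radial_volume"
  unfolding radial_volume_def[abs_def] by (intro continuous_intros)

lemma radial_volume_borel [measurable]: "radial_volume \<in> borel_measurable borel"
  using continuous_radial_volume by (rule borel_measurable_continuous_onI)

lemma mem_ball_of_measure:
  fixes x :: "'a::euclidean_space"
  assumes "0 \<le> m"
  shows "x \<in> ball_of_measure m \<longleftrightarrow> radial_volume x < m"
proof -
  let ?c = "ball_const TYPE('a)" and ?n = "DIM('a)"
  define \<rho> where "\<rho> = (m / ?c) powr (1 / ?n)"
  have c: "?c > 0"
    by (rule ball_const_pos)
  have n: "?n > 0"
    by simp
  have \<rho>0: "0 \<le> \<rho>"
    by (simp add: \<rho>_def)
  have \<rho>n: "\<rho> ^ ?n = m / ?c"
  proof (cases "m = 0")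
    case True
    then show ?thesis by (simp add: \<rho>_def)
  next
    case False
    define q where "q = m / ?c"
    have "q > 0"
      using False assms c by (simp add: q_def)
    then have "(q powr (1 / ?n)) ^ ?n = q"
      by (simp add: powr_powr flip: powr_realpow)
    then show ?thesis
      by (simp add: \<rho>_def q_def)
  qed
  have "x \<in> ball_of_measure m \<longleftrightarrow> norm x < \<rho>"
    by (simp add: ball_of_measure_def \<rho>_def)
  also have "\<dots> \<longleftrightarrow> norm x ^ ?n < \<rho> ^ ?n"
    using power_mono_iff[OF \<rho>0 norm_ge_zero n, of x] by (simp add: not_le[symmetric])
  also have "\<dots> \<longleftrightarrow> radial_volume x < m"
    unfolding \<rho>n radial_volume_def using c by (simp add: less_divide_eq mult.commute)
  finally show ?thesis .
qed

lemma emeasure_radial_volume_less: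
  assumes "0 \<le> m"
  shows "emeasure lborel {x::'a::euclidean_space. radial_volume x < m} = ennreal m"
proof -
  have eq: "{x::'a. radial_volume x < m} = ball_of_measure m"
    using mem_ball_of_measure[OF assms] by auto
  have b: "(ball_of_measure m :: 'a set) \<in> sets borel"
    unfolding ball_of_measure_def by simp
  have "emeasure lborel (ball_of_measure m :: 'a set) = ennreal (measure lborel (ball_of_measure m :: 'a set))"
    unfolding ball_of_measure_def using emeasure_lborel_ball_finite
    by (intro emeasure_eq_ennreal_measure) (simp add: less_top)
  also have "measure lborel (ball_of_measure m :: 'a set) = measure lebesgue (ball_of_measure m :: 'a set)"
    by (rule measure_completion[symmetric]) (use b in simp)
  also have "\<dots> = m"
    by (rule measure_ball_of_measure[OF assms])
  finally show ?thesis
    unfolding eq .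
qed

text \<open>The sublevel sets of the radial volume are balls, and their measures are the levels.\<close>

lemma distr_radial_volume:
  "distr (lborel :: 'a::euclidean_space measure) borel radial_volume = density lborel (indicator {0..})"
proof (rule measure_eqI_generator_eq[where E = "range (\<lambda>a::real. {..<a})" and \<Omega> = UNIV and A = "\<lambda>i. {..<real i}"])
  have e1: "emeasure (distr (lborel :: 'a measure) borel radial_volume) {..<a} = ennreal (max 0 a)" for a
  proof (cases "a \<ge> 0")
    case True
    then show ?thesis
      by (subst emeasure_distr) (auto simp: emeasure_radial_volume_less vimage_def)
  next
    case False
    have "\<not> radial_volume x < a" for x :: 'a
      using radial_volume_nonneg[of x] False by linarith
    then have "radial_volume -` {..<a} = ({} :: 'a set)"
      by blast
    then show ?thesis
      using False by (subst emeasure_distr) (auto simp: max_def)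
  qed
  have e2: "emeasure (density lborel (indicator {0..})) {..<a::real} = ennreal (max 0 a)" for a
  proof -
    have "indicator {0..} s * indicator {..<a} s = (indicator {0..<a} s :: ennreal)" for s
      by (simp add: indicator_def)
    then have "emeasure (density lborel (indicator {0..})) {..<a} = (\<integral>\<^sup>+s. indicator {0..<a} s \<partial>lborel)"
      by (subst emeasure_density) simp_all
    then show ?thesis
      by (cases "a \<ge> 0") (auto simp: max_def)
  qed
  show "Int_stable (range (\<lambda>a::real. {..<a}))"
    unfolding Int_stable_def
  proof (clarify)
    fix a b :: real
    have "{..<a} \<inter> {..<b} = {..<min a b}" by auto
    then show "{..<a} \<inter> {..<b} \<in> range lessThan" by simp
  qed
  show "emeasure (distr (lborel :: 'a measure) borel radial_volume) X = emeasure (density lborel (indicator {0..})) X"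
    if "X \<in> range (\<lambda>a::real. {..<a})" for X
    using that e1 e2 by auto
  show "sets (distr (lborel :: 'a measure) borel radial_volume) = sigma_sets UNIV (range (\<lambda>a::real. {..<a}))"
    "sets (density lborel (indicator {0..})) = sigma_sets UNIV (range (\<lambda>a::real. {..<a}))"
    using arg_cong[OF borel_Iio, of sets] by simp_all
  show "(\<Union>i. {..<real i}) = UNIV"
    using reals_Archimedean2 by auto
  show "emeasure (distr (lborel :: 'a measure) borel radial_volume) {..<real i} \<noteq> \<infinity>" for i
    by (simp add: e1)
qed auto

lemma nn_integral_radial_volume:
  assumes [measurable]: "F \<in> borel_measurable borel"
  shows "(\<integral>\<^sup>+x. F (radial_volume x) \<partial>(lborel :: 'a::euclidean_space measure)) = (\<integral>\<^sup>+s. F s * indicator {0..} s \<partial>lborel)"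
proof -
  have "(\<integral>\<^sup>+x. F (radial_volume x) \<partial>(lborel :: 'a measure)) = (\<integral>\<^sup>+s. F s \<partial>distr (lborel :: 'a measure) borel radial_volume)"
    by (rule nn_integral_distr[symmetric]) simp_all
  also have "\<dots> = (\<integral>\<^sup>+s. F s * indicator {0..} s \<partial>lborel)"
    unfolding distr_radial_volume by (subst nn_integral_density) (simp_all add: mult.commute)
  finally show ?thesis .
qed

lemma integrable_radial_volume:
  fixes F :: "real \<Rightarrow> real"
  assumes F: "integrable lborel F"
  shows "integrable lborel (\<lambda>x::'a::euclidean_space. F (radial_volume x))"
    and "(\<integral>x. \<bar>F (radial_volume x)\<bar> \<partial>(lborel :: 'a measure)) \<le> (\<integral>s. \<bar>F s\<bar> \<partial>lborel)"
proof -
  have [measurable]: "F \<in> borel_measurable borel"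
    using F by auto
  have fin: "(\<integral>\<^sup>+s. ennreal \<bar>F s\<bar> \<partial>lborel) = ennreal (\<integral>s. \<bar>F s\<bar> \<partial>lborel)"
    using F by (intro nn_integral_eq_integral) auto
  have le: "(\<integral>\<^sup>+x. ennreal \<bar>F (radial_volume x)\<bar> \<partial>(lborel :: 'a measure)) \<le> ennreal (\<integral>s. \<bar>F s\<bar> \<partial>lborel)"
    unfolding fin[symmetric] by (subst nn_integral_radial_volume[of "\<lambda>s. ennreal \<bar>F s\<bar>"])
      (auto intro!: nn_integral_mono simp: indicator_def)
  show i: "integrable lborel (\<lambda>x::'a. F (radial_volume x))"
    using le by (intro integrableI_bounded) (auto simp: top_unique less_top[symmetric])
  have "ennreal (\<integral>x. \<bar>F (radial_volume x)\<bar> \<partial>(lborel :: 'a measure)) \<le> ennreal (\<integral>s. \<bar>F s\<bar> \<partial>lborel)"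
    using le i by (subst nn_integral_eq_integral[symmetric]) auto
  then show "(\<integral>x. \<bar>F (radial_volume x)\<bar> \<partial>(lborel :: 'a measure)) \<le> (\<integral>s. \<bar>F s\<bar> \<partial>lborel)"
    by (simp add: integral_nonneg_AE)
qed

text \<open>The classical gradient of \<open>radial_volume\<close>.\<close>

definition radial_gradient :: "'a::euclidean_space \<Rightarrow> 'a" where
  "radial_gradient x = (DIM('a) * ball_const TYPE('a) * norm x ^ (DIM('a) - 2)) *\<^sub>R x"

text \<open>Dimension one is excluded because \<open>|x|\<close> is not differentiable at the origin; from dimension two on,
  \<open>|x|\<^sup>n\<close> is \<open>o(|x|)\<close> there.\<close>

lemma radial_volume_has_derivative:
  fixes x :: "'a::euclidean_space"
  assumes "DIM('a) \<ge> 2"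
  shows "(radial_volume has_derivative (\<lambda>v. radial_gradient x \<bullet> v)) (at x)"
proof (cases "x = 0")
  case True
  have "((\<lambda>h::'a. ball_const TYPE('a) * norm h ^ (DIM('a) - 1)) \<longlongrightarrow> ball_const TYPE('a) * norm (0::'a) ^ (DIM('a) - 1)) (at 0)"
    by (intro tendsto_intros)
  then have lim: "((\<lambda>h::'a. ball_const TYPE('a) * norm h ^ (DIM('a) - 1)) \<longlongrightarrow> 0) (at 0)"
    using assms by (simp add: power_0_left)
  have "((\<lambda>h::'a. norm (radial_volume (0 + h) - radial_volume (0::'a) - 0) / norm h) \<longlongrightarrow> 0) (at 0)"
  proof (rule Lim_transform_eventually[OF lim])
    have pow: "norm h ^ DIM('a) = norm h ^ (DIM('a) - 1) * norm h" for h :: 'a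
      using assms by (simp flip: power_Suc2)
    have "ball_const TYPE('a) * norm h ^ (DIM('a) - 1)
        = norm (radial_volume (0 + h) - radial_volume (0::'a) - 0) / norm h" if "h \<noteq> 0" for h :: 'a
    proof -
      have "norm (radial_volume (0 + h) - radial_volume (0::'a) - 0) = radial_volume h"
        using radial_volume_nonneg[of h] by (simp add: radial_volume_0_iff[THEN iffD2])
      then show ?thesis
        using that pow[of h] by (simp add: radial_volume_def)
    qed
    then show "\<forall>\<^sub>F h::'a in at 0. ball_const TYPE('a) * norm h ^ (DIM('a) - 1)
        = norm (radial_volume (0 + h) - radial_volume (0::'a) - 0) / norm h"
      by (simp only: eventually_at_filter) (rule always_eventually, blast)
  qed
  then have "(radial_volume has_derivative (\<lambda>v::'a. 0)) (at 0)"
    by (subst has_derivative_at) simp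
  then show ?thesis
    using True by (simp add: radial_gradient_def)
next
  case False
  have "((\<lambda>x. norm x ^ DIM('a)) has_derivative (\<lambda>v. DIM('a) * (sgn x \<bullet> v) * norm x ^ (DIM('a) - 1))) (at x)"
    using has_derivative_power[OF has_derivative_norm[OF False], of "DIM('a)"]
    by (simp add: inner_commute)
  then have "(radial_volume has_derivative (\<lambda>v. ball_const TYPE('a) * (DIM('a) * (sgn x \<bullet> v) * norm x ^ (DIM('a) - 1)))) (at x)"
    unfolding radial_volume_def[abs_def] by (rule has_derivative_mult_right)
  moreover have "norm x ^ (DIM('a) - 1) = norm x ^ (DIM('a) - 2) * norm x"
  proof -
    have "DIM('a) - 1 = Suc (DIM('a) - 2)"
      using assms by simp
    then show ?thesis by simp
  qed
  ultimately show ?thesis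
    using False by (simp add: radial_gradient_def sgn_div_norm field_simps)
qed

lemma continuous_radial_gradient: "continuous_on S radial_gradient"
  unfolding radial_gradient_def[abs_def] by (intro continuous_intros)

lemma radial_gradient_borel [measurable]: "radial_gradient \<in> borel_measurable borel"
  using continuous_radial_gradient by (rule borel_measurable_continuous_onI)

lemma norm_radial_gradient:
  fixes x :: "'a::euclidean_space"
  assumes "DIM('a) \<ge> 2"
  shows "norm (radial_gradient x) = DIM('a) * ball_const TYPE('a) powr (1 / DIM('a))
    * radial_volume x powr (1 - 1 / DIM('a))"
proof (cases "x = 0")
  case True
  then show ?thesis
    by (simp add: radial_gradient_def radial_volume_def)
next
  case False
  let ?c = "ball_const TYPE('a)" and ?n = "real DIM('a)"
  have c: "?c > 0"
    by (rule ball_const_pos)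
  have "norm x ^ (DIM('a) - 2) * norm x = norm x ^ (DIM('a) - 1)"
  proof -
    have "DIM('a) - 1 = Suc (DIM('a) - 2)"
      using assms by simp
    then show ?thesis by simp
  qed
  then have 1: "norm (radial_gradient x) = ?n * ?c * norm x ^ (DIM('a) - 1)"
    using c by (simp add: radial_gradient_def)
  have "radial_volume x powr (1 - 1 / ?n) = ?c powr (1 - 1 / ?n) * (norm x ^ DIM('a)) powr (1 - 1 / ?n)"
    unfolding radial_volume_def using c by (simp add: powr_mult)
  also have "(norm x ^ DIM('a)) powr (1 - 1 / ?n) = norm x powr (?n * (1 - 1 / ?n))"
    using False by (simp add: powr_powr flip: powr_realpow)
  also have "?n * (1 - 1 / ?n) = real (DIM('a) - 1)"
    using assms by (simp add: field_simps of_nat_diff)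
  also have "norm x powr real (DIM('a) - 1) = norm x ^ (DIM('a) - 1)"
    using False by (intro powr_realpow) simp
  finally have 2: "radial_volume x powr (1 - 1 / ?n) = ?c powr (1 - 1 / ?n) * norm x ^ (DIM('a) - 1)" .
  have "?c powr (1 / ?n) * ?c powr (1 - 1 / ?n) = ?c"
    using c by (simp flip: powr_add)
  then show ?thesis
    unfolding 1 2 by (metis mult.assoc)
qed

text \<open>In one dimension the averages over the segments of length \<open>h\<close> from \<open>s\<close> and from \<open>s + z\<close> differ by at most
  \<open>translation_modulus f z / h\<close>.\<close>

lemma continuous_steklov:
  fixes f :: "real \<Rightarrow> real"
  assumes f: "integrable lborel f" and h: "h > 0"
  shows "continuous_on UNIV (steklov h f)"
proof (rule continuous_at_imp_continuous_on, rule ballI)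
  fix s
  have [measurable]: "f \<in> borel_measurable borel"
    using f by auto
  have i: "integrable lborel (\<lambda>t. f (y + h * t))" for y
    using lborel_integrable_real_affine[OF f, of h y] h by simp
  have bound: "\<bar>steklov h f (s + z) - steklov h f s\<bar> \<le> translation_modulus f z / h" for z
  proof -
    have i1: "integrable lborel (\<lambda>t. indicator {0..1} t * f (y + t *\<^sub>R h))" for y
      using integrable_real_mult_indicator[OF _ i[of y], of "{0..1}"] by (simp add: mult.commute)
    have eq: "steklov h f (s + z) - steklov h f s
        = (\<integral>t. indicator {0..1} t * f (s + z + t *\<^sub>R h) - indicator {0..1} t * f (s + t *\<^sub>R h) \<partial>lborel)"
      unfolding steklov_def by (rule Bochner_Integration.integral_diff[OF i1 i1, symmetric])
    have "\<bar>steklov h f (s + z) - steklov h f s\<bar> \<le> (\<integral>t. \<bar>f (s + h * t + z) - f (s + h * t)\<bar> \<partial>lborel)"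
      unfolding eq
    proof (rule integral_abs_bound_integral)
      show "integrable lborel (\<lambda>t. indicator {0..1} t * f (s + z + t *\<^sub>R h) - indicator {0..1} t * f (s + t *\<^sub>R h))"
        by (rule Bochner_Integration.integrable_diff[OF i1 i1])
      show "integrable lborel (\<lambda>t. \<bar>f (s + h * t + z) - f (s + h * t)\<bar>)"
        using i[of "s + z"] i[of s] by (auto simp: algebra_simps intro!: integrable_abs)
    qed (auto simp: indicator_def algebra_simps)
    also have "\<dots> = translation_modulus f z / h"
    proof -
      have "translation_modulus f z = \<bar>h\<bar> *\<^sub>R (\<integral>t. \<bar>f (s + h * t + z) - f (s + h * t)\<bar> \<partial>lborel)"
        unfolding translation_modulus_def using h by (intro lborel_integral_real_affine) simp
      then show ?thesis
        using h by simp
    qed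
    finally show ?thesis .
  qed
  show "isCont (steklov h f) s"
    unfolding continuous_at_sequentially
  proof (intro allI impI)
    fix y :: "nat \<Rightarrow> real" assume "y \<longlonglongrightarrow> s"
    then have "(\<lambda>n. y n - s) \<longlonglongrightarrow> 0"
      by (rule LIM_zero)
    from tendsto_divide[OF translation_modulus_tendsto[OF f this] tendsto_const, of h] h
    have lim: "(\<lambda>n. translation_modulus f (y n - s) / h) \<longlonglongrightarrow> 0"
      by simp
    have "(\<lambda>n. steklov h f (y n) - steklov h f s) \<longlonglongrightarrow> 0"
      by (rule Lim_null_comparison[OF _ lim]) (use bound[of "y _ - s"] in auto)
    then show "(steklov h f \<circ> y) \<longlonglongrightarrow> steklov h f s"
      unfolding comp_def by (rule LIM_zero_cancel)
  qed
qed

lemma integrable_continuous_times_test: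
  fixes \<phi> \<psi> :: "'a::euclidean_space \<Rightarrow> real"
  assumes \<phi>: "\<phi> \<in> C1_compact_support W" and \<psi>: "continuous_on UNIV \<psi>"
  shows "integrable lborel (\<lambda>x. \<psi> x * \<phi> x)"
    and "integrable lborel (\<lambda>x. \<psi> x * frechet_derivative \<phi> (at x) b)"
proof -
  define K where "K = closure {x. \<phi> x \<noteq> 0}"
  note K = C1_compact_support_support[OF \<phi>, folded K_def]
  have "integrable lborel (\<lambda>x. indicator K x *\<^sub>R (\<psi> x * \<phi> x))"
    using \<psi> C1_compact_support_derivative(3)[OF \<phi>]
    by (intro borel_integrable_compact K continuous_intros) (auto intro: continuous_on_subset)
  moreover have "(\<lambda>x. indicator K x *\<^sub>R (\<psi> x * \<phi> x)) = (\<lambda>x. \<psi> x * \<phi> x)"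
  proof
    show "indicator K x *\<^sub>R (\<psi> x * \<phi> x) = \<psi> x * \<phi> x" for x
      using K(3)[of x] by (cases "x \<in> K") auto
  qed
  ultimately show "integrable lborel (\<lambda>x. \<psi> x * \<phi> x)"
    by (simp only:)
  have "integrable lborel (\<lambda>x. indicator K x *\<^sub>R (\<psi> x * frechet_derivative \<phi> (at x) b))"
    using \<psi> C1_compact_support_derivative(2)[OF \<phi>]
    by (intro borel_integrable_compact K continuous_intros) (auto intro: continuous_on_subset)
  moreover have "(\<lambda>x. indicator K x *\<^sub>R (\<psi> x * frechet_derivative \<phi> (at x) b))
      = (\<lambda>x. \<psi> x * frechet_derivative \<phi> (at x) b)"
  proof
    show "indicator K x *\<^sub>R (\<psi> x * frechet_derivative \<phi> (at x) b) = \<psi> x * frechet_derivative \<phi> (at x) b" for x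
      using K(4)[of x b] by (cases "x \<in> K") auto
  qed
  ultimately show "integrable lborel (\<lambda>x. \<psi> x * frechet_derivative \<phi> (at x) b)"
    by (simp only:)
qed

text \<open>The product of \<open>F(c\<^sub>n|x|\<^sup>n)\<close> and \<open>\<phi>\<close> has compact support, so its directional derivative integrates to
  \<open>0\<close>.\<close>

lemma radial_parts_C1:
  fixes \<phi> :: "'a::euclidean_space \<Rightarrow> real"
  assumes dim: "DIM('a) \<ge> 2" and \<phi>: "\<phi> \<in> C1_compact_support W"
    and F: "\<And>s. 0 \<le> s \<Longrightarrow> (F has_real_derivative F' s) (at s)" and F': "continuous_on {0..} F'"
  shows "(\<integral>x. F (radial_volume x) * frechet_derivative \<phi> (at x) b \<partial>lborel)
    = - (\<integral>x. F' (radial_volume x) * (radial_gradient x \<bullet> b) * \<phi> x \<partial>lborel)"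
proof -
  have cF: "continuous_on {0..} F"
    using F DERIV_isCont by (intro continuous_at_imp_continuous_on) auto
  have c1: "continuous_on UNIV (\<lambda>x::'a. F (radial_volume x))" "continuous_on UNIV (\<lambda>x::'a. F' (radial_volume x))"
    using radial_volume_nonneg
    by (auto intro!: continuous_on_compose2[OF cF] continuous_on_compose2[OF F'] continuous_radial_volume)
  have c2: "continuous_on UNIV (\<lambda>x::'a. F' (radial_volume x) * (radial_gradient x \<bullet> b))"
    by (intro continuous_intros c1 continuous_radial_gradient)
  define K where "K = closure {x. \<phi> x \<noteq> 0}"
  note K = C1_compact_support_support[OF \<phi>, folded K_def]
  obtain R where R: "\<And>x. x \<in> K \<Longrightarrow> norm x \<le> R"
    using compact_imp_bounded[OF K(1)] unfolding bounded_iff by blast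
  let ?\<psi>' = "\<lambda>x. F' (radial_volume x) * (radial_gradient x \<bullet> b) * \<phi> x + F (radial_volume x) * frechet_derivative \<phi> (at x) b"
  have "(\<integral>x. ?\<psi>' x \<partial>lborel) = 0"
  proof (rule integral_directional_derivative_eq_0[where \<psi> = "\<lambda>x. F (radial_volume x) * \<phi> x" and v = b])
    fix x :: 'a
    have 1: "((\<lambda>h. radial_volume (x + h *\<^sub>R b)) has_real_derivative radial_gradient x \<bullet> b) (at 0)"
      using has_derivative_line[of radial_volume _ x 0 b] radial_volume_has_derivative[OF dim, of x] by simp
    have 2: "((\<lambda>h. F (radial_volume (x + h *\<^sub>R b))) has_real_derivative F' (radial_volume x) * (radial_gradient x \<bullet> b)) (at 0)"
    proof (rule DERIV_chain2[OF _ 1])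
      show "(F has_real_derivative F' (radial_volume x)) (at (radial_volume (x + 0 *\<^sub>R b)))"
        using F[OF radial_volume_nonneg, of x] by simp
    qed
    have 3: "((\<lambda>h. \<phi> (x + h *\<^sub>R b)) has_real_derivative frechet_derivative \<phi> (at x) b) (at 0)"
      using has_derivative_line[of \<phi> "frechet_derivative \<phi> (at x)" x 0 b]
        C1_compact_support_derivative(1)[OF \<phi>] by simp
    show "((\<lambda>h. F (radial_volume (x + h *\<^sub>R b)) * \<phi> (x + h *\<^sub>R b)) has_real_derivative ?\<psi>' x) (at 0)"
      using DERIV_mult[OF 2 3] by (simp add: mult_ac add.commute)
  next
    show "continuous_on UNIV ?\<psi>'" "continuous_on UNIV (\<lambda>x. F (radial_volume x) * \<phi> x)"
      by (intro continuous_intros c1 c2 C1_compact_support_derivative[OF \<phi>])+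
    show "F (radial_volume x) * \<phi> x = 0" if "norm x > R" for x
      using K(3)[of x] R[of x] that by force
  qed
  then show ?thesis
    using integrable_continuous_times_test(1)[OF \<phi> c2] integrable_continuous_times_test(2)[OF \<phi> c1(1), of b]
    by (simp add: eq_neg_iff_add_eq_0 add.commute)
qed

text \<open>Steklov averages of \<open>f\<close> are continuous and converge to \<open>f\<close> in \<open>L\<^sup>1\<close>. Their primitives therefore converge
  uniformly, and since \<open>radial_volume\<close> transports Lebesgue measure, the compositions with it converge
  in \<open>L\<^sup>1\<close> as well. The primitive starts at a negative number so that it is differentiable at \<open>0\<close> from
  both sides.\<close>

lemma radial_parts_L1:
  fixes \<phi> :: "'a::euclidean_space \<Rightarrow> real" and f :: "real \<Rightarrow> real"
  assumes dim: "DIM('a) \<ge> 2" and \<phi>: "\<phi> \<in> C1_compact_support W" and f: "integrable lborel f"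
  defines "F \<equiv> \<lambda>s. \<integral>\<sigma>. indicator {-1..s} \<sigma> * f \<sigma> \<partial>lborel"
  shows "(\<integral>x. F (radial_volume x) * frechet_derivative \<phi> (at x) b \<partial>lborel)
    = - (\<integral>x. f (radial_volume x) * (radial_gradient x \<bullet> b) * \<phi> x \<partial>lborel)"
proof -
  have [measurable]: "f \<in> borel_measurable borel"
    using f by auto
  define h where "h n = inverse (real (Suc n))" for n
  have h: "h n > 0" for n
    by (simp add: h_def)
  have h_lim: "h \<longlonglongrightarrow> 0"
    unfolding h_def by (rule LIMSEQ_inverse_real_of_nat)
  define k where "k n = steklov (h n) f" for n
  have ik: "integrable lborel (k n)" for n
    unfolding k_def by (rule integrable_steklov[OF f])
  have [measurable]: "k n \<in> borel_measurable borel" for n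
    using ik[of n] by auto
  have ck: "continuous_on UNIV (k n)" for n
    unfolding k_def by (rule continuous_steklov[OF f h])
  have k_lim: "(\<lambda>n. \<integral>s. \<bar>k n s - f s\<bar> \<partial>lborel) \<longlonglongrightarrow> 0"
    unfolding k_def by (rule steklov_tendsto_L1[OF f h_lim])
  define Fn where "Fn n s = (\<integral>\<sigma>. indicator {-1..s} \<sigma> * k n \<sigma> \<partial>lborel)" for n s
  have iI: "integrable lborel (\<lambda>\<sigma>. indicator {-1..s} \<sigma> * q \<sigma>)" if "integrable lborel q" for s and q :: "real \<Rightarrow> real"
    using integrable_real_mult_indicator[OF _ that, of "{-1..s}"] by (simp add: mult.commute)
  have der: "(Fn n has_real_derivative k n s) (at s)" if "0 \<le> s" for n s
  proof -
    have eq: "Fn n y = integral {-1..y} (k n)" for y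
    proof -
      have "set_integrable lborel {-1..y} (k n)"
        using iI[OF ik[of n], of y] by (simp add: set_integrable_def)
      from set_borel_integral_eq_integral(2)[OF this] show ?thesis
        by (simp add: Fn_def set_lebesgue_integral_def)
    qed
    have "((\<lambda>y. integral {-1..y} (k n)) has_real_derivative k n s) (at s within {-1..s + 1})"
      using that by (intro integral_has_real_derivative continuous_on_subset[OF ck]) auto
    moreover have "at s within {-1..s + 1} = at s"
      using that by (intro at_within_Icc_at) auto
    ultimately show ?thesis
      unfolding eq[abs_def] by simp
  qed
  have parts: "(\<integral>x. Fn n (radial_volume x) * frechet_derivative \<phi> (at x) b \<partial>lborel)
      = - (\<integral>x. k n (radial_volume x) * (radial_gradient x \<bullet> b) * \<phi> x \<partial>lborel)" for n
    by (rule radial_parts_C1[OF dim \<phi> der continuous_on_subset[OF ck]]) auto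
  obtain B where B: "0 \<le> B" "\<And>x. \<bar>\<phi> x\<bar> \<le> B" "\<And>x. \<bar>frechet_derivative \<phi> (at x) b\<bar> \<le> B"
    using C1_compact_support_bounded[OF \<phi>] by metis
  note [measurable] = C1_compact_support_measurable[OF \<phi>]
  have F_diff: "\<bar>Fn n s - F s\<bar> \<le> (\<integral>s. \<bar>k n s - f s\<bar> \<partial>lborel)" for n s
  proof -
    have eq: "Fn n s - F s = (\<integral>\<sigma>. indicator {-1..s} \<sigma> * k n \<sigma> - indicator {-1..s} \<sigma> * f \<sigma> \<partial>lborel)"
      unfolding Fn_def F_def by (rule Bochner_Integration.integral_diff[OF iI[OF ik] iI[OF f], symmetric])
    show ?thesis
      unfolding eq
    proof (rule integral_abs_bound_integral)
      show "integrable lborel (\<lambda>\<sigma>. indicator {-1..s} \<sigma> * k n \<sigma> - indicator {-1..s} \<sigma> * f \<sigma>)"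
        by (rule Bochner_Integration.integrable_diff[OF iI[OF ik] iI[OF f]])
      show "integrable lborel (\<lambda>s. \<bar>k n s - f s\<bar>)"
        using ik[of n] f by simp
    qed (auto simp: indicator_def)
  qed
  have F_lim: "(\<lambda>n. Fn n s) \<longlonglongrightarrow> F s" for s
  proof -
    have "(\<lambda>n. Fn n s - F s) \<longlonglongrightarrow> 0"
      by (rule Lim_null_comparison[OF _ k_lim]) (use F_diff in auto)
    then show ?thesis
      by (rule LIM_zero_cancel)
  qed
  obtain C where C: "\<And>n. \<bar>\<integral>s. \<bar>k n s - f s\<bar> \<partial>lborel\<bar> \<le> C"
    using convergent_imp_Bseq[OF convergentI[OF k_lim]] unfolding Bseq_def by auto
  have F_le: "\<bar>F s\<bar> \<le> (\<integral>s. \<bar>f s\<bar> \<partial>lborel)" for s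
    unfolding F_def
    by (rule integral_abs_bound_integral[OF iI[OF f]])
       (use f in \<open>auto simp: indicator_def\<close>)
  have Fn_le: "\<bar>Fn n s\<bar> \<le> C + (\<integral>s. \<bar>f s\<bar> \<partial>lborel)" for n s
    using F_diff[of n s] F_le[of s] C[of n] by linarith
  have Fn_cont: "continuous_on UNIV (\<lambda>x::'a. Fn n (radial_volume x))" for n
  proof -
    have "continuous_on {0..} (Fn n)"
      using DERIV_isCont[OF der[of _ n]] by (intro continuous_at_imp_continuous_on ballI) simp
    then show ?thesis
      using radial_volume_nonneg by (auto intro!: continuous_on_compose2[of "{0..}" "Fn n"] continuous_radial_volume)
  qed
  have [measurable]: "(\<lambda>x::'a. Fn n (radial_volume x)) \<in> borel_measurable borel" for n
    by (rule borel_measurable_continuous_onI[OF Fn_cont])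
  have [measurable]: "(\<lambda>x::'a. F (radial_volume x)) \<in> borel_measurable borel"
    by (rule borel_measurable_LIMSEQ_real[where u = "\<lambda>n x. Fn n (radial_volume x)"]) (auto intro: F_lim)
  have lim1: "(\<lambda>n. \<integral>x. Fn n (radial_volume x) * frechet_derivative \<phi> (at x) b \<partial>lborel)
      \<longlonglongrightarrow> (\<integral>x. F (radial_volume x) * frechet_derivative \<phi> (at x) b \<partial>lborel)"
  proof (rule integral_dominated_convergence)
    show "integrable lborel (\<lambda>x. (C + (\<integral>s. \<bar>f s\<bar> \<partial>lborel)) * \<bar>frechet_derivative \<phi> (at x) b\<bar>)"
      using integral_derivative_test_function(2)[OF \<phi>] by simp
    show "AE x in lborel. norm (Fn n (radial_volume x) * frechet_derivative \<phi> (at x) b)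
        \<le> (C + (\<integral>s. \<bar>f s\<bar> \<partial>lborel)) * \<bar>frechet_derivative \<phi> (at x) b\<bar>" for n
      unfolding real_norm_def abs_mult by (intro AE_I2 mult_right_mono Fn_le) simp
  qed (auto intro!: tendsto_mult F_lim)
  define K where "K = closure {x. \<phi> x \<noteq> 0}"
  note K = C1_compact_support_support[OF \<phi>, folded K_def]
  define w where "w x = (radial_gradient x \<bullet> b) * \<phi> x" for x
  have w_cont: "continuous_on UNIV w"
    unfolding w_def[abs_def] by (intro continuous_intros continuous_radial_gradient C1_compact_support_derivative[OF \<phi>])
  have w_meas [measurable]: "w \<in> borel_measurable borel"
    using w_cont by (rule borel_measurable_continuous_onI)
  obtain D where D: "0 \<le> D" "\<And>x. \<bar>w x\<bar> \<le> D"
  proof -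
    have "bounded (w ` K)"
      by (intro compact_imp_bounded compact_continuous_image K continuous_on_subset[OF w_cont]) auto
    then obtain D where "\<forall>x\<in>K. \<bar>w x\<bar> \<le> D"
      unfolding bounded_iff by auto
    then have "\<bar>w x\<bar> \<le> max 0 D" for x
      using K(3)[of x] by (cases "x \<in> K") (auto simp: w_def)
    then show thesis
      using that[of "max 0 D"] by simp
  qed
  have lim2: "(\<lambda>n. \<integral>x. k n (radial_volume x) * w x \<partial>lborel) \<longlonglongrightarrow> (\<integral>x. f (radial_volume x) * w x \<partial>lborel)"
  proof -
    have j: "integrable lborel (\<lambda>x. k n (radial_volume x) * w x)" "integrable lborel (\<lambda>x. f (radial_volume x) * w x)" for n
      using ik f by (auto intro!: integrable_mult_bounded[OF _ _ D(2)] integrable_radial_volume)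
    have bound: "\<bar>(\<integral>x. k n (radial_volume x) * w x \<partial>lborel) - (\<integral>x. f (radial_volume x) * w x \<partial>lborel)\<bar>
        \<le> D * (\<integral>s. \<bar>k n s - f s\<bar> \<partial>lborel)" for n
    proof -
      have i: "integrable lborel (\<lambda>s. k n s - f s)"
        using ik f by simp
      have eq: "(\<integral>x. k n (radial_volume x) * w x \<partial>lborel) - (\<integral>x. f (radial_volume x) * w x \<partial>lborel)
          = (\<integral>x. k n (radial_volume x) * w x - f (radial_volume x) * w x \<partial>lborel)"
        by (rule Bochner_Integration.integral_diff[OF j(1) j(2), symmetric])
      have "\<bar>(\<integral>x. k n (radial_volume x) * w x \<partial>lborel) - (\<integral>x. f (radial_volume x) * w x \<partial>lborel)\<bar>
          \<le> (\<integral>x. D * \<bar>k n (radial_volume x) - f (radial_volume x)\<bar> \<partial>(lborel :: 'a measure))"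
        unfolding eq
      proof (rule integral_abs_bound_integral)
        show "integrable lborel (\<lambda>x. k n (radial_volume x) * w x - f (radial_volume x) * w x)"
          by (rule Bochner_Integration.integrable_diff[OF j(1) j(2)])
        show "integrable lborel (\<lambda>x::'a. D * \<bar>k n (radial_volume x) - f (radial_volume x)\<bar>)"
          using integrable_radial_volume(1)[OF i, where 'a = 'a] by simp
        fix x
        show "\<bar>k n (radial_volume x) * w x - f (radial_volume x) * w x\<bar> \<le> D * \<bar>k n (radial_volume x) - f (radial_volume x)\<bar>"
          using mult_left_mono[OF D(2)[of x], of "\<bar>k n (radial_volume x) - f (radial_volume x)\<bar>"]
          by (simp only: left_diff_distrib[symmetric] abs_mult mult.commute[of _ D])
      qed
      also have "\<dots> = D * (\<integral>x. \<bar>k n (radial_volume x) - f (radial_volume x)\<bar> \<partial>(lborel :: 'a measure))"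
        by simp
      also have "\<dots> \<le> D * (\<integral>s. \<bar>k n s - f s\<bar> \<partial>lborel)"
        using integrable_radial_volume(2)[OF i, where 'a = 'a] D(1) by (intro mult_left_mono) auto
      finally show ?thesis .
    qed
    have "(\<lambda>n. (\<integral>x. k n (radial_volume x) * w x \<partial>lborel) - (\<integral>x. f (radial_volume x) * w x \<partial>lborel)) \<longlonglongrightarrow> 0"
    proof (rule Lim_null_comparison)
      show "(\<lambda>n. D * (\<integral>s. \<bar>k n s - f s\<bar> \<partial>lborel)) \<longlonglongrightarrow> 0"
        using tendsto_mult_left[OF k_lim, of D] by simp
    qed (use bound in auto)
    then show ?thesis
      by (rule LIM_zero_cancel)
  qed
  have "(\<integral>x. F (radial_volume x) * frechet_derivative \<phi> (at x) b \<partial>lborel) = - (\<integral>x. f (radial_volume x) * w x \<partial>lborel)"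
    using lim1 tendsto_minus[OF lim2] unfolding parts by (simp add: w_def mult.assoc LIMSEQ_unique)
  then show ?thesis
    by (simp add: w_def mult.assoc)
qed

section \<open>The symmetrized function and its weak gradient\<close>

lemma N_function_superlinear:
  assumes "N_function A"
  obtains T where "T \<ge> 0" "\<And>t. t \<ge> 0 \<Longrightarrow> t \<le> T + A t"
proof -
  have "\<forall>\<^sub>F t in at_top. 1 \<le> A t / t"
    using assms by (simp add: N_function_def filterlim_at_top)
  then obtain T where T: "\<And>t. t \<ge> T \<Longrightarrow> 1 \<le> A t / t"
    by (auto simp: eventually_at_top_linorder)
  show thesis
  proof (rule that[of "max 1 T"])
    fix t :: real assume "t \<ge> 0"
    show "t \<le> max 1 T + A t"
    proof (cases "t \<ge> max 1 T")
      case True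
      then have "t > 0" "1 \<le> A t / t"
        using T[of t] by auto
      then have "t \<le> A t" by (simp add: le_divide_eq)
      then show ?thesis by simp
    next
      case False
      then have "t \<le> max 1 T" by linarith
      then show ?thesis
        using N_functionD(1)[OF assms \<open>t \<ge> 0\<close>] by linarith
    qed
  qed simp
qed

text \<open>An N-function eventually dominates the identity.\<close>

lemma integrable_of_modular:
  fixes f :: "'a \<Rightarrow> 'b::{banach, second_countable_topology}"
  assumes A: "N_function A" and f: "f \<in> borel_measurable M" and k: "k > 0" and M: "finite_measure M"
    and mod: "(\<integral>\<^sup>+x. ennreal (A (norm (f x) / k)) \<partial>M) < \<infinity>"
  shows "integrable M f"
proof (rule integrableI_bounded[OF f])
  obtain T where T: "T \<ge> 0" "\<And>t. t \<ge> 0 \<Longrightarrow> t \<le> T + A t"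
    using N_function_superlinear[OF A] by blast
  note [measurable] = f N_function_extend(3)[OF A]
  have Af: "A (norm (f x) / k) = A \<bar>norm (f x) / k\<bar>" for x
    using k by simp
  have [measurable]: "(\<lambda>x. A (norm (f x) / k)) \<in> borel_measurable M"
    unfolding Af by measurable
  have "(\<integral>\<^sup>+x. ennreal (norm (f x)) \<partial>M) \<le> (\<integral>\<^sup>+x. ennreal k * (ennreal T + ennreal (A (norm (f x) / k))) \<partial>M)"
  proof (rule nn_integral_mono)
    fix x
    have "norm (f x) / k \<le> T + A (norm (f x) / k)"
      using k by (intro T(2)) simp
    then have "norm (f x) \<le> k * (T + A (norm (f x) / k))"
      using k by (simp add: divide_le_eq mult.commute)
    then have "ennreal (norm (f x)) \<le> ennreal (k * (T + A (norm (f x) / k)))"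
      by (rule ennreal_leI)
    also have "\<dots> = ennreal k * (ennreal T + ennreal (A (norm (f x) / k)))"
      using k T(1) N_functionD(1)[OF A, of "norm (f x) / k"] by (simp add: ennreal_mult ennreal_plus)
    finally show "ennreal (norm (f x)) \<le> ennreal k * (ennreal T + ennreal (A (norm (f x) / k)))" .
  qed
  also have "\<dots> = ennreal k * (ennreal T * emeasure M (space M) + (\<integral>\<^sup>+x. ennreal (A (norm (f x) / k)) \<partial>M))"
    by (simp add: nn_integral_cmult nn_integral_add)
  also have "\<dots> < \<infinity>"
    using mod finite_measure.emeasure_finite[OF M, of "space M"]
    by (auto simp: ennreal_mult_less_top ennreal_mult_eq_top_iff less_top[symmetric])
  finally show "(\<integral>\<^sup>+x. ennreal (norm (f x)) \<partial>M) < \<infinity>" .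
qed

text \<open>From here on the exponent is the isoperimetric one of the ambient dimension.\<close>

locale symmetrized_function = isoperimetric_function \<Omega> u g p Q
  for \<Omega> :: "'a::euclidean_space set" and u g p Q +
  assumes dim: "DIM('a) \<ge> 2" and p_eq: "p = 1 - 1 / DIM('a)" and V_pos: "V > 0"
    and u_zero: "\<And>x. x \<notin> \<Omega> \<Longrightarrow> u x = 0"
begin

abbreviation v :: "'a \<Rightarrow> real" where
  "v \<equiv> schwarz_symmetrization \<Omega> u"

abbreviation W :: "'a set" where
  "W \<equiv> ball_of_measure V"

lemma v_eq: "v x = r (radial_volume x)"
  by (simp add: schwarz_symmetrization_def r_def radial_volume_def)

text \<open>A Borel version of the rearrangement: outside \<open>(0, V)\<close>, where the rearrangement may be infinite and its
  real value is meaningless, it is replaced by \<open>0\<close>.\<close>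

definition r0 :: "real \<Rightarrow> real" where
  "r0 s = indicator {0<..<V} s * r s"

lemma r0_borel [measurable]: "r0 \<in> borel_measurable borel"
  unfolding borel_measurable_iff_greater
proof
  fix t
  have "{s. t < r0 s} = ({0<..<V} \<inter> {s. s < \<mu> t}) \<union> ({s. t < 0} - {0<..<V})"
    using less_\<mu>_iff by (auto simp: r0_def indicator_def split: if_splits)
  also have "\<dots> \<in> sets borel"
    by measurable
  finally show "{s \<in> space borel. t < r0 s} \<in> sets borel"
    by simp
qed

definition v0 :: "'a \<Rightarrow> real" where
  "v0 x = r0 (radial_volume x)"

lemma v0_borel [measurable]: "v0 \<in> borel_measurable borel"
  unfolding v0_def[abs_def] by measurable

lemma mem_W: "x \<in> W \<longleftrightarrow> radial_volume x < V"
  using V_pos by (intro mem_ball_of_measure) simp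

lemma v0_eq: "x \<in> W \<Longrightarrow> x \<noteq> 0 \<Longrightarrow> v0 x = v x"
  using radial_volume_nonneg[of x] radial_volume_0_iff[of x]
  by (simp add: v0_def v_eq r0_def mem_W indicator_def)

text \<open>By the Galois connection the superlevel set \<open>{r > t}\<close> is the interval \<open>(0, \<mu> t)\<close>, up to the point \<open>V\<close>.\<close>

lemma distr_r0: "distr (restrict_space lborel {0<..<V}) borel r0 = value_measure"
proof (rule measure_eqI_lessThan)
  show "emeasure (distr (restrict_space lborel {0<..<V}) borel r0) {t<..} = emeasure value_measure {t<..}" for t
  proof -
    have [measurable]: "r0 \<in> borel_measurable (restrict_space lborel {0<..<V})"
      by (rule measurable_restrict_space1) simp
    have "emeasure (distr (restrict_space lborel {0<..<V}) borel r0) {t<..}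
        = emeasure lborel (r0 -` {t<..} \<inter> {0<..<V})"
      by (subst emeasure_distr) (simp_all add: space_restrict_space emeasure_restrict_space)
    also have "r0 -` {t<..} \<inter> {0<..<V} = {0<..<\<mu> t} - {V}"
    proof -
      have "\<mu> t \<le> V"
        unfolding \<mu>_eq measure_values_UNIV[symmetric] by (intro value_measure.finite_measure_mono) auto
      then have "s \<in> r0 -` {t<..} \<inter> {0<..<V} \<longleftrightarrow> s \<in> {0<..<\<mu> t} - {V}" for s
        using less_\<mu>_iff[of s t] by (auto simp: r0_def)
      then show ?thesis by blast
    qed
    also have "emeasure lborel ({0<..<\<mu> t} - {V}) = emeasure lborel {0<..<\<mu> t}"
      by (rule emeasure_Diff_null_set) (auto simp: null_sets_def)
    also have "\<dots> = ennreal (\<mu> t)"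
      by (simp add: \<mu>_eq)
    also have "\<dots> = emeasure value_measure {t<..}"
      by (simp add: \<mu>_eq value_measure.emeasure_eq_measure)
    finally show ?thesis .
  qed
  then show "emeasure (distr (restrict_space lborel {0<..<V}) borel r0) {t<..} < \<infinity>" for t
    by (simp add: value_measure.emeasure_eq_measure)
qed simp_all

lemma nn_integral_W_radial:
  assumes [measurable]: "F \<in> borel_measurable borel"
  shows "(\<integral>\<^sup>+x. F (radial_volume x) * indicator {x. 0 < radial_volume x \<and> radial_volume x < m} x \<partial>(lborel :: 'a measure))
    = (\<integral>\<^sup>+s. F s * indicator {0<..<m} s \<partial>lborel)"
proof -
  have "(\<integral>\<^sup>+x. F (radial_volume x) * indicator {x. 0 < radial_volume x \<and> radial_volume x < m} x \<partial>(lborel :: 'a measure))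
      = (\<integral>\<^sup>+x. F (radial_volume x) * indicator {0<..<m} (radial_volume x) \<partial>(lborel :: 'a measure))"
    by (intro nn_integral_cong) (simp add: indicator_def)
  also have "\<dots> = (\<integral>\<^sup>+s. F s * indicator {0<..<m} s * indicator {0..} s \<partial>lborel)"
    by (rule nn_integral_radial_volume) simp
  also have "\<dots> = (\<integral>\<^sup>+s. F s * indicator {0<..<m} s \<partial>lborel)"
    by (intro nn_integral_cong) (simp add: indicator_def)
  finally show ?thesis .
qed

text \<open>Compose the transport of Lebesgue measure by \<open>radial_volume\<close> with the equality of distributions of \<open>r\<close>
  and \<open>u\<close>.\<close>

lemma equimeasurable:
  assumes F [measurable]: "F \<in> borel_measurable borel"
  shows "(\<integral>\<^sup>+x. F (v0 x) * indicator W x \<partial>lborel) = (\<integral>\<^sup>+x. F (u x) * indicator \<Omega> x \<partial>lborel)"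
proof -
  have "(\<integral>\<^sup>+x. F (v0 x) * indicator W x \<partial>lborel)
      = (\<integral>\<^sup>+x. F (r0 (radial_volume x)) * indicator {x. 0 < radial_volume x \<and> radial_volume x < V} x \<partial>(lborel :: 'a measure))"
  proof (rule nn_integral_cong_AE)
    show "AE x in lborel. F (v0 x) * indicator W x
        = F (r0 (radial_volume x)) * indicator {x. 0 < radial_volume x \<and> radial_volume x < V} x"
      using AE_lborel_singleton[of "0::'a"]
    proof eventually_elim
      case (elim x)
      then have "0 < radial_volume x"
        using radial_volume_nonneg[of x] radial_volume_0_iff[of x] by simp
      then show ?case
        by (simp add: v0_def mem_W indicator_def)
    qed
  qed
  also have "\<dots> = (\<integral>\<^sup>+s. F (r0 s) * indicator {0<..<V} s \<partial>lborel)"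
    by (rule nn_integral_W_radial[of "\<lambda>s. F (r0 s)"]) simp
  also have "\<dots> = (\<integral>\<^sup>+s. F (r0 s) \<partial>restrict_space lborel {0<..<V})"
    by (subst nn_integral_restrict_space) simp_all
  also have "\<dots> = (\<integral>\<^sup>+y. F y \<partial>distr (restrict_space lborel {0<..<V}) borel r0)"
    by (rule nn_integral_distr[symmetric]) (auto intro: measurable_restrict_space1)
  also have "\<dots> = (\<integral>\<^sup>+x. F (u x) \<partial>restrict_space lborel \<Omega>)"
    unfolding distr_r0 value_measure_def
    by (rule nn_integral_distr) (auto intro: measurable_restrict_space1)
  also have "\<dots> = (\<integral>\<^sup>+x. F (u x) * indicator \<Omega> x \<partial>lborel)"
    by (subst nn_integral_restrict_space) simp_all
  finally show ?thesis .
qed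

lemma W_borel [measurable]: "W \<in> sets borel"
  by (simp add: ball_of_measure_def)

lemma integrable_v0: "integrable lborel (\<lambda>x. indicator W x * v0 x)"
proof (rule integrableI_bounded)
  have "(\<integral>\<^sup>+x. ennreal (norm (indicator W x * v0 x)) \<partial>lborel) = (\<integral>\<^sup>+x. ennreal \<bar>v0 x\<bar> * indicator W x \<partial>lborel)"
    by (intro nn_integral_cong) (simp add: indicator_def)
  also have "\<dots> = (\<integral>\<^sup>+x. ennreal \<bar>u x\<bar> * indicator \<Omega> x \<partial>lborel)"
    by (rule equimeasurable) simp
  also have "\<dots> \<le> (\<integral>\<^sup>+x. ennreal (norm (u x)) \<partial>lborel)"
    by (intro nn_integral_mono) (simp add: indicator_def)
  also have "\<dots> < \<infinity>"
    using u_integrable by (simp add: integrable_iff_bounded)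
  finally show "(\<integral>\<^sup>+x. ennreal (norm (indicator W x * v0 x)) \<partial>lborel) < \<infinity>" .
qed simp

text \<open>The pointwise gradient that the chain rule predicts for \<open>v\<close>, the profile having derivative
  \<open>- slope_density\<close>.\<close>

definition Dv :: "'a \<Rightarrow> 'a" where
  "Dv x = - slope_density (radial_volume x) *\<^sub>R radial_gradient x"

lemma Dv_borel [measurable]: "Dv \<in> borel_measurable borel"
  unfolding Dv_def[abs_def] by measurable

definition gradient_factor :: "real \<Rightarrow> real" where
  "gradient_factor \<epsilon> = Q * DIM('a) * ball_const TYPE('a) powr (1 / DIM('a)) * ((V - \<epsilon>) / \<epsilon>) powr p"

lemma gradient_factor_pos: "0 < \<epsilon> \<Longrightarrow> \<epsilon> < V / 2 \<Longrightarrow> gradient_factor \<epsilon> > 0"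
  unfolding gradient_factor_def using Q ball_const_pos[where 'a = 'a] by simp

lemma norm_Dv:
  assumes "0 < \<epsilon>" "\<epsilon> < V / 2"
  shows "norm (Dv x) = gradient_factor \<epsilon> * weighted_slope \<epsilon> (radial_volume x)"
proof -
  have "((V - \<epsilon>) / \<epsilon>) powr p > 0"
    using assms by simp
  then show ?thesis
    using Q slope_density_nonneg[of "radial_volume x"] unfolding Dv_def weighted_slope_def gradient_factor_def
    by (simp add: norm_radial_gradient[OF dim] p_eq[symmetric])
qed

lemma Dv_modular_le:
  assumes A: "N_function A" and k: "k > 0" and \<epsilon>: "0 < \<epsilon>" "\<epsilon> < V / 2"
  shows "(\<integral>\<^sup>+x. ennreal (A (norm (Dv x) / (gradient_factor \<epsilon> * k))) * indicator (ball_of_measure (V - \<epsilon>)) x \<partial>lborel)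
    \<le> (\<integral>\<^sup>+x. ennreal (A (norm (g x) / k)) \<partial>lborel)"
proof -
  note [measurable] = N_function_extend(3)[OF A]
  have ws_nonneg: "0 \<le> weighted_slope \<epsilon> s" for s
    unfolding weighted_slope_def using Q slope_density_nonneg by (intro divide_nonneg_nonneg mult_nonneg_nonneg) auto
  have [measurable]: "weighted_slope \<epsilon> \<in> borel_measurable borel"
    unfolding weighted_slope_def[abs_def] by measurable
  have A_ws: "A (weighted_slope \<epsilon> s / k) = A \<bar>weighted_slope \<epsilon> s / k\<bar>" for s
    using ws_nonneg[of s] k by simp
  have [measurable]: "(\<lambda>s. A (weighted_slope \<epsilon> s / k)) \<in> borel_measurable borel"
    unfolding A_ws by measurable
  have eq: "norm (Dv x) / (gradient_factor \<epsilon> * k) = weighted_slope \<epsilon> (radial_volume x) / k" for x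
    using gradient_factor_pos[OF \<epsilon>] k by (simp add: norm_Dv[OF \<epsilon>])
  have "(\<integral>\<^sup>+x. ennreal (A (norm (Dv x) / (gradient_factor \<epsilon> * k))) * indicator (ball_of_measure (V - \<epsilon>)) x \<partial>lborel)
      = (\<integral>\<^sup>+x. ennreal (A (weighted_slope \<epsilon> (radial_volume x) / k))
          * indicator {x. 0 < radial_volume x \<and> radial_volume x < V - \<epsilon>} x \<partial>(lborel :: 'a measure))"
  proof (rule nn_integral_cong_AE)
    show "AE x in lborel. ennreal (A (norm (Dv x) / (gradient_factor \<epsilon> * k))) * indicator (ball_of_measure (V - \<epsilon>)) x
        = ennreal (A (weighted_slope \<epsilon> (radial_volume x) / k))
          * indicator {x. 0 < radial_volume x \<and> radial_volume x < V - \<epsilon>} x"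
      using AE_lborel_singleton[of "0::'a"]
    proof eventually_elim
      case (elim x)
      then have "0 < radial_volume x"
        using radial_volume_nonneg[of x] radial_volume_0_iff[of x] by simp
      moreover have "x \<in> ball_of_measure (V - \<epsilon>) \<longleftrightarrow> radial_volume x < V - \<epsilon>"
        using \<epsilon> by (intro mem_ball_of_measure) simp
      ultimately show ?case
        by (simp add: eq indicator_def)
    qed
  qed
  also have "\<dots> = (\<integral>\<^sup>+s. ennreal (A (weighted_slope \<epsilon> s / k)) * indicator {0<..<V - \<epsilon>} s \<partial>lborel)"
    by (rule nn_integral_W_radial[of "\<lambda>s. ennreal (A (weighted_slope \<epsilon> s / k))"]) measurable
  also have "\<dots> \<le> (\<integral>\<^sup>+s. ennreal (A (weighted_slope \<epsilon> s / k)) * indicator {0<..V - \<epsilon>} s \<partial>lborel)"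
    by (intro nn_integral_mono) (auto simp: indicator_def)
  also have "\<dots> \<le> (\<integral>\<^sup>+x. ennreal (A (norm (g x) / k)) \<partial>lborel)"
    by (rule weighted_slope_modular_le[OF A k \<epsilon>])
  finally show ?thesis .
qed

text \<open>The weight \<open>s\<^sup>p\<close> compensates the possible singularity of the density at \<open>s = 0\<close>; this is visible only
  through the modular inequality, hence the detour through \<open>A\<close>.\<close>

lemma Dv_integrable:
  assumes A: "N_function A" and k: "k > 0" and mod: "(\<integral>\<^sup>+x. ennreal (A (norm (g x) / k)) \<partial>lborel) < \<infinity>"
    and \<epsilon>: "0 < \<epsilon>" "\<epsilon> < V / 2"
  shows "integrable lborel (\<lambda>x. indicator (ball_of_measure (V - \<epsilon>)) x *\<^sub>R Dv x)"
proof -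
  let ?B = "ball_of_measure (V - \<epsilon>) :: 'a set"
  have [measurable]: "?B \<in> sets borel"
    by (simp add: ball_of_measure_def)
  have "integrable (restrict_space lborel ?B) Dv"
  proof (rule integrable_of_modular[OF A])
    show "Dv \<in> borel_measurable (restrict_space lborel ?B)"
      by (rule measurable_restrict_space1) simp
    show "gradient_factor \<epsilon> * k > 0"
      using gradient_factor_pos[OF \<epsilon>] k by simp
    show "finite_measure (restrict_space lborel ?B)"
      using emeasure_lborel_ball_finite
      by (intro finite_measureI) (simp add: emeasure_restrict_space space_restrict_space ball_of_measure_def less_top)
    have "(\<integral>\<^sup>+x. ennreal (A (norm (Dv x) / (gradient_factor \<epsilon> * k))) \<partial>restrict_space lborel ?B)
        = (\<integral>\<^sup>+x. ennreal (A (norm (Dv x) / (gradient_factor \<epsilon> * k))) * indicator ?B x \<partial>lborel)"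
      by (subst nn_integral_restrict_space) simp_all
    also have "\<dots> < \<infinity>"
      using Dv_modular_le[OF A k \<epsilon>] mod by (rule le_less_trans)
    finally show "(\<integral>\<^sup>+x. ennreal (A (norm (Dv x) / (gradient_factor \<epsilon> * k))) \<partial>restrict_space lborel ?B) < \<infinity>" .
  qed
  then show ?thesis
    by (subst (asm) integrable_restrict_space) simp_all
qed

lemma compact_subset_ball_of_measure:
  assumes K: "compact K" "K \<subseteq> W"
  obtains \<epsilon> where "0 < \<epsilon>" "\<epsilon> < V / 2" "K \<subseteq> ball_of_measure (V - \<epsilon>)"
proof -
  have "\<exists>d<V. \<forall>x\<in>K. radial_volume x \<le> d"
  proof (cases "K = {}")
    case True
    then show ?thesis
      using V_pos by (intro exI[of _ 0]) simp
  next
    case False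
    obtain y where "y \<in> K" "\<forall>x\<in>K. radial_volume x \<le> radial_volume y"
      using continuous_attains_sup[OF K(1) False continuous_radial_volume] by blast
    then show ?thesis
      using K(2) mem_W by blast
  qed
  then obtain d where d: "d < V" "\<And>x. x \<in> K \<Longrightarrow> radial_volume x \<le> d"
    by blast
  define \<epsilon> where "\<epsilon> = min (V / 4) ((V - d) / 2)"
  have \<epsilon>: "0 < \<epsilon>" "\<epsilon> < V / 2" "d < V - \<epsilon>"
    using d(1) V_pos by (auto simp: \<epsilon>_def min_def field_simps)
  show thesis
  proof (rule that[OF \<epsilon>(1,2)])
    show "K \<subseteq> ball_of_measure (V - \<epsilon>)"
    proof
      fix x assume "x \<in> K"
      then have "radial_volume x < V - \<epsilon>"
        using d(2)[of x] \<epsilon>(3) by simp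
      then show "x \<in> ball_of_measure (V - \<epsilon>)"
        using \<epsilon> V_pos by (subst mem_ball_of_measure) auto
    qed
  qed
qed

text \<open>The profile may be unbounded at the centre of the ball. Freeze it at its value \<open>r c\<close> for radial volume
  below \<open>c\<close>; the frozen profile is covered by \<open>radial_parts_L1\<close>, and dominated convergence applies as \<open>c\<close>
  tends to \<open>0\<close>.\<close>

lemma Dv_parts:
  assumes A: "N_function A" and k: "k > 0" and mod: "(\<integral>\<^sup>+x. ennreal (A (norm (g x) / k)) \<partial>lborel) < \<infinity>"
    and \<phi>: "\<phi> \<in> C1_compact_support W"
  shows "(\<integral>x. v0 x * frechet_derivative \<phi> (at x) b \<partial>lborel) = - (\<integral>x. (Dv x \<bullet> b) * \<phi> x \<partial>lborel)"
proof -
  define K where "K = closure {x. \<phi> x \<noteq> 0}"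
  note K = C1_compact_support_support[OF \<phi>, folded K_def]
  obtain \<epsilon> where \<epsilon>: "0 < \<epsilon>" "\<epsilon> < V / 2" "K \<subseteq> ball_of_measure (V - \<epsilon>)"
    using compact_subset_ball_of_measure[OF K(1,2)] by blast
  define d where "d = V - \<epsilon>"
  have d: "0 < d" "d < V"
    using \<epsilon> by (auto simp: d_def)
  have Kd: "radial_volume x < d" if "x \<in> K" for x
    using \<epsilon>(3) that d by (auto simp: d_def mem_ball_of_measure)
  have iDv: "integrable lborel (\<lambda>x. indicator (ball_of_measure d) x *\<^sub>R Dv x)"
    unfolding d_def by (rule Dv_integrable[OF A k mod \<epsilon>(1,2)])
  let ?D = "\<lambda>x. frechet_derivative \<phi> (at x) b"
  obtain B where B: "0 \<le> B" "\<And>x. \<bar>\<phi> x\<bar> \<le> B" "\<And>x. \<bar>?D x\<bar> \<le> B"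
    using C1_compact_support_bounded[OF \<phi>] by metis
  note [measurable] = C1_compact_support_measurable[OF \<phi>]
  have [measurable]: "(ball_of_measure d :: 'a set) \<in> sets borel"
    by (simp add: ball_of_measure_def)
  define c where "c n = d / (2 + real n)" for n
  have c: "0 < c n" "c n < d" for n
  proof -
    show "0 < c n"
      using d by (simp add: c_def)
    have "d / (2 + real n) < d / 1"
      using d by (intro divide_strict_left_mono) auto
    then show "c n < d"
      by (simp add: c_def)
  qed
  have c_lim: "c \<longlonglongrightarrow> 0"
    unfolding c_def by (intro tendsto_divide_0[OF tendsto_const] filterlim_at_top_imp_at_infinity
      filterlim_tendsto_add_at_top[OF tendsto_const] filterlim_real_sequentially)
  define f where "f n \<sigma> = indicator {c n..d} \<sigma> * slope_density \<sigma>" for n and \<sigma> :: real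
  have f: "integrable lborel (f n)" for n
    unfolding f_def[abs_def] using c[of n] d by (intro slope_density_integrable) auto
  \<comment> \<open>The frozen profile. It differs from the primitive of \<open>- f n\<close> by the constant \<open>r (c n)\<close>, which the
    derivative of a test function annihilates.\<close>
  define rc where "rc n s = r (max s (c n))" for n s
  have F_eq: "(\<integral>\<sigma>. indicator {-1..s} \<sigma> * f n \<sigma> \<partial>lborel) = r (c n) - rc n s" if s: "0 \<le> s" "s \<le> d" for n s
  proof (cases "c n \<le> s")
    case True
    have "indicator {-1..s} \<sigma> * f n \<sigma> = indicator {c n..s} \<sigma> * slope_density \<sigma>" for \<sigma>
      using c[of n] s by (auto simp: f_def indicator_def)
    then show ?thesis
      using slope_density_integral[of "c n" s] True c[of n] s d by (simp add: rc_def max_def)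
  next
    case False
    then have zero: "(\<lambda>\<sigma>. indicator {-1..s} \<sigma> * f n \<sigma>) = (\<lambda>\<sigma>. 0)"
      by (intro ext) (auto simp: f_def indicator_def)
    show ?thesis
      unfolding zero using False by (simp add: rc_def max_def)
  qed
  have rc_eq: "rc n s = r0 (max s (c n))" if "s \<le> d" for n s
    using that c[of n] d by (auto simp: rc_def r0_def indicator_def max_def)
  have parts: "(\<integral>x. r0 (max (radial_volume x) (c n)) * ?D x \<partial>lborel)
      = (\<integral>x. f n (radial_volume x) * (radial_gradient x \<bullet> b) * \<phi> x \<partial>lborel)" for n
  proof -
    have "(\<integral>x. (\<integral>\<sigma>. indicator {-1..radial_volume x} \<sigma> * f n \<sigma> \<partial>lborel) * ?D x \<partial>lborel)
        = - (\<integral>x. f n (radial_volume x) * (radial_gradient x \<bullet> b) * \<phi> x \<partial>lborel)"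
      by (rule radial_parts_L1[OF dim \<phi> f])
    moreover have "(\<integral>x. (\<integral>\<sigma>. indicator {-1..radial_volume x} \<sigma> * f n \<sigma> \<partial>lborel) * ?D x \<partial>lborel)
        = (\<integral>x. r (c n) * ?D x - r0 (max (radial_volume x) (c n)) * ?D x \<partial>lborel)"
    proof (intro Bochner_Integration.integral_cong refl)
      fix x :: 'a
      show "(\<integral>\<sigma>. indicator {-1..radial_volume x} \<sigma> * f n \<sigma> \<partial>lborel) * ?D x
          = r (c n) * ?D x - r0 (max (radial_volume x) (c n)) * ?D x"
      proof (cases "x \<in> K")
        case True
        then show ?thesis
          using F_eq[OF radial_volume_nonneg, of x n] rc_eq[of "radial_volume x" n] Kd[of x]
          by (simp add: left_diff_distrib)
      next
        case False
        then show ?thesis by (simp add: K(4))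
      qed
    qed
    moreover have "(\<integral>x. r (c n) * ?D x - r0 (max (radial_volume x) (c n)) * ?D x \<partial>lborel)
        = r (c n) * (\<integral>x. ?D x \<partial>lborel) - (\<integral>x. r0 (max (radial_volume x) (c n)) * ?D x \<partial>lborel)"
    proof (subst Bochner_Integration.integral_diff)
      show "integrable lborel (\<lambda>x. r (c n) * ?D x)"
        using integral_derivative_test_function(2)[OF \<phi>] by simp
      show "integrable lborel (\<lambda>x. r0 (max (radial_volume x) (c n)) * ?D x)"
      proof (rule Bochner_Integration.integrable_bound)
        show "integrable lborel (\<lambda>x. (\<bar>r (c n)\<bar> + \<bar>r d\<bar>) * ?D x)"
          using integral_derivative_test_function(2)[OF \<phi>] by simp
        have "\<bar>r0 (max (radial_volume x) (c n)) * ?D x\<bar> \<le> \<bar>(\<bar>r (c n)\<bar> + \<bar>r d\<bar>) * ?D x\<bar>" for x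
        proof (cases "x \<in> K")
          case True
          let ?m = "max (radial_volume x) (c n)"
          have m: "0 < ?m" "c n \<le> ?m" "?m \<le> d" "?m < V"
            using Kd[OF True] c[of n] d by auto
          have "r d \<le> r ?m" "r ?m \<le> r (c n)"
            using m c[of n] d by (auto intro!: r_antimono)
          then have "\<bar>r0 ?m\<bar> \<le> \<bar>r (c n)\<bar> + \<bar>r d\<bar>"
            using m by (auto simp: r0_def)
          then have "\<bar>r0 ?m\<bar> * \<bar>?D x\<bar> \<le> (\<bar>r (c n)\<bar> + \<bar>r d\<bar>) * \<bar>?D x\<bar>"
            by (rule mult_right_mono) simp
          then show ?thesis
            by (simp add: abs_mult)
        next
          case False
          then show ?thesis by (simp add: K(4))
        qed
        then show "AE x in lborel. norm (r0 (max (radial_volume x) (c n)) * ?D x) \<le> norm ((\<bar>r (c n)\<bar> + \<bar>r d\<bar>) * ?D x)"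
          by simp
      qed simp
    qed simp
    ultimately show ?thesis
      using integral_derivative_test_function(1)[OF \<phi>, of b] by simp
  qed
  have lim1: "(\<lambda>n. \<integral>x. r0 (max (radial_volume x) (c n)) * ?D x \<partial>lborel) \<longlonglongrightarrow> (\<integral>x. v0 x * ?D x \<partial>lborel)"
  proof (rule integral_dominated_convergence)
    show "integrable lborel (\<lambda>x. \<bar>indicator W x * v0 x\<bar> * B + \<bar>r d\<bar> * \<bar>?D x\<bar>)"
      using integrable_v0 integral_derivative_test_function(2)[OF \<phi>, of b] by simp
    show "AE x in lborel. norm (r0 (max (radial_volume x) (c n)) * ?D x) \<le> \<bar>indicator W x * v0 x\<bar> * B + \<bar>r d\<bar> * \<bar>?D x\<bar>" for n
      using AE_lborel_singleton[of "0::'a"]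
    proof eventually_elim
      case (elim x)
      then have x0: "0 < radial_volume x"
        using radial_volume_nonneg[of x] radial_volume_0_iff[of x] by simp
      show ?case
      proof (cases "x \<in> K")
        case True
        let ?m = "max (radial_volume x) (c n)"
        have m: "0 < ?m" "radial_volume x \<le> ?m" "?m \<le> d" "?m < V"
          using Kd[OF True] c[of n] d x0 by auto
        have "r d \<le> r ?m" "r ?m \<le> r (radial_volume x)"
          using m x0 d by (auto intro!: r_antimono)
        moreover have "v0 x = r (radial_volume x)" "x \<in> W"
          using x0 Kd[OF True] d by (auto simp: v0_def r0_def mem_W)
        ultimately have "\<bar>r0 ?m\<bar> \<le> \<bar>indicator W x * v0 x\<bar> + \<bar>r d\<bar>"
          using m by (auto simp: r0_def)
        then have "\<bar>r0 ?m\<bar> * \<bar>?D x\<bar> \<le> (\<bar>indicator W x * v0 x\<bar> + \<bar>r d\<bar>) * \<bar>?D x\<bar>"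
          by (rule mult_right_mono) simp
        also have "\<dots> \<le> \<bar>indicator W x * v0 x\<bar> * B + \<bar>r d\<bar> * \<bar>?D x\<bar>"
          unfolding distrib_right by (intro add_right_mono mult_left_mono B) simp
        finally show ?thesis
          by (simp add: abs_mult)
      next
        case False
        then show ?thesis
          using B(1) by (simp add: K(4))
      qed
    qed
    show "AE x in lborel. (\<lambda>n. r0 (max (radial_volume x) (c n)) * ?D x) \<longlonglongrightarrow> v0 x * ?D x"
      using AE_lborel_singleton[of "0::'a"]
    proof eventually_elim
      case (elim x)
      then have "0 < radial_volume x"
        using radial_volume_nonneg[of x] radial_volume_0_iff[of x] by simp
      then have "\<forall>\<^sub>F n in sequentially. c n < radial_volume x"
        using c_lim by (intro order_tendstoD) auto
      then have "\<forall>\<^sub>F n in sequentially. r0 (max (radial_volume x) (c n)) * ?D x = v0 x * ?D x"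
        by eventually_elim (simp add: v0_def max_def)
      then show ?case
        by (rule tendsto_eventually)
    qed
  qed simp_all
  have lim2: "(\<lambda>n. \<integral>x. f n (radial_volume x) * (radial_gradient x \<bullet> b) * \<phi> x \<partial>lborel) \<longlonglongrightarrow> (\<integral>x. - (Dv x \<bullet> b) * \<phi> x \<partial>lborel)"
  proof (rule integral_dominated_convergence)
    have f_meas: "f n \<in> borel_measurable borel" for n
      using f[of n] by auto
    show "(\<lambda>x. f n (radial_volume x) * (radial_gradient x \<bullet> b) * \<phi> x) \<in> borel_measurable lborel" for n
      using f_meas[of n] by measurable
    show "integrable lborel (\<lambda>x. \<bar>(indicator (ball_of_measure d) x *\<^sub>R Dv x) \<bullet> b\<bar> * B)"
      by (intro integrable_mult_left integrable_abs integrable_inner_left iDv)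
    show "AE x in lborel. norm (f n (radial_volume x) * (radial_gradient x \<bullet> b) * \<phi> x)
        \<le> \<bar>(indicator (ball_of_measure d) x *\<^sub>R Dv x) \<bullet> b\<bar> * B" for n
    proof (rule AE_I2)
      fix x :: 'a
      show "norm (f n (radial_volume x) * (radial_gradient x \<bullet> b) * \<phi> x)
        \<le> \<bar>(indicator (ball_of_measure d) x *\<^sub>R Dv x) \<bullet> b\<bar> * B"
      proof (cases "x \<in> K")
        case True
        then have "x \<in> ball_of_measure d"
          using \<epsilon>(3) by (auto simp: d_def)
        then have "\<bar>f n (radial_volume x) * (radial_gradient x \<bullet> b)\<bar> \<le> \<bar>(indicator (ball_of_measure d) x *\<^sub>R Dv x) \<bullet> b\<bar>"
          by (simp add: f_def Dv_def abs_mult indicator_def)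
        then show ?thesis
          unfolding real_norm_def abs_mult[of _ "\<phi> x"] by (intro mult_mono B) simp_all
      next
        case False
        then show ?thesis
          using K(3) B(1) by simp
      qed
    qed
    show "AE x in lborel. (\<lambda>n. f n (radial_volume x) * (radial_gradient x \<bullet> b) * \<phi> x) \<longlonglongrightarrow> - (Dv x \<bullet> b) * \<phi> x"
      using AE_lborel_singleton[of "0::'a"]
    proof eventually_elim
      case (elim x)
      show ?case
      proof (cases "x \<in> K")
        case True
        have "0 < radial_volume x"
          using elim radial_volume_nonneg[of x] radial_volume_0_iff[of x] by simp
        then have "\<forall>\<^sub>F n in sequentially. c n < radial_volume x"
          using c_lim by (intro order_tendstoD) auto
        then have "\<forall>\<^sub>F n in sequentially. f n (radial_volume x) * (radial_gradient x \<bullet> b) * \<phi> x = - (Dv x \<bullet> b) * \<phi> x"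
          by eventually_elim (use Kd[OF True] in \<open>simp add: f_def Dv_def\<close>)
        then show ?thesis
          by (rule tendsto_eventually)
      next
        case False
        then show ?thesis by (simp add: K(3))
      qed
    qed
  qed simp_all
  have "(\<integral>x. v0 x * ?D x \<partial>lborel) = (\<integral>x. - (Dv x \<bullet> b) * \<phi> x \<partial>lborel)"
    using lim1 lim2 unfolding parts by (rule LIMSEQ_unique)
  then show ?thesis by simp
qed

text \<open>Local integrability and Orlicz modulars on \<open>W\<close> refer to \<open>v\<close> itself and not to the representative \<open>v0\<close>;
  the origin is the only point of \<open>W\<close> at which the two can differ.\<close>

lemma v_on_W:
  obtains v1 where "v1 \<in> borel_measurable borel" "\<And>x. x \<in> W \<Longrightarrow> v x = v1 x" "AE x in lborel. v1 x = v0 x"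
proof (rule that)
  show "(\<lambda>x. if x = 0 then v 0 else v0 x) \<in> borel_measurable borel"
    by measurable
  show "v x = (if x = 0 then v 0 else v0 x)" if "x \<in> W" for x
    using v0_eq[OF that] by simp
  show "AE x in lborel. (if x = 0 then v 0 else v0 x) = v0 x"
    using AE_lborel_singleton[of "0::'a"] by eventually_elim simp
qed

lemma has_weak_gradient_schwarz:
  assumes A: "N_function A" and k: "k > 0" and mod: "(\<integral>\<^sup>+x. ennreal (A (norm (g x) / k)) \<partial>lborel) < \<infinity>"
  shows "has_weak_gradient W v Dv"
  unfolding has_weak_gradient_def
proof (intro conjI ballI)
  obtain v1 where v1 [measurable]: "v1 \<in> borel_measurable borel" and v_v1: "\<And>x. x \<in> W \<Longrightarrow> v x = v1 x"
      and v1_v0: "AE x in lborel. v1 x = v0 x"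
    using v_on_W by blast
  show "locally_integrable W v"
    unfolding locally_integrable_def
  proof (intro allI impI)
    fix K assume K: "compact K \<and> K \<subseteq> W"
    then have [measurable]: "K \<in> sets borel"
      by (simp add: compact_imp_closed borel_closed)
    have "integrable lborel (\<lambda>x. indicator K x *\<^sub>R (indicator W x * v0 x))"
      using integrable_v0 by (intro integrable_mult_indicator) simp_all
    moreover have "AE x in lborel. indicator K x *\<^sub>R (indicator W x * v0 x) = indicator K x *\<^sub>R v1 x"
      using v1_v0 by eventually_elim (use K in \<open>auto simp: indicator_def\<close>)
    ultimately have "integrable lborel (\<lambda>x. indicator K x *\<^sub>R v1 x)"
      by (subst integrable_cong_AE[symmetric]) auto
    then have "integrable lebesgue (\<lambda>x. indicator K x *\<^sub>R v1 x)"
      by (subst integrable_completion) simp_all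
    also have "(\<lambda>x. indicator K x *\<^sub>R v1 x) = (\<lambda>x. indicator K x *\<^sub>R v x)"
      using K v_v1 by (auto simp: indicator_def fun_eq_iff)
    finally show "integrable (lebesgue_on K) v"
      by (subst integrable_restrict_space) simp_all
  qed
  show "locally_integrable W Dv"
    unfolding locally_integrable_def
  proof (intro allI impI)
    fix K assume K: "compact K \<and> K \<subseteq> W"
    then have [measurable]: "K \<in> sets borel"
      by (simp add: compact_imp_closed borel_closed)
    obtain \<epsilon> where \<epsilon>: "0 < \<epsilon>" "\<epsilon> < V / 2" "K \<subseteq> ball_of_measure (V - \<epsilon>)"
      using compact_subset_ball_of_measure K by blast
    have "integrable lborel (\<lambda>x. indicator K x *\<^sub>R (indicator (ball_of_measure (V - \<epsilon>)) x *\<^sub>R Dv x))"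
      by (intro integrable_mult_indicator Dv_integrable[OF A k mod \<epsilon>(1,2)]) simp
    also have "(\<lambda>x. indicator K x *\<^sub>R (indicator (ball_of_measure (V - \<epsilon>)) x *\<^sub>R Dv x)) = (\<lambda>x. indicator K x *\<^sub>R Dv x)"
      using \<epsilon>(3) by (auto simp: indicator_def fun_eq_iff)
    finally have "integrable lebesgue (\<lambda>x. indicator K x *\<^sub>R Dv x)"
      by (subst integrable_completion) simp_all
    then show "integrable (lebesgue_on K) Dv"
      by (subst integrable_restrict_space) simp_all
  qed
  fix \<phi> :: "'a \<Rightarrow> real" and b :: 'a assume \<phi>: "\<phi> \<in> C1_compact_support W" and b: "b \<in> Basis"
  note [measurable] = C1_compact_support_measurable[OF \<phi>]
  note K = C1_compact_support_support[OF \<phi>]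
  have zero: "\<phi> x = 0" "frechet_derivative \<phi> (at x) b = 0" if "x \<notin> W" for x
    using K(2) K(3,4)[of x] that by blast+
  have "(LINT x|lebesgue_on W. v x * frechet_derivative \<phi> (at x) b)
      = (\<integral>x. indicator W x *\<^sub>R (v x * frechet_derivative \<phi> (at x) b) \<partial>lebesgue)"
    by (subst integral_restrict_space) simp_all
  also have "\<dots> = (\<integral>x. indicator W x *\<^sub>R (v1 x * frechet_derivative \<phi> (at x) b) \<partial>lebesgue)"
    using v_v1 by (intro Bochner_Integration.integral_cong) (auto simp: indicator_def)
  also have "\<dots> = (\<integral>x. indicator W x *\<^sub>R (v1 x * frechet_derivative \<phi> (at x) b) \<partial>lborel)"
    by (rule integral_completion) simp
  also have "\<dots> = (\<integral>x. v0 x * frechet_derivative \<phi> (at x) b \<partial>lborel)"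
  proof (rule integral_cong_AE)
    show "AE x in lborel. indicator W x *\<^sub>R (v1 x * frechet_derivative \<phi> (at x) b) = v0 x * frechet_derivative \<phi> (at x) b"
      using v1_v0 by eventually_elim (auto simp: indicator_def zero)
  qed simp_all
  also have "\<dots> = - (\<integral>x. (Dv x \<bullet> b) * \<phi> x \<partial>lborel)"
    by (rule Dv_parts[OF A k mod \<phi>])
  also have "(\<integral>x. (Dv x \<bullet> b) * \<phi> x \<partial>lborel) = (\<integral>x. indicator W x *\<^sub>R ((Dv x \<bullet> b) * \<phi> x) \<partial>lborel)"
    by (intro Bochner_Integration.integral_cong) (auto simp: indicator_def zero)
  also have "\<dots> = (\<integral>x. indicator W x *\<^sub>R ((Dv x \<bullet> b) * \<phi> x) \<partial>lebesgue)"
    by (rule integral_completion[symmetric]) simp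
  also have "\<dots> = (LINT x|lebesgue_on W. (Dv x \<bullet> b) * \<phi> x)"
    by (subst integral_restrict_space) simp_all
  finally show "(LINT x|lebesgue_on W. v x * frechet_derivative \<phi> (at x) b) = - (LINT x|lebesgue_on W. (Dv x \<bullet> b) * \<phi> x)" .
qed

lemma v_measurable: "v \<in> borel_measurable (lebesgue_on W)"
proof -
  obtain v1 where v1: "v1 \<in> borel_measurable borel" "\<And>x. x \<in> W \<Longrightarrow> v x = v1 x"
    using v_on_W by blast
  have "v1 \<in> borel_measurable (lebesgue_on W)"
    by (intro measurable_restrict_space1 measurable_completion) (use v1(1) in simp)
  then show ?thesis
    by (subst measurable_cong[of _ _ v1]) (use v1(2) in \<open>simp_all add: space_restrict_space\<close>)
qed

lemma nn_integral_lebesgue_on_borel: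
  assumes [measurable]: "S \<in> sets borel" "F \<in> borel_measurable borel"
  shows "(\<integral>\<^sup>+x. F x \<partial>lebesgue_on S) = (\<integral>\<^sup>+x. F x * indicator S x \<partial>lborel)"
  by (subst nn_integral_restrict_space) (simp_all add: nn_integral_completion)

lemma schwarz_modular:
  assumes A: "N_function A"
  shows "orlicz_modular A W (\<lambda>x. v x / k) = orlicz_modular A \<Omega> (\<lambda>x. u x / k)"
proof -
  note [measurable] = N_function_extend(3)[OF A]
  obtain v1 where v1 [measurable]: "v1 \<in> borel_measurable borel" and v_v1: "\<And>x. x \<in> W \<Longrightarrow> v x = v1 x"
      and v1_v0: "AE x in lborel. v1 x = v0 x"
    using v_on_W by blast
  have "orlicz_modular A W (\<lambda>x. v x / k) = (\<integral>\<^sup>+x. ennreal (A \<bar>v1 x / k\<bar>) \<partial>lebesgue_on W)"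
    unfolding orlicz_modular_def by (intro nn_integral_cong) (simp add: space_restrict_space v_v1)
  also have "\<dots> = (\<integral>\<^sup>+x. ennreal (A \<bar>v1 x / k\<bar>) * indicator W x \<partial>lborel)"
    by (rule nn_integral_lebesgue_on_borel) measurable
  also have "\<dots> = (\<integral>\<^sup>+x. ennreal (A \<bar>v0 x / k\<bar>) * indicator W x \<partial>lborel)"
    using v1_v0 by (intro nn_integral_cong_AE, eventually_elim) simp
  also have "\<dots> = (\<integral>\<^sup>+x. ennreal (A \<bar>u x / k\<bar>) * indicator \<Omega> x \<partial>lborel)"
    by (rule equimeasurable[of "\<lambda>y. ennreal (A \<bar>y / k\<bar>)"]) measurable
  also have "\<dots> = orlicz_modular A \<Omega> (\<lambda>x. u x / k)"
    unfolding orlicz_modular_def by (rule nn_integral_lebesgue_on_borel[symmetric]) measurable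
  finally show ?thesis .
qed

lemma modular_gradient:
  assumes A: "N_function A" and k: "k > 0"
  shows "orlicz_modular A \<Omega> (\<lambda>x. norm (g x) / k) = (\<integral>\<^sup>+x. ennreal (A (norm (g x) / k)) \<partial>lborel)"
proof -
  note [measurable] = N_function_extend(3)[OF A]
  have "orlicz_modular A \<Omega> (\<lambda>x. norm (g x) / k) = (\<integral>\<^sup>+x. ennreal (A \<bar>norm (g x) / k\<bar>) * indicator \<Omega> x \<partial>lborel)"
    unfolding orlicz_modular_def by (rule nn_integral_lebesgue_on_borel) measurable
  also have "\<dots> = (\<integral>\<^sup>+x. ennreal (A (norm (g x) / k)) \<partial>lborel)"
    using k by (intro nn_integral_cong) (auto simp: indicator_def g_zero N_function_zero[OF A])
  finally show ?thesis .
qed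

lemma modular_Dv:
  assumes A: "N_function A" and k: "k > 0" and \<epsilon>: "0 < \<epsilon>" "\<epsilon> < V / 2"
  shows "orlicz_modular A (ball_of_measure (V - \<epsilon>)) (\<lambda>x. norm (Dv x) / (gradient_factor \<epsilon> * k))
    \<le> orlicz_modular A \<Omega> (\<lambda>x. norm (g x) / k)"
proof -
  note [measurable] = N_function_extend(3)[OF A]
  have [measurable]: "(ball_of_measure (V - \<epsilon>) :: 'a set) \<in> sets borel"
    by (simp add: ball_of_measure_def)
  have "orlicz_modular A (ball_of_measure (V - \<epsilon>)) (\<lambda>x. norm (Dv x) / (gradient_factor \<epsilon> * k))
      = (\<integral>\<^sup>+x. ennreal (A \<bar>norm (Dv x) / (gradient_factor \<epsilon> * k)\<bar>) * indicator (ball_of_measure (V - \<epsilon>)) x \<partial>lborel)"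
    unfolding orlicz_modular_def by (rule nn_integral_lebesgue_on_borel) measurable
  also have "\<dots> = (\<integral>\<^sup>+x. ennreal (A (norm (Dv x) / (gradient_factor \<epsilon> * k))) * indicator (ball_of_measure (V - \<epsilon>)) x \<partial>lborel)"
    using k gradient_factor_pos[OF \<epsilon>] by simp
  also have "\<dots> \<le> (\<integral>\<^sup>+x. ennreal (A (norm (g x) / k)) \<partial>lborel)"
    by (rule Dv_modular_le[OF A k \<epsilon>])
  finally show ?thesis
    by (simp add: modular_gradient[OF A k])
qed

end

section \<open>Passage to arbitrary representatives and the final estimate\<close>

text \<open>Each coordinate is a real Lebesgue measurable function, for which the completion of the Borel sets
  provides a Borel version.\<close>

lemma borel_representative:
  fixes f :: "'a::euclidean_space \<Rightarrow> 'b::euclidean_space"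
  assumes S [measurable]: "S \<in> sets borel" and f: "f \<in> borel_measurable (lebesgue_on S)"
  obtains f' where "f' \<in> borel_measurable borel" "\<And>x. x \<notin> S \<Longrightarrow> f' x = 0"
    "AE x in lebesgue. x \<in> S \<longrightarrow> f x = f' x"
proof -
  have F: "(\<lambda>x. indicator S x *\<^sub>R f x) \<in> borel_measurable lebesgue"
    using f by (subst (asm) borel_measurable_restrict_space_iff) simp_all
  have "\<exists>h\<in>borel_measurable lborel. AE x in lborel. (indicator S x *\<^sub>R f x) \<bullet> b = h x" for b
    by (intro completion_ex_borel_measurable_real borel_measurable_inner F borel_measurable_const)
  then obtain h where h: "\<And>b. h b \<in> borel_measurable lborel" "\<And>b. AE x in lborel. (indicator S x *\<^sub>R f x) \<bullet> b = h b x"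
    by metis
  have [measurable]: "h b \<in> borel_measurable borel" for b
    using h(1)[of b] by simp
  define f' where "f' x = indicator S x *\<^sub>R (\<Sum>b\<in>Basis. h b x *\<^sub>R b)" for x
  show thesis
  proof (rule that[of f'])
    show "f' \<in> borel_measurable borel"
      unfolding f'_def[abs_def] by measurable
    show "f' x = 0" if "x \<notin> S" for x
      using that by (simp add: f'_def)
    have "AE x in lborel. \<forall>b\<in>Basis. (indicator S x *\<^sub>R f x) \<bullet> b = h b x"
      using h(2) by (intro AE_ball_countable[THEN iffD2] countable_finite) auto
    then have "AE x in lborel. x \<in> S \<longrightarrow> f x = f' x"
    proof eventually_elim
      case (elim x)
      show ?case
      proof
        assume x: "x \<in> S"
        have "f' x = (\<Sum>b\<in>Basis. (f x \<bullet> b) *\<^sub>R b)"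
          using elim x by (simp add: f'_def)
        then show "f x = f' x"
          by (simp add: euclidean_representation)
      qed
    qed
    then show "AE x in lebesgue. x \<in> S \<longrightarrow> f x = f' x"
      by (rule AE_completion)
  qed
qed

lemma lebesgue_on_representative:
  fixes F F' :: "'a::euclidean_space \<Rightarrow> 'b::euclidean_space"
  assumes S [measurable]: "S \<in> sets borel" and F: "F \<in> borel_measurable (lebesgue_on S)"
    and F' [measurable]: "F' \<in> borel_measurable borel" and zero: "\<And>x. x \<notin> S \<Longrightarrow> F' x = 0"
    and ae: "AE x in lebesgue. x \<in> S \<longrightarrow> F x = F' x"
  shows "(LINT x|lebesgue_on S. F x) = (\<integral>x. F' x \<partial>lborel)"
    and "integrable (lebesgue_on S) F \<longleftrightarrow> integrable lborel F'"
proof -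
  have F_meas: "(\<lambda>x. indicator S x *\<^sub>R F x) \<in> borel_measurable lebesgue"
    using F by (subst (asm) borel_measurable_restrict_space_iff) simp_all
  have F'_meas: "F' \<in> borel_measurable lebesgue"
    using F' by (intro measurable_completion) simp
  have eq: "AE x in lebesgue. indicator S x *\<^sub>R F x = F' x"
    using ae by eventually_elim (auto simp: indicator_def zero)
  have "(LINT x|lebesgue_on S. F x) = (\<integral>x. indicator S x *\<^sub>R F x \<partial>lebesgue)"
    by (subst integral_restrict_space) simp_all
  also have "\<dots> = (\<integral>x. F' x \<partial>lebesgue)"
    by (rule integral_cong_AE[OF F_meas F'_meas eq])
  also have "\<dots> = (\<integral>x. F' x \<partial>lborel)"
    by (rule integral_completion) simp
  finally show "(LINT x|lebesgue_on S. F x) = (\<integral>x. F' x \<partial>lborel)" .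
  have "integrable (lebesgue_on S) F \<longleftrightarrow> integrable lebesgue (\<lambda>x. indicator S x *\<^sub>R F x)"
    by (subst integrable_restrict_space) simp_all
  also have "\<dots> \<longleftrightarrow> integrable lebesgue F'"
    by (rule integrable_cong_AE[OF F_meas F'_meas eq])
  also have "\<dots> \<longleftrightarrow> integrable lborel F'"
    by (rule integrable_completion) simp
  finally show "integrable (lebesgue_on S) F \<longleftrightarrow> integrable lborel F'" .
qed

text \<open>An open set is a countable union of compact sets.\<close>

lemma locally_integrable_measurable:
  fixes f :: "'a::euclidean_space \<Rightarrow> 'b::euclidean_space"
  assumes f: "locally_integrable S f" and S: "open S"
  shows "f \<in> borel_measurable (lebesgue_on S)"
proof -
  obtain C :: "nat \<Rightarrow> 'a set" where C: "\<And>n. compact (C n)" "\<And>n. C n \<subseteq> S" "\<Union>(range C) = S"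
    using open_Union_compact_subsets[OF S] by metis
  show ?thesis
  proof (rule measurable_piecewise_restrict[of "range C"])
    fix K assume "K \<in> range C"
    then have K: "compact K" "K \<subseteq> S"
      using C by auto
    then have [measurable]: "K \<in> sets lebesgue" "S \<in> sets lebesgue"
      using S by (auto simp: compact_imp_closed)
    show "K \<inter> space (lebesgue_on S) \<in> sets (lebesgue_on S)"
      using K(2) by (auto simp: space_restrict_space sets_restrict_space_iff Int_absorb2)
    have "restrict_space (lebesgue_on S) K = lebesgue_on K"
      using K(2) by (subst restrict_restrict_space) (simp_all add: Int_absorb1)
    moreover have "f \<in> borel_measurable (lebesgue_on K)"
      using f K by (auto simp: locally_integrable_def)
    ultimately show "f \<in> borel_measurable (restrict_space (lebesgue_on S) K)"
      by simp
  qed (use C(3) in \<open>auto simp: space_restrict_space\<close>)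
qed

lemma orlicz_modular_cong_AE:
  assumes [measurable]: "S \<in> sets lebesgue" and "AE x in lebesgue. x \<in> S \<longrightarrow> f x = h x"
  shows "orlicz_modular A S f = orlicz_modular A S h"
  unfolding orlicz_modular_def
  using assms by (intro nn_integral_cong_AE) (auto simp: AE_restrict_space_iff elim: eventually_mono)

lemma orlicz_modular_mono_set:
  assumes [measurable]: "S \<in> sets lebesgue" "T \<in> sets lebesgue" and "S \<subseteq> T"
  shows "orlicz_modular A S f \<le> orlicz_modular A T f"
  unfolding orlicz_modular_def using assms(3)
  by (subst (1 2) nn_integral_restrict_space) (auto intro!: nn_integral_mono simp: indicator_def)

lemma orlicz_modular_mono:
  assumes "N_function A" and "\<And>x. x \<in> S \<Longrightarrow> \<bar>f x\<bar> \<le> \<bar>h x\<bar>"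
  shows "orlicz_modular A S f \<le> orlicz_modular A S h"
  unfolding orlicz_modular_def
  by (intro nn_integral_mono ennreal_leI N_functionD(2)[OF assms(1)] assms(2)) (simp_all add: space_restrict_space)

lemma has_weak_gradient_subset:
  assumes g: "has_weak_gradient W f g" and U: "open U" "U \<subseteq> W" and W: "open W"
  shows "has_weak_gradient U f g"
  unfolding has_weak_gradient_def
proof (intro conjI ballI)
  show "locally_integrable U f" "locally_integrable U g"
    using g U(2) unfolding has_weak_gradient_def locally_integrable_def by auto
  fix \<phi> :: "'a \<Rightarrow> real" and b :: 'a assume \<phi>: "\<phi> \<in> C1_compact_support U" and b: "b \<in> Basis"
  note K = C1_compact_support_support[OF \<phi>]
  have zero: "\<phi> x = 0" "frechet_derivative \<phi> (at x) b = 0" if "x \<notin> U" for x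
    using K(2) K(3,4)[of x] that by blast+
  have \<phi>W: "\<phi> \<in> C1_compact_support W"
    using \<phi> U(2) by (auto simp: C1_compact_support_def)
  have [measurable]: "U \<in> sets lebesgue" "W \<in> sets lebesgue"
    using U W by auto
  have eq: "(LINT x|lebesgue_on U. q x) = (LINT x|lebesgue_on W. q x)" if "\<And>x. x \<notin> U \<Longrightarrow> q x = 0" for q :: "'a \<Rightarrow> real"
    using that U(2) by (subst (1 2) integral_restrict_space)
      (auto intro!: Bochner_Integration.integral_cong simp: indicator_def)
  show "(LINT x|lebesgue_on U. f x * frechet_derivative \<phi> (at x) b) = - (LINT x|lebesgue_on U. (g x \<bullet> b) * \<phi> x)"
    using g \<phi>W b zero unfolding has_weak_gradient_def by (subst (1 2) eq) auto
qed

text \<open>This makes the estimate independent of which weak gradient is selected by \<open>weak_gradient\<close>. Restricting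
  to a set with compact closure turns local integrability into integrability, as the fundamental lemma
  requires.\<close>

lemma weak_gradient_unique:
  fixes f :: "'a::euclidean_space \<Rightarrow> real"
  assumes g1: "has_weak_gradient W f g1" and g2: "has_weak_gradient W f g2" and W: "open W"
    and U: "open U" "compact (closure U)" "closure U \<subseteq> W"
  shows "AE x in lebesgue. x \<in> U \<longrightarrow> g1 x = g2 x"
proof -
  have [measurable]: "U \<in> sets borel" "W \<in> sets borel"
    using U W by auto
  have sub: "U \<subseteq> closure U"
    by (rule closure_subset)
  have comp: "AE x in lebesgue. x \<in> U \<longrightarrow> g1 x \<bullet> b = g2 x \<bullet> b" if b: "b \<in> Basis" for b
  proof -
    have i: "integrable lebesgue (\<lambda>x. indicator U x *\<^sub>R q x)" if "locally_integrable W q" for q :: "'a \<Rightarrow> 'a"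
    proof -
      have "integrable (lebesgue_on (closure U)) q"
        using that U unfolding locally_integrable_def by blast
      then have "integrable lebesgue (\<lambda>x. indicator (closure U) x *\<^sub>R q x)"
        by (subst (asm) integrable_restrict_space) simp_all
      then have "integrable lebesgue (\<lambda>x. indicator U x *\<^sub>R (indicator (closure U) x *\<^sub>R q x))"
        by (rule integrable_mult_indicator[rotated]) simp
      also have "(\<lambda>x. indicator U x *\<^sub>R (indicator (closure U) x *\<^sub>R q x)) = (\<lambda>x. indicator U x *\<^sub>R q x)"
        using sub by (auto simp: indicator_def fun_eq_iff)
      finally show ?thesis .
    qed
    have i1: "integrable lebesgue (\<lambda>x. (indicator U x *\<^sub>R g1 x) \<bullet> b)" and i2: "integrable lebesgue (\<lambda>x. (indicator U x *\<^sub>R g2 x) \<bullet> b)"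
      using g1 g2 by (auto intro!: integrable_inner_left i simp: has_weak_gradient_def simp del: inner_scaleR_left)
    define F where "F x = (indicator U x *\<^sub>R g1 x) \<bullet> b - (indicator U x *\<^sub>R g2 x) \<bullet> b" for x
    have iF: "integrable lebesgue F"
      unfolding F_def[abs_def] by (rule Bochner_Integration.integrable_diff[OF i1 i2])
    then have F_meas: "F \<in> borel_measurable lebesgue"
      by auto
    obtain F' where F'0: "F' \<in> borel_measurable lborel" and FF'0: "AE x in lborel. F x = F' x"
      using completion_ex_borel_measurable_real[OF F_meas] by blast
    have F' [measurable]: "F' \<in> borel_measurable borel"
      using F'0 by simp
    have FF': "AE x in lebesgue. F x = F' x"
      using FF'0 by (rule AE_completion)
    have F'_leb: "F' \<in> borel_measurable lebesgue"
      using F'0 by (rule measurable_completion)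
    have iF': "integrable lborel F'"
      using iF integrable_cong_AE[OF F_meas F'_leb FF'] integrable_completion[OF F'0] by simp
    have "AE x in lborel. x \<in> U \<longrightarrow> F' x = 0"
    proof (rule fundamental_lemma_weak_derivative[OF iF' U(1)])
      fix \<phi> :: "'a \<Rightarrow> real" assume \<phi>: "\<phi> \<in> C1_compact_support U"
      have \<phi>W: "\<phi> \<in> C1_compact_support W"
        using \<phi> sub U(3) by (auto simp: C1_compact_support_def)
      note K = C1_compact_support_support[OF \<phi>]
      have zero: "\<phi> x = 0" if "x \<notin> U" for x
        using K(2) K(3)[of x] that by blast
      note [measurable] = C1_compact_support_measurable[OF \<phi>]
      have \<phi>_leb [measurable]: "\<phi> \<in> borel_measurable lebesgue"
        by (rule measurable_completion) simp
      obtain B where B: "\<And>x. \<bar>\<phi> x\<bar> \<le> B"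
        using C1_compact_support_bounded[OF \<phi>] by metis
      have mult: "integrable lebesgue (\<lambda>x. q x * \<phi> x)" if "integrable lebesgue q" for q :: "'a \<Rightarrow> real"
      proof (rule Bochner_Integration.integrable_bound)
        show "integrable lebesgue (\<lambda>x. B * q x)"
          using that by simp
        show "(\<lambda>x. q x * \<phi> x) \<in> borel_measurable lebesgue"
          using that by (intro borel_measurable_times) auto
        have "\<bar>q x * \<phi> x\<bar> \<le> \<bar>B * q x\<bar>" for x
          using mult_right_mono[OF order_trans[OF B[of x] abs_ge_self[of B]], of "\<bar>q x\<bar>"] by (simp add: abs_mult mult.commute)
        then show "AE x in lebesgue. norm (q x * \<phi> x) \<le> norm (B * q x)"
          by simp
      qed
      have on_W: "(LINT x|lebesgue_on W. (q x \<bullet> b) * \<phi> x) = (\<integral>x. ((indicator U x *\<^sub>R q x) \<bullet> b) * \<phi> x \<partial>lebesgue)" for q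
        using subsetD[OF order_trans[OF sub U(3)]] zero by (subst integral_restrict_space)
          (auto intro!: Bochner_Integration.integral_cong simp: indicator_def)
      have "(LINT x|lebesgue_on W. (g1 x \<bullet> b) * \<phi> x) = (LINT x|lebesgue_on W. (g2 x \<bullet> b) * \<phi> x)"
        using g1 g2 \<phi>W b unfolding has_weak_gradient_def by force
      then have "(\<integral>x. ((indicator U x *\<^sub>R g1 x) \<bullet> b) * \<phi> x - ((indicator U x *\<^sub>R g2 x) \<bullet> b) * \<phi> x \<partial>lebesgue) = 0"
        unfolding on_W by (subst Bochner_Integration.integral_diff[OF mult[OF i1] mult[OF i2]]) simp
      then have "(\<integral>x. F x * \<phi> x \<partial>lebesgue) = 0"
        by (simp only: F_def left_diff_distrib)
      also have "(\<integral>x. F x * \<phi> x \<partial>lebesgue) = (\<integral>x. F' x * \<phi> x \<partial>lebesgue)"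
      proof (rule integral_cong_AE)
        show "(\<lambda>x. F x * \<phi> x) \<in> borel_measurable lebesgue" "(\<lambda>x. F' x * \<phi> x) \<in> borel_measurable lebesgue"
          using F_meas F'_leb \<phi>_leb by (auto intro!: borel_measurable_times)
        show "AE x in lebesgue. F x * \<phi> x = F' x * \<phi> x"
          using FF' by eventually_elim simp
      qed
      also have "\<dots> = (\<integral>x. F' x * \<phi> x \<partial>lborel)"
        by (rule integral_completion) simp
      finally show "(\<integral>x. F' x * \<phi> x \<partial>lborel) = 0" .
    qed
    then have "AE x in lebesgue. x \<in> U \<longrightarrow> F' x = 0"
      by (rule AE_completion)
    with FF' show ?thesis
    proof eventually_elim
      case (elim x)
      then show ?case
        by (cases "x \<in> U") (simp_all add: F_def)
    qed
  qed
  have "AE x in lebesgue. \<forall>b\<in>Basis. x \<in> U \<longrightarrow> g1 x \<bullet> b = g2 x \<bullet> b"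
    using comp by (intro AE_ball_countable[THEN iffD2] countable_finite) auto
  then show ?thesis
    by eventually_elim (auto intro: euclidean_eqI)
qed

text \<open>By convexity, \<open>A\<close> of the mean of the coordinates is at most the mean of the values of \<open>A\<close>, so the
  coordinates being in the Orlicz space puts the length of the vector there.\<close>

lemma orlicz_gradient_norm_modular:
  fixes g :: "'a::euclidean_space \<Rightarrow> 'a"
  assumes A: "N_function A" and comp: "\<And>b. b \<in> Basis \<Longrightarrow> (\<lambda>x. g x \<bullet> b) \<in> orlicz_space A S"
  obtains k where "k > 0" "orlicz_modular A S (\<lambda>x. norm (g x) / k) < \<infinity>"
proof -
  note [measurable] = N_function_extend(3)[OF A]
  have "\<forall>b\<in>Basis. \<exists>k>0. orlicz_modular A S (\<lambda>x. (g x \<bullet> b) / k) < \<infinity>"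
    using comp by (auto simp: orlicz_space_def)
  then obtain \<kappa> where \<kappa>: "\<And>b. b \<in> Basis \<Longrightarrow> \<kappa> b > 0" "\<And>b. b \<in> Basis \<Longrightarrow> orlicz_modular A S (\<lambda>x. (g x \<bullet> b) / \<kappa> b) < \<infinity>"
    by metis
  define K where "K = (\<Sum>b\<in>(Basis::'a set). \<kappa> b)"
  have K_ge: "\<kappa> b \<le> K" if "b \<in> Basis" for b
    unfolding K_def using \<kappa>(1) that by (intro member_le_sum) (auto intro: less_imp_le)
  have K0: "K > 0"
    unfolding K_def using \<kappa>(1) by (intro sum_pos) auto
  define N where "N = real DIM('a)"
  have N: "N > 0"
    by (simp add: N_def)
  have pointwise: "A \<bar>norm (g x) / (N * K)\<bar> \<le> (\<Sum>b\<in>Basis. A \<bar>(g x \<bullet> b) / \<kappa> b\<bar>)" for x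
  proof -
    have "norm (g x) / (N * K) \<le> (\<Sum>b\<in>Basis. \<bar>g x \<bullet> b\<bar>) / (N * K)"
      using N K0 by (intro divide_right_mono norm_le_l1) simp
    also have "\<dots> = (\<Sum>b\<in>Basis. (1 / N) * (\<bar>g x \<bullet> b\<bar> / K))"
      by (simp add: sum_divide_distrib)
    also have "\<dots> \<le> (\<Sum>b\<in>Basis. (1 / N) * \<bar>(g x \<bullet> b) / \<kappa> b\<bar>)"
    proof (intro sum_mono mult_left_mono)
      fix b :: 'a assume b: "b \<in> Basis"
      show "\<bar>g x \<bullet> b\<bar> / K \<le> \<bar>(g x \<bullet> b) / \<kappa> b\<bar>"
        using \<kappa>(1)[OF b] K_ge[OF b] by (simp add: abs_divide divide_left_mono)
    qed (use N in simp)
    finally have "A \<bar>norm (g x) / (N * K)\<bar> \<le> A (\<Sum>b\<in>Basis. (1 / N) *\<^sub>R \<bar>(g x \<bullet> b) / \<kappa> b\<bar>)"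
      using N K0 by (intro N_functionD(2)[OF A]) auto
    also have "\<dots> \<le> (\<Sum>b\<in>Basis. (1 / N) * A \<bar>(g x \<bullet> b) / \<kappa> b\<bar>)"
      using N by (intro convex_on_sum[OF _ _ N_functionD(4)[OF A]]) (auto simp: N_def)
    also have "\<dots> \<le> (\<Sum>b\<in>Basis. 1 * A \<bar>(g x \<bullet> b) / \<kappa> b\<bar>)"
      using N_functionD(1)[OF A] by (intro sum_mono mult_right_mono) (auto simp: N_def)
    finally show ?thesis by simp
  qed
  show thesis
  proof (rule that[of "N * K"])
    show "N * K > 0"
      using N K0 by simp
    have [measurable]: "(\<lambda>x. g x \<bullet> b) \<in> borel_measurable (lebesgue_on S)" if "b \<in> Basis" for b
      using comp[OF that] by (simp add: orlicz_space_def)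
    have "orlicz_modular A S (\<lambda>x. norm (g x) / (N * K))
        \<le> (\<integral>\<^sup>+x. (\<Sum>b\<in>Basis. ennreal (A \<bar>(g x \<bullet> b) / \<kappa> b\<bar>)) \<partial>lebesgue_on S)"
      unfolding orlicz_modular_def
      using pointwise N_functionD(1)[OF A] by (intro nn_integral_mono) (simp add: ennreal_leI)
    also have "\<dots> = (\<Sum>b\<in>Basis. orlicz_modular A S (\<lambda>x. (g x \<bullet> b) / \<kappa> b))"
      unfolding orlicz_modular_def by (rule nn_integral_sum) measurable
    also have "\<dots> < \<infinity>"
      using \<kappa>(2) by simp
    finally show "orlicz_modular A S (\<lambda>x. norm (g x) / (N * K)) < \<infinity>" .
  qed
qed

text \<open>Pass to Borel representatives that vanish outside \<open>\<Omega>\<close>. They have the same distribution function, the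
  same modulars and the same integrals against test functions, so the results for
  \<open>symmetrized_function\<close> carry over.\<close>

lemma schwarz_symmetrization_core:
  fixes \<Omega> :: "'a::euclidean_space set" and u :: "'a \<Rightarrow> real" and g :: "'a \<Rightarrow> 'a" and Q :: real
  defines "V \<equiv> measure lebesgue \<Omega>"
  assumes dim: "DIM('a) \<ge> 2" and \<Omega>: "open \<Omega>" "bounded \<Omega>" "\<Omega> \<noteq> {}" and Q: "Q > 0"
    and iso: "\<forall>E \<in> sets lebesgue. E \<subseteq> \<Omega> \<longrightarrow>
      ereal Q * perimeter \<Omega> E \<ge> ereal (min (measure lebesgue E) (measure lebesgue (\<Omega> - E)) powr (1 - 1 / DIM('a)))"
    and A: "N_function A" and g: "has_weak_gradient \<Omega> u g"
    and ui: "integrable (lebesgue_on \<Omega>) u" and g_meas: "g \<in> borel_measurable (lebesgue_on \<Omega>)"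
    and k0: "k0 > 0" "orlicz_modular A \<Omega> (\<lambda>x. norm (g x) / k0) < \<infinity>"
  shows "\<exists>Dv. has_weak_gradient (ball_of_measure V) (schwarz_symmetrization \<Omega> u) Dv \<and>
      Dv \<in> borel_measurable borel \<and>
      (\<forall>\<epsilon> k. 0 < \<epsilon> \<longrightarrow> \<epsilon> < V / 2 \<longrightarrow> 0 < k \<longrightarrow>
        orlicz_modular A (ball_of_measure (V - \<epsilon>)) (\<lambda>x. norm (Dv x) /
          (Q * DIM('a) * ball_const TYPE('a) powr (1 / DIM('a)) * ((V - \<epsilon>) / \<epsilon>) powr (1 - 1 / DIM('a)) * k))
        \<le> orlicz_modular A \<Omega> (\<lambda>x. norm (g x) / k))"
    and "schwarz_symmetrization \<Omega> u \<in> borel_measurable (lebesgue_on (ball_of_measure V))"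
    and "orlicz_modular A (ball_of_measure V) (\<lambda>x. schwarz_symmetrization \<Omega> u x / \<kappa>) = orlicz_modular A \<Omega> (\<lambda>x. u x / \<kappa>)"
    and "0 < c \<Longrightarrow> c \<le> d \<Longrightarrow> d < V \<Longrightarrow>
      abs_continuous_on_interval (\<lambda>s. real_of_ereal (decreasing_rearrangement \<Omega> u s)) c d"
    and "compact K \<Longrightarrow> K \<subseteq> ball_of_measure V \<Longrightarrow> \<exists>\<epsilon>>0. \<epsilon> < V / 2 \<and> K \<subseteq> (ball_of_measure (V - \<epsilon>) :: 'a set)"
proof -
  have \<Omega>_borel [measurable]: "\<Omega> \<in> sets borel"
    using \<Omega> by simp
  have fin: "emeasure lborel \<Omega> < \<infinity>"
    using emeasure_bounded_finite[OF \<Omega>(2)] by simp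
  have V_lborel: "V = measure lborel \<Omega>"
    unfolding V_def by (rule measure_completion) simp
  have "emeasure lborel \<Omega> \<noteq> 0"
  proof
    assume "emeasure lborel \<Omega> = 0"
    then have "\<Omega> \<in> null_sets lebesgue"
      by (intro null_sets_completionI) (simp add: null_sets_def)
    then show False
      using open_not_negligible[OF \<Omega>(1,3)] by (simp add: negligible_iff_null_sets)
  qed
  then have "emeasure lborel \<Omega> > 0"
    by (simp add: zero_less_iff_neq_zero)
  then have V_pos: "V > 0"
    unfolding V_lborel using fin by (simp add: measure_def enn2real_positive_iff)
  obtain u' where u' [measurable]: "u' \<in> borel_measurable borel" and u'0: "\<And>x. x \<notin> \<Omega> \<Longrightarrow> u' x = 0"
      and uu': "AE x in lebesgue. x \<in> \<Omega> \<longrightarrow> u x = u' x"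
    using borel_representative[OF \<Omega>_borel borel_measurable_integrable[OF ui]] by blast
  obtain g' where g' [measurable]: "g' \<in> borel_measurable borel" and g'0: "\<And>x. x \<notin> \<Omega> \<Longrightarrow> g' x = 0"
      and gg': "AE x in lebesgue. x \<in> \<Omega> \<longrightarrow> g x = g' x"
    using borel_representative[OF \<Omega>_borel g_meas] by blast
  have fin_on: "finite_measure (lebesgue_on \<Omega>)"
    using fin by (intro finite_measureI) (simp add: emeasure_restrict_space space_restrict_space emeasure_completion)
  have "(\<integral>\<^sup>+x. ennreal (A (norm (g x) / k0)) \<partial>lebesgue_on \<Omega>) < \<infinity>"
    using k0 by (simp add: orlicz_modular_def)
  then have gi: "integrable (lebesgue_on \<Omega>) g"
    by (rule integrable_of_modular[OF A g_meas k0(1) fin_on])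
  have u'i: "integrable lborel u'"
    using ui lebesgue_on_representative(2)[OF \<Omega>_borel borel_measurable_integrable[OF ui] u' u'0 uu'] by simp
  have g'i: "integrable lborel g'"
    using gi lebesgue_on_representative(2)[OF \<Omega>_borel g_meas g' g'0 gg'] by simp
  have weak': "(\<integral>x. u' x * frechet_derivative \<phi> (at x) b \<partial>lborel) = - (\<integral>x. (g' x \<bullet> b) * \<phi> x \<partial>lborel)"
    if \<phi>: "\<phi> \<in> C1_compact_support \<Omega>" and b: "b \<in> Basis" for \<phi> b
  proof -
    note [measurable] = C1_compact_support_measurable[OF \<phi>]
    have leb: "\<psi> \<in> borel_measurable (lebesgue_on \<Omega>)" if "\<psi> \<in> borel_measurable borel" for \<psi> :: "'a \<Rightarrow> real"
      using that by (intro measurable_restrict_space1 measurable_completion) simp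
    have "(LINT x|lebesgue_on \<Omega>. u x * frechet_derivative \<phi> (at x) b) = (\<integral>x. u' x * frechet_derivative \<phi> (at x) b \<partial>lborel)"
    proof (rule lebesgue_on_representative(1)[OF \<Omega>_borel])
      show "(\<lambda>x. u x * frechet_derivative \<phi> (at x) b) \<in> borel_measurable (lebesgue_on \<Omega>)"
        by (intro borel_measurable_times borel_measurable_integrable[OF ui] leb C1_compact_support_measurable[OF \<phi>])
      show "AE x in lebesgue. x \<in> \<Omega> \<longrightarrow> u x * frechet_derivative \<phi> (at x) b = u' x * frechet_derivative \<phi> (at x) b"
        using uu' by eventually_elim simp
    qed (simp_all add: u'0)
    moreover have "(LINT x|lebesgue_on \<Omega>. (g x \<bullet> b) * \<phi> x) = (\<integral>x. (g' x \<bullet> b) * \<phi> x \<partial>lborel)"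
    proof (rule lebesgue_on_representative(1)[OF \<Omega>_borel])
      show "(\<lambda>x. (g x \<bullet> b) * \<phi> x) \<in> borel_measurable (lebesgue_on \<Omega>)"
        by (intro borel_measurable_times borel_measurable_inner g_meas borel_measurable_const leb C1_compact_support_measurable[OF \<phi>])
      show "AE x in lebesgue. x \<in> \<Omega> \<longrightarrow> (g x \<bullet> b) * \<phi> x = (g' x \<bullet> b) * \<phi> x"
        using gg' by eventually_elim simp
    qed (simp_all add: g'0)
    ultimately show ?thesis
      using g \<phi> b unfolding has_weak_gradient_def by simp
  qed
  interpret R: rearranged_function \<Omega> u'
    by unfold_locales (use fin in simp_all)
  interpret S: symmetrized_function \<Omega> u' g' "1 - 1 / DIM('a)" Q
  proof (unfold_locales)
    show "0 < rearranged_function.V \<Omega>"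
      using V_pos by (simp add: R.V_def V_lborel)
  qed (use \<Omega> fin u'i g'i weak' Q iso g'0 dim V_pos u'0 in \<open>auto simp: rearranged_function.V_def V_lborel\<close>)
  have SV: "R.V = V"
    by (simp add: R.V_def V_lborel)
  have "distribution_function \<Omega> u t = distribution_function \<Omega> u' t" for t
    unfolding distribution_function_def
  proof (rule measure_eq_AE)
    show "AE x in lebesgue. x \<in> {x \<in> \<Omega>. t < u x} \<longleftrightarrow> x \<in> {x \<in> \<Omega>. t < u' x}"
      using uu' by eventually_elim auto
    have "{x \<in> space (lebesgue_on \<Omega>). t < u x} \<in> sets (lebesgue_on \<Omega>)"
      using borel_measurable_integrable[OF ui] by measurable
    then show "{x \<in> \<Omega>. t < u x} \<in> sets lebesgue"
      by (simp add: space_restrict_space sets_restrict_space_iff)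
  qed simp
  then have dr: "decreasing_rearrangement \<Omega> u = decreasing_rearrangement \<Omega> u'"
    unfolding decreasing_rearrangement_def by simp
  then have ss: "schwarz_symmetrization \<Omega> u = schwarz_symmetrization \<Omega> u'"
    by (simp add: schwarz_symmetrization_def fun_eq_iff)
  have mu: "orlicz_modular A \<Omega> (\<lambda>x. u x / k) = orlicz_modular A \<Omega> (\<lambda>x. u' x / k)" for k
    using uu' by (intro orlicz_modular_cong_AE) (auto elim: eventually_mono)
  have mg: "orlicz_modular A \<Omega> (\<lambda>x. norm (g x) / k) = orlicz_modular A \<Omega> (\<lambda>x. norm (g' x) / k)" for k
    using gg' by (intro orlicz_modular_cong_AE) (auto elim: eventually_mono)
  have mod: "(\<integral>\<^sup>+x. ennreal (A (norm (g' x) / k0)) \<partial>lborel) < \<infinity>"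
    using k0 S.modular_gradient[OF A k0(1)] by (simp add: mg)
  have Dv_mod: "orlicz_modular A (ball_of_measure (V - \<epsilon>)) (\<lambda>x. norm (S.Dv x) /
      (Q * DIM('a) * ball_const TYPE('a) powr (1 / DIM('a)) * ((V - \<epsilon>) / \<epsilon>) powr (1 - 1 / DIM('a)) * k))
    \<le> orlicz_modular A \<Omega> (\<lambda>x. norm (g x) / k)" if "0 < \<epsilon>" "\<epsilon> < V / 2" "0 < k" for \<epsilon> k
    using S.modular_Dv[OF A that(3), of \<epsilon>] that by (simp add: SV mg S.gradient_factor_def)
  show "\<exists>Dv. has_weak_gradient (ball_of_measure V) (schwarz_symmetrization \<Omega> u) Dv \<and>
      Dv \<in> borel_measurable borel \<and>
      (\<forall>\<epsilon> k. 0 < \<epsilon> \<longrightarrow> \<epsilon> < V / 2 \<longrightarrow> 0 < k \<longrightarrow>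
        orlicz_modular A (ball_of_measure (V - \<epsilon>)) (\<lambda>x. norm (Dv x) /
          (Q * DIM('a) * ball_const TYPE('a) powr (1 / DIM('a)) * ((V - \<epsilon>) / \<epsilon>) powr (1 - 1 / DIM('a)) * k))
        \<le> orlicz_modular A \<Omega> (\<lambda>x. norm (g x) / k))"
  proof (intro exI[of _ S.Dv] conjI allI impI)
    show "has_weak_gradient (ball_of_measure V) (schwarz_symmetrization \<Omega> u) S.Dv"
      using S.has_weak_gradient_schwarz[OF A k0(1) mod] by (simp add: SV ss)
    show "S.Dv \<in> borel_measurable borel"
      by (rule S.Dv_borel)
  qed (rule Dv_mod)
  show "schwarz_symmetrization \<Omega> u \<in> borel_measurable (lebesgue_on (ball_of_measure V))"
    using S.v_measurable by (simp add: SV ss)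
  show "orlicz_modular A (ball_of_measure V) (\<lambda>x. schwarz_symmetrization \<Omega> u x / \<kappa>) = orlicz_modular A \<Omega> (\<lambda>x. u x / \<kappa>)"
    using S.schwarz_modular[OF A, of \<kappa>] by (simp add: SV ss mu)
  show "abs_continuous_on_interval (\<lambda>s. real_of_ereal (decreasing_rearrangement \<Omega> u s)) c d"
    if "0 < c" "c \<le> d" "d < V"
    using S.rearrangement_abs_continuous[of c d] that by (simp add: SV dr R.r_def[abs_def])
  show "\<exists>\<epsilon>>0. \<epsilon> < V / 2 \<and> K \<subseteq> (ball_of_measure (V - \<epsilon>) :: 'a set)" if K: "compact K" "K \<subseteq> ball_of_measure V"
  proof -
    obtain \<epsilon> where "0 < \<epsilon>" "\<epsilon> < V / 2" "K \<subseteq> ball_of_measure (V - \<epsilon>)"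
      using S.compact_subset_ball_of_measure[of K] K unfolding SV by blast
    then show ?thesis by blast
  qed
qed

text \<open>The result in an arbitrary Euclidean space. The selected weak gradient of \<open>u\<close> need not be the one whose
  coordinates are known to lie in the Orlicz space. For the norm inequality the core result is therefore
  applied anew to the selected gradient, for each \<open>k\<close> that competes in its norm; if there is no such \<open>k\<close>,
  the right-hand side is infinite.\<close>

theorem schwarz_symmetrization_orlicz:
  fixes \<Omega> :: "'a::euclidean_space set" and u :: "'a \<Rightarrow> real" and Q :: real
  defines "V \<equiv> measure lebesgue \<Omega>"
  assumes dim: "DIM('a) \<ge> 2" and \<Omega>: "open \<Omega>" "bounded \<Omega>" "\<Omega> \<noteq> {}" and Q: "Q > 0"
    and iso: "\<forall>E \<in> sets lebesgue. E \<subseteq> \<Omega> \<longrightarrow>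
      ereal Q * perimeter \<Omega> E \<ge> ereal (min (measure lebesgue E) (measure lebesgue (\<Omega> - E)) powr (1 - 1 / DIM('a)))"
    and A: "N_function A" and u: "u \<in> orlicz_sobolev A \<Omega>"
  shows "schwarz_symmetrization \<Omega> u \<in> orlicz_sobolev_loc A (ball_of_measure V)"
    and "\<And>\<epsilon>. 0 < \<epsilon> \<Longrightarrow> \<epsilon> < V / 2 \<Longrightarrow>
      orlicz_norm A (ball_of_measure (V - \<epsilon>))
        (\<lambda>x. norm (weak_gradient (ball_of_measure V) (schwarz_symmetrization \<Omega> u) x))
      \<le> ennreal (Q * DIM('a) * ball_const TYPE('a) powr (1 / DIM('a)) * ((V - \<epsilon>) / \<epsilon>) powr (1 - 1 / DIM('a)))
        * orlicz_norm A \<Omega> (\<lambda>x. norm (weak_gradient \<Omega> u x))"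
    and "\<And>c d. 0 < c \<Longrightarrow> c \<le> d \<Longrightarrow> d < V \<Longrightarrow>
      abs_continuous_on_interval (\<lambda>s. real_of_ereal (decreasing_rearrangement \<Omega> u s)) c d"
proof -
  let ?v = "schwarz_symmetrization \<Omega> u" and ?W = "ball_of_measure V :: 'a set"
  have \<Omega>_borel: "\<Omega> \<in> sets borel"
    using \<Omega> by simp
  have W_open: "open ?W" and W_sets: "(ball_of_measure m :: 'a set) \<in> sets lebesgue" for m
    by (simp_all add: ball_of_measure_def)
  have u_space: "u \<in> orlicz_space A \<Omega>"
    using u by (simp add: orlicz_sobolev_def)
  then obtain \<kappa> where u_meas: "u \<in> borel_measurable (lebesgue_on \<Omega>)" and \<kappa>: "\<kappa> > 0"
      and u_mod: "orlicz_modular A \<Omega> (\<lambda>x. u x / \<kappa>) < \<infinity>"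
    by (auto simp: orlicz_space_def)
  have fin_on: "finite_measure (lebesgue_on \<Omega>)"
    using emeasure_bounded_finite[OF \<Omega>(2)] \<Omega>_borel
    by (intro finite_measureI) (simp add: emeasure_restrict_space space_restrict_space emeasure_completion)
  have "(\<integral>\<^sup>+x. ennreal (A (norm (u x) / \<kappa>)) \<partial>lebesgue_on \<Omega>) < \<infinity>"
    using u_mod \<kappa> by (simp add: orlicz_modular_def)
  then have ui: "integrable (lebesgue_on \<Omega>) u"
    by (rule integrable_of_modular[OF A u_meas \<kappa> fin_on])
  obtain g0 where g0: "has_weak_gradient \<Omega> u g0" "\<And>b. b \<in> Basis \<Longrightarrow> (\<lambda>x. g0 x \<bullet> b) \<in> orlicz_space A \<Omega>"
    using u by (auto simp: orlicz_sobolev_def)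
  obtain k0 where k0: "k0 > 0" "orlicz_modular A \<Omega> (\<lambda>x. norm (g0 x) / k0) < \<infinity>"
    using orlicz_gradient_norm_modular[OF A g0(2)] by blast
  have g0_meas: "g0 \<in> borel_measurable (lebesgue_on \<Omega>)"
    using g0(2) by (subst borel_measurable_euclidean_space) (auto simp: orlicz_space_def)
  note core = schwarz_symmetrization_core[OF dim \<Omega> Q iso A g0(1) ui g0_meas k0, folded V_def]
  obtain Dv where Dv: "has_weak_gradient ?W ?v Dv" "Dv \<in> borel_measurable borel"
      and Dv_mod: "\<And>\<epsilon> k. 0 < \<epsilon> \<Longrightarrow> \<epsilon> < V / 2 \<Longrightarrow> 0 < k \<Longrightarrow>
        orlicz_modular A (ball_of_measure (V - \<epsilon>)) (\<lambda>x. norm (Dv x) /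
        (Q * DIM('a) * ball_const TYPE('a) powr (1 / DIM('a)) * ((V - \<epsilon>) / \<epsilon>) powr (1 - 1 / DIM('a)) * k))
        \<le> orlicz_modular A \<Omega> (\<lambda>x. norm (g0 x) / k)"
    using core(1) by blast
  note v_meas = core(2) and v_mod = core(3) and ac = core(4) and exhaust = core(5)
  define C where "C \<epsilon> = Q * DIM('a) * ball_const TYPE('a) powr (1 / DIM('a)) * ((V - \<epsilon>) / \<epsilon>) powr (1 - 1 / DIM('a))" for \<epsilon>
  have C_pos: "C \<epsilon> > 0" if "0 < \<epsilon>" "\<epsilon> < V / 2" for \<epsilon>
    unfolding C_def using that Q ball_const_pos[where 'a = 'a] by simp
  show "abs_continuous_on_interval (\<lambda>s. real_of_ereal (decreasing_rearrangement \<Omega> u s)) c d"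
    if "0 < c" "c \<le> d" "d < V" for c d
    using that by (rule ac)
  show "?v \<in> orlicz_sobolev_loc A ?W"
    unfolding orlicz_sobolev_loc_def
  proof (intro CollectI allI impI)
    fix U :: "'a set" assume U: "open U \<and> compact (closure U) \<and> closure U \<subseteq> ?W"
    then have OW: "U \<subseteq> ?W" and U_sets: "U \<in> sets lebesgue"
      using closure_subset[of U] by auto
    obtain \<epsilon> where \<epsilon>: "0 < \<epsilon>" "\<epsilon> < V / 2" "U \<subseteq> ball_of_measure (V - \<epsilon>)"
      using exhaust[of "closure U"] U closure_subset[of U] by blast
    have "?v \<in> borel_measurable (lebesgue_on U)"
      using v_meas measurable_restrict_mono OW by blast
    moreover have "orlicz_modular A U (\<lambda>x. ?v x / \<kappa>) < \<infinity>"
      using orlicz_modular_mono_set[OF U_sets W_sets OW, of A "\<lambda>x. ?v x / \<kappa>"] u_mod unfolding v_mod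
      by (rule le_less_trans)
    ultimately have v_space: "?v \<in> orlicz_space A U"
      using \<kappa> by (auto simp: orlicz_space_def)
    have "(\<lambda>x. Dv x \<bullet> b) \<in> orlicz_space A U" if b: "b \<in> Basis" for b
    proof -
      have "(\<lambda>x. Dv x \<bullet> b) \<in> borel_measurable (lebesgue_on U)"
        using Dv(2) by (intro measurable_restrict_space1 measurable_completion) simp
      moreover have "orlicz_modular A U (\<lambda>x. (Dv x \<bullet> b) / (C \<epsilon> * k0)) < \<infinity>"
      proof -
        have "orlicz_modular A U (\<lambda>x. (Dv x \<bullet> b) / (C \<epsilon> * k0)) \<le> orlicz_modular A U (\<lambda>x. norm (Dv x) / (C \<epsilon> * k0))"
          using Basis_le_norm[OF b] by (intro orlicz_modular_mono[OF A]) (simp add: abs_divide divide_right_mono)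
        also have "\<dots> \<le> orlicz_modular A (ball_of_measure (V - \<epsilon>)) (\<lambda>x. norm (Dv x) / (C \<epsilon> * k0))"
          by (rule orlicz_modular_mono_set[OF U_sets W_sets \<epsilon>(3)])
        also have "\<dots> \<le> orlicz_modular A \<Omega> (\<lambda>x. norm (g0 x) / k0)"
          unfolding C_def by (rule Dv_mod[OF \<epsilon>(1,2) k0(1)])
        also have "\<dots> < \<infinity>"
          by (rule k0(2))
        finally show ?thesis .
      qed
      moreover have "C \<epsilon> * k0 > 0"
        using C_pos[OF \<epsilon>(1,2)] k0(1) by simp
      ultimately show ?thesis
        by (auto simp: orlicz_space_def)
    qed
    moreover have "has_weak_gradient U ?v Dv"
      using has_weak_gradient_subset[OF Dv(1) _ OW W_open] U by blast
    ultimately show "?v \<in> orlicz_sobolev A U"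
      using v_space by (auto simp: orlicz_sobolev_def)
  qed
  fix \<epsilon> :: real assume \<epsilon>: "0 < \<epsilon>" "\<epsilon> < V / 2"
  let ?B = "ball_of_measure (V - \<epsilon>) :: 'a set"
  define G where "G = weak_gradient \<Omega> u"
  have G: "has_weak_gradient \<Omega> u G"
    unfolding G_def weak_gradient_def by (rule someI[of "has_weak_gradient \<Omega> u", OF g0(1)])
  define D' where "D' = weak_gradient ?W ?v"
  have D': "has_weak_gradient ?W ?v D'"
    unfolding D'_def weak_gradient_def by (rule someI[of "has_weak_gradient ?W ?v", OF Dv(1)])
  have cB: "compact (closure ?B)" "closure ?B \<subseteq> ?W" "open ?B"
  proof -
    show "compact (closure ?B)" "open ?B"
      by (simp_all add: ball_of_measure_def)
    have "((V - \<epsilon>) / ball_const TYPE('a)) powr (1 / DIM('a)) < (V / ball_const TYPE('a)) powr (1 / DIM('a))"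
      using \<epsilon> ball_const_pos[where 'a = 'a] by (intro powr_less_mono2) (auto simp: divide_strict_right_mono)
    then have "cball (0::'a) (((V - \<epsilon>) / ball_const TYPE('a)) powr (1 / DIM('a))) \<subseteq> ?W"
      by (auto simp: ball_of_measure_def)
    then show "closure ?B \<subseteq> ?W"
      unfolding ball_of_measure_def by (meson closed_cball closure_minimal ball_subset_cball order_trans)
  qed
  have G_meas: "G \<in> borel_measurable (lebesgue_on \<Omega>)"
    using G \<Omega>(1) by (intro locally_integrable_measurable) (simp_all add: has_weak_gradient_def)
  have key: "orlicz_norm A ?B (\<lambda>x. norm (D' x)) \<le> ennreal (C \<epsilon> * k)"
    if k: "k > 0" "orlicz_modular A \<Omega> (\<lambda>x. norm (G x) / k) \<le> 1" for k
  proof -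
    have "orlicz_modular A \<Omega> (\<lambda>x. norm (G x) / k) < \<infinity>"
      using k(2) by (rule le_less_trans) simp
    then obtain DG where DG: "has_weak_gradient ?W ?v DG"
      and DG_mod: "\<And>\<epsilon> k. 0 < \<epsilon> \<Longrightarrow> \<epsilon> < V / 2 \<Longrightarrow> 0 < k \<Longrightarrow>
        orlicz_modular A (ball_of_measure (V - \<epsilon>)) (\<lambda>x. norm (DG x) /
        (Q * DIM('a) * ball_const TYPE('a) powr (1 / DIM('a)) * ((V - \<epsilon>) / \<epsilon>) powr (1 - 1 / DIM('a)) * k))
        \<le> orlicz_modular A \<Omega> (\<lambda>x. norm (G x) / k)"
      using schwarz_symmetrization_core[OF dim \<Omega> Q iso A G ui G_meas k(1), folded V_def] by blast
    have "AE x in lebesgue. x \<in> ?B \<longrightarrow> D' x = DG x"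
      by (rule weak_gradient_unique[OF D' DG W_open cB(3,1,2)])
    then have "orlicz_modular A ?B (\<lambda>x. norm (D' x) / (C \<epsilon> * k)) = orlicz_modular A ?B (\<lambda>x. norm (DG x) / (C \<epsilon> * k))"
      by (intro orlicz_modular_cong_AE[OF W_sets]) (auto elim: eventually_mono)
    also have "\<dots> \<le> 1"
      using DG_mod[OF \<epsilon> k(1)] k(2) unfolding C_def by (rule order_trans)
    finally show ?thesis
      unfolding orlicz_norm_def using C_pos[OF \<epsilon>] k(1) by (intro Inf_lower) auto
  qed
  show "orlicz_norm A ?B (\<lambda>x. norm (weak_gradient ?W ?v x))
      \<le> ennreal (Q * DIM('a) * ball_const TYPE('a) powr (1 / DIM('a)) * ((V - \<epsilon>) / \<epsilon>) powr (1 - 1 / DIM('a)))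
        * orlicz_norm A \<Omega> (\<lambda>x. norm (weak_gradient \<Omega> u x))"
  proof -
    let ?L = "orlicz_norm A ?B (\<lambda>x. norm (D' x))"
    have c: "ennreal (C \<epsilon>) \<noteq> 0" "ennreal (C \<epsilon>) \<noteq> top"
      using C_pos[OF \<epsilon>] by simp_all
    have "?L / ennreal (C \<epsilon>) \<le> orlicz_norm A \<Omega> (\<lambda>x. norm (G x))"
      unfolding orlicz_norm_def[of A \<Omega>]
    proof (rule Inf_greatest, clarify)
      fix k :: real assume k: "0 < k" "orlicz_modular A \<Omega> (\<lambda>x. norm (G x) / k) \<le> 1"
      have "?L / ennreal (C \<epsilon>) \<le> ennreal (C \<epsilon> * k) / ennreal (C \<epsilon>)"
        by (intro divide_right_mono_ennreal key k)
      also have "\<dots> = ennreal k"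
        using C_pos[OF \<epsilon>] k(1) by (simp add: divide_ennreal)
      finally show "?L / ennreal (C \<epsilon>) \<le> ennreal k" .
    qed
    then have "ennreal (C \<epsilon>) * (?L / ennreal (C \<epsilon>)) \<le> ennreal (C \<epsilon>) * orlicz_norm A \<Omega> (\<lambda>x. norm (G x))"
      by (rule mult_left_mono) simp
    moreover have "ennreal (C \<epsilon>) * (?L / ennreal (C \<epsilon>)) = ?L"
      using c by (simp add: ennreal_times_divide mult.commute[of "ennreal (C \<epsilon>)"] mult_divide_eq_ennreal)
    ultimately show ?thesis
      by (simp add: C_def D'_def G_def)
  qed
qed

theorem theorem3p4:
  fixes \<Omega> :: "(real ^ 'n) set" and u :: "real ^ 'n \<Rightarrow> real"
    and A :: "real \<Rightarrow> real" and Q :: real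
  assumes "CARD('n) \<ge> 2"
    and "bounded_lipschitz_domain \<Omega>"
    and "Q > 0"
    and "\<And>E. E \<in> sets lebesgue \<Longrightarrow> E \<subseteq> \<Omega> \<Longrightarrow>
      ereal Q * perimeter \<Omega> E \<ge>
        ereal (min (measure lebesgue E) (measure lebesgue (\<Omega> - E)) powr (1 - 1 / CARD('n)))"
    and "N_function A"
    and "Delta2_near_infinity A"
    and "u \<in> orlicz_sobolev A \<Omega>"
  shows "schwarz_symmetrization \<Omega> u \<in> orlicz_sobolev_loc A (ball_of_measure (measure lebesgue \<Omega>)) \<and>
    (\<forall>\<epsilon>. 0 < \<epsilon> \<and> \<epsilon> < measure lebesgue \<Omega> / 2 \<longrightarrow>
      orlicz_norm A (ball_of_measure (measure lebesgue \<Omega> - \<epsilon>))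
        (\<lambda>x. norm (weak_gradient (ball_of_measure (measure lebesgue \<Omega>)) (schwarz_symmetrization \<Omega> u) x))
      \<le> ennreal (Q * CARD('n) * ball_const TYPE(real ^ 'n) powr (1 / CARD('n))
                 * ((measure lebesgue \<Omega> - \<epsilon>) / \<epsilon>) powr (1 - 1 / CARD('n)))
        * orlicz_norm A \<Omega> (\<lambda>x. norm (weak_gradient \<Omega> u x))) \<and>
    (\<forall>\<epsilon>. 0 < \<epsilon> \<and> \<epsilon> < measure lebesgue \<Omega> / 2 \<longrightarrow>
      AC_loc (\<lambda>s. real_of_ereal (decreasing_rearrangement \<Omega> u s)) \<epsilon> (measure lebesgue \<Omega> - \<epsilon>))"
proof -
  have dim: "DIM(real ^ 'n) = CARD('n)"
    by simp
  have \<Omega>: "open \<Omega>" "bounded \<Omega>" "\<Omega> \<noteq> {}"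
    using assms(2) by (auto simp: bounded_lipschitz_domain_def)
  have iso: "\<forall>E \<in> sets lebesgue. E \<subseteq> \<Omega> \<longrightarrow> ereal Q * perimeter \<Omega> E \<ge>
      ereal (min (measure lebesgue E) (measure lebesgue (\<Omega> - E)) powr (1 - 1 / CARD('n)))"
    using assms(4) by blast
  note main = schwarz_symmetrization_orlicz[of \<Omega> Q A u, unfolded dim,
    OF assms(1) \<Omega> assms(3) iso assms(5) assms(7)]
  show ?thesis
    using main(1,2) by (auto simp: AC_loc_def intro!: main(3))
qed

end
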